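(* Let $d=1$ and $N\geq 1$, and let $H^{(N)}$ be the $N$-particle Anderson Hamiltonian described in the context. For every localization length $m>0$ and decay parameter $p>0$ there exist explicit constants $C(m,N,p)$ and $C(m,N,p,\|\rho\|_\infty,L_0)$ (also allowed to depend on the fixed quantities $d,\beta,\gamma,\tau$ and the density $\rho$) such that the following holds: if the initial length scale $L_0\geq 1$ and the disorder parameter $\lambda>0$ satisfy $$L_0\geq C(m,N,p)\qquad\text{and}\qquad \lambda\geq C(m,N,p,\|\rho\|_\infty,L_0),$$ then for all $L\geq L_0$, $$\inf_{\mathbf a\in\mathbb Z^{Nd}}\mathbb P\big(\Lambda_L^{(N)}(\mathbf a)\text{ is } m\text{-localizing for } H^{(N)}\big)\geq 1-L^{-p}.$$
   Context: Fix parameters $\beta,\tau\in(0,1)$ and $\gamma>1$ with $\beta<\gamma^{-1}<1<\gamma<2$ and $\max(\gamma\beta,\gamma^{-1})<\tau<1$. Points of $\mathbb Z^{Nd}$ are written $\mathbf x=(x_1,\dots,x_N)$ with $x_j\in\mathbb Z^d$; the symmetric group $S_N$ acts by $\pi\mathbf x=(x_{\pi(1)},\dots,x_{\pi(N)})$. The symmetrized distance is $d_S(\mathbf x,\mathbf y)=\min_{\pi\in S_N}\|\mathbf x-\pi\mathbf y\|_\infty$. For $\mathbf a\in\mathbb Z^{Nd}$ and real $L>0$, $\Lambda_L^{(N)}(\mathbf a)=\{\mathbf x\in\mathbb Z^{Nd}: d_S(\mathbf x,\mathbf a)\leq L\}$. Random potential: $\mathcal V=\{\mathcal V(u)\}_{u\in\mathbb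 Z^d}$ are i.i.d. random variables with density $\rho$ such that (i) $\operatorname{supp}\rho\subseteq[0,v_{\max}]$ for some $v_{\max}>0$; (ii) there are $\rho_{\min},\rho_{\max}>0$ with $\rho_{\min}\le\rho(v)\le\rho_{\max}$ for all $v\in[0,v_{\max}]$; (iii) $\rho$ is continuously differentiable on $(0,v_{\max})$ with $\rho'$ bounded there. The interaction $\mathcal U:\mathbb Z^d\to\mathbb R$ has finite support, and $\lambda>0$. The $N$-particle Hamiltonian on $\ell^2(\mathbb Z^{Nd})$ is $H^{(N)}=-\Delta^{(N)}+\lambda V+U$, where $(\Delta^{(N)}\varphi)(\mathbf x)=\sum_{\mathbf y:\|\mathbf y-\mathbf x\|_1=1}\varphi(\mathbf y)$, $V(\mathbf x)=\sum_{j=1}^N\mathcal V(x_j)$, $U(\mathbf x)=\sum_{1\le i<j\le N}\mathcal U(x_i-x_j)$. For $\Theta\subseteq\mathbb Z^{Nd}$, $H_\Theta=1_\Theta H1_\Theta$ acting on $\ell^2(\Theta)$. Localization: for $\Lambda_L=\Lambda_L^{(N)}(\mathbf a)$, $\mathbf x\in\Lambda_L$ and $m>0$, $\varphi\in\ell^2(\Lambda_L)$ is $(\mathbf x,m)$-localizing if $\|\varphi\|_{\ell^2}=1$ and $|\varphi(\mathbf y)|\le e^{-m\,d_S(\mathbf y,\mathbf x)}$ for all $\mathbf y\in\Lambda_L$ with $d_S(\mathbf y,\mathbf x)\ge L^\tau$; it is $m$-localizing if it is $(\mathbf x,m)$-localizing for some $\mathbf x\in\Lambda_L$. The cube $\Lambda_L$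 is $m$-localizing for $H$ if $H_{\Lambda_L}$ has an orthonormal eigenbasis (eigenvalues repeated according to multiplicity) all of whose elements are $m$-localizing. *)

theory Defs
  imports "HOL-Probability.Probability" "HOL-Combinatorics.Permutations"
begin

text \<open>Dimension d = 1. An N-particle configuration x = (x_0,...,x_{N-1}) in Z^N is
  represented as a function nat => int that vanishes at indices >= N.\<close>

type_synonym config = "nat \<Rightarrow> int"

definition configs :: "nat \<Rightarrow> config set" where
  "configs N = {x. \<forall>j\<ge>N. x j = 0}"

definition linf :: "nat \<Rightarrow> config \<Rightarrow> int" where
  "linf N z = Max {\<bar>z j\<bar> | j. j < N}"

definition lone :: "nat \<Rightarrow> config \<Rightarrow> int" where
  "lone N z = (\<Sum>j<N. \<bar>z j\<bar>)"

definition dS :: "nat \<Rightarrow> config \<Rightarrow> config \<Rightarrow> real" where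
  "dS N x y = real_of_int (Min {linf N (\<lambda>j. x j - y (\<pi> j)) | \<pi>. \<pi> permutes {..<N}})"

definition cube :: "nat \<Rightarrow> real \<Rightarrow> config \<Rightarrow> config set" where
  "cube N L a = {x \<in> configs N. dS N x a \<le> L}"

text \<open>Matrix elements H(x,y) of H = -Delta + lambda V + U, for a given realization
  pot : Z -> R of the random potential and interaction Uint : Z -> R.\<close>
definition ham :: "nat \<Rightarrow> real \<Rightarrow> (int \<Rightarrow> real) \<Rightarrow> (int \<Rightarrow> real) \<Rightarrow> config \<Rightarrow> config \<Rightarrow> real" where
  "ham N lam pot Uint x y =
     (if lone N (\<lambda>j. x j - y j) = 1 then -1 else 0)
     + (if x = y then lam * (\<Sum>j<N. pot (x j)) + (\<Sum>j<N. \<Sum>i<j. Uint (x i - x j)) else 0)"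

definition x_localizing ::
  "nat \<Rightarrow> real \<Rightarrow> real \<Rightarrow> config \<Rightarrow> config \<Rightarrow> real \<Rightarrow> (config \<Rightarrow> complex) \<Rightarrow> bool" where
  "x_localizing N \<tau> L a x m \<phi> \<longleftrightarrow>
     (\<Sum>y\<in>cube N L a. (cmod (\<phi> y))\<^sup>2) = 1 \<and>
     (\<forall>y\<in>cube N L a. dS N y x \<ge> L powr \<tau> \<longrightarrow> cmod (\<phi> y) \<le> exp (- m * dS N y x))"

definition m_localizing ::
  "nat \<Rightarrow> real \<Rightarrow> real \<Rightarrow> config \<Rightarrow> real \<Rightarrow> (config \<Rightarrow> complex) \<Rightarrow> bool" where
  "m_localizing N \<tau> L a m \<phi> \<longleftrightarrow> (\<exists>x\<in>cube N L a. x_localizing N \<tau> L a x m \<phi>)"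

text \<open>The cube is m-localizing for H: H_Lambda = 1_Lambda H 1_Lambda on l^2(Lambda) has an
  orthonormal eigenbasis (card Lambda many orthonormal eigenvectors, indexed by Lambda itself,
  so eigenvalues are repeated according to multiplicity) all of whose elements are m-localizing.\<close>
definition cube_localizing ::
  "nat \<Rightarrow> real \<Rightarrow> real \<Rightarrow> config \<Rightarrow> real \<Rightarrow> real \<Rightarrow> (int \<Rightarrow> real) \<Rightarrow> (int \<Rightarrow> real) \<Rightarrow> bool" where
  "cube_localizing N \<tau> L a m lam pot Uint \<longleftrightarrow>
     (\<exists>(\<phi> :: config \<Rightarrow> config \<Rightarrow> complex) (E :: config \<Rightarrow> complex).
        (\<forall>i\<in>cube N L a. \<forall>k\<in>cube N L a.
           (\<Sum>y\<in>cube N L a. \<phi> i y * cnj (\<phi> k y)) = (if i = k then 1 else 0)) \<and>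
        (\<forall>i\<in>cube N L a. \<forall>x\<in>cube N L a.
           (\<Sum>y\<in>cube N L a. complex_of_real (ham N lam pot Uint x y) * \<phi> i y) = E i * \<phi> i x) \<and>
        (\<forall>i\<in>cube N L a. m_localizing N \<tau> L a m (\<phi> i)))"

definition iid_with_density :: "'a measure \<Rightarrow> (int \<Rightarrow> 'a \<Rightarrow> real) \<Rightarrow> (real \<Rightarrow> real) \<Rightarrow> bool" where
  "iid_with_density M V \<rho> \<longleftrightarrow>
     prob_space M \<and> prob_space.indep_vars M (\<lambda>_. borel) V UNIV \<and>
     (\<forall>u. distributed M lborel (V u) (\<lambda>v. ennreal (\<rho> v)))"

end

theory Submission
  imports Defs "HOL-Real_Asymp.Real_Asymp"
begin

text \<open>
  The proof is a multiscale analysis by induction on the number of particles, along the scales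
  \<open>l, l\<^sup>2, l\<^sup>4, \<dots>\<close>. On the line the symmetrized distance of two configurations is determined by
  their counting functions. If two balls of radius \<open>l\<close> are far apart in this distance, some half-line
  contains a constant number of particles of each configuration of the first ball and a different
  constant number for the second. A common shift of the potential on the half-line therefore moves the
  two spectra at different speeds, and averaging over the shift (this uses the smoothness of the
  density) shows that resonances between the two balls are unlikely.

  A ball is singular at an energy \<open>E\<close> if some solution of the eigenvalue equation fails to decay from
  its boundary to its centre. A ball around a configuration consisting of two distant groups is a
  product of two non-interacting systems with fewer particles; by induction these are localized, so
  such a ball is singular only if it is resonant, and two distant balls are not resonant simultaneously.
  Distant balls around the remaining, clustered configurations depend on disjoint sets of sites and
  are independent. Hence seven distant singular balls of radius \<open>l\<close> at a common energy would produce
  three independent unlikely events, and in their absence non-resonant balls of radius \<open>l\<^sup>2\<close> are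
  non-singular. Finally, if any two singular balls at energy \<open>E\<close> are close to each other, then every
  eigenfunction with eigenvalue \<open>E\<close> decays exponentially away from them. Large disorder is used
  only at the initial scale.
\<close>

section \<open>Symmetrized distance via counting functions\<close>

text \<open>Balls that are far apart in the symmetrized distance may still share sites, so their
  Hamiltonians are correlated and independence says nothing about coincidences of their spectra; the
  different speeds under a half-line shift take its place. A single ball is always singular at some
  energy, namely at an eigenvalue whose eigenfunction does not vanish at the centre. Only a
  coincidence at a common energy can be rare, which is why all estimates concern pairs. Passing from
  \<open>l\<close> to \<open>l * l\<close> turns the target \<open>l powr - P\<close> into
  \<open>l powr - (2 * P)\<close>. Two independent pairs would give exactly this power and leave
  nothing for the number of choices; the third pair pays for them, once \<open>P\<close> exceeds a
  multiple of the number of particles. The seventh ball allows for one split ball, since two of them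
  would resonate. The induction on particles loses decay rate and probability, which is affordable
  because the claim is made for every rate and every power: smaller systems are invoked with larger
  ones. Label sets are arbitrary finite sets, so that a group of particles is again a system without
  renumbering.\<close>

definition confs :: "nat set \<Rightarrow> config set" where
  "confs S = {x. \<forall>j. j \<notin> S \<longrightarrow> x j = 0}"

definition cnt :: "nat set \<Rightarrow> config \<Rightarrow> int \<Rightarrow> int" where
  "cnt S x t = int (card {j \<in> S. x j \<le> t})"

text \<open>Interleaving of the two counting functions: the bottleneck distance of the two point
  sets with multiplicity is at most \<open>r\<close>. Permutations thus disappear until the
  comparison with \<open>dS\<close>.\<close>

definition near :: "nat set \<Rightarrow> nat \<Rightarrow> config \<Rightarrow> config \<Rightarrow> bool" where
  "near S r x y \<longleftrightarrow>
     (\<forall>t. cnt S x t \<le> cnt S y (t + int r) \<and> cnt S y t \<le> cnt S x (t + int r))"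

definition sball :: "nat set \<Rightarrow> nat \<Rightarrow> config \<Rightarrow> config set" where
  "sball S r z = {y \<in> confs S. near S r y z}"

definition neighbours :: "nat set \<Rightarrow> config \<Rightarrow> config set" where
  "neighbours S x = {y. \<exists>j\<in>S. y = x(j := x j + 1) \<or> y = x(j := x j - 1)}"

text \<open>Cubes are regions; intersections of regions are regions, and so are the two factors into which
  a region decomposes around a configuration consisting of two distant groups.\<close>

definition region :: "nat set \<Rightarrow> (int \<Rightarrow> int) \<Rightarrow> (int \<Rightarrow> int) \<Rightarrow> config set" where
  "region S lo hi = {y \<in> confs S. \<forall>t. lo t \<le> cnt S y t \<and> cnt S y t \<le> hi t}"

definition sdist :: "nat set \<Rightarrow> config \<Rightarrow> config \<Rightarrow> nat" where
  "sdist S x y = (LEAST r. near S r x y)"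

definition sites :: "nat set \<Rightarrow> nat \<Rightarrow> config \<Rightarrow> int set" where
  "sites S l z = (\<Union>i\<in>S. {z i - int l..z i + int l})"

section \<open>Counting functions and the distance they define\<close>

lemma cnt_mono: "finite S \<Longrightarrow> s \<le> t \<Longrightarrow> cnt S x s \<le> cnt S x t"
  unfolding cnt_def by (auto intro!: card_mono)

lemma cnt_le_card: "finite S \<Longrightarrow> cnt S x t \<le> int (card S)"
  unfolding cnt_def by (auto intro!: card_mono)

lemma cnt_nonneg: "0 \<le> cnt S x t"
  unfolding cnt_def by simp

lemma cnt_cong: "(\<And>j. j \<in> S \<Longrightarrow> x j = y j) \<Longrightarrow> cnt S x t = cnt S y t"
proof -
  assume a: "\<And>j. j \<in> S \<Longrightarrow> x j = y j"
  have "{j \<in> S. x j \<le> t} = {j \<in> S. y j \<le> t}" using a by auto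
  thus ?thesis unfolding cnt_def by simp
qed

lemma cnt_less_imp_ex:
  assumes "finite S" "cnt S x s < cnt S x t"
  shows "\<exists>j\<in>S. s < x j \<and> x j \<le> t"
proof (rule ccontr)
  assume "\<not> ?thesis"
  hence "{j \<in> S. x j \<le> t} \<subseteq> {j \<in> S. x j \<le> s}" by force
  hence "card {j \<in> S. x j \<le> t} \<le> card {j \<in> S. x j \<le> s}"
    using assms(1) by (intro card_mono) auto
  thus False using assms(2) unfolding cnt_def by simp
qed

lemma cnt_eq_if_none:
  assumes "finite S" "s \<le> t" "\<And>j. j \<in> S \<Longrightarrow> \<not> (s < x j \<and> x j \<le> t)"
  shows "cnt S x s = cnt S x t"
  using cnt_less_imp_ex[OF assms(1), of x s t] cnt_mono[OF assms(1,2), of x] assms(3)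
  by fastforce

lemma near_refl: "finite S \<Longrightarrow> near S r x x"
  unfolding near_def by (auto intro: cnt_mono)

lemma near_sym: "near S r x y \<Longrightarrow> near S r y x"
  unfolding near_def by auto

lemma near_trans: "near S r x y \<Longrightarrow> near S s y z \<Longrightarrow> near S (r + s) x z"
  unfolding near_def
proof (intro allI conjI)
  fix t
  assume a: "\<forall>t. cnt S x t \<le> cnt S y (t + int r) \<and> cnt S y t \<le> cnt S x (t + int r)"
    and b: "\<forall>t. cnt S y t \<le> cnt S z (t + int s) \<and> cnt S z t \<le> cnt S y (t + int s)"
  show "cnt S x t \<le> cnt S z (t + int (r + s))"
    using a[rule_format, of t] b[rule_format, of "t + int r"] by (simp add: algebra_simps)
  show "cnt S z t \<le> cnt S x (t + int (r + s))"
    using a[rule_format, of "t + int s"] b[rule_format, of t] by (simp add: algebra_simps)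
qed

lemma near_mono: "finite S \<Longrightarrow> near S r x y \<Longrightarrow> r \<le> s \<Longrightarrow> near S s x y"
  using near_trans[of S r x y "s - r" y] near_refl[of S "s - r" y] by simp

text \<open>A matching that moves particles by at most \<open>r\<close> injects those up to
  \<open>t\<close> into those up to \<open>t + r\<close>. The converse, special to the line, is
  \<open>matching_of_counts\<close>.\<close>

lemma near_of_bij:
  assumes S: "finite S" and pi: "bij_betw \<pi> S S" and d: "\<And>j. j \<in> S \<Longrightarrow> \<bar>x j - y (\<pi> j)\<bar> \<le> int r"
  shows "near S r x y"
  unfolding near_def
proof (intro allI conjI)
  fix t
  have inj: "inj_on \<pi> S" and im: "\<pi> ` S = S" using pi by (auto simp: bij_betw_def)
  have "card {j \<in> S. x j \<le> t} = card (\<pi> ` {j \<in> S. x j \<le> t})"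
    by (rule card_image[symmetric]) (rule inj_on_subset[OF inj], auto)
  also have "\<dots> \<le> card {j \<in> S. y j \<le> t + int r}"
    using S im d by (intro card_mono) force+
  finally show "cnt S x t \<le> cnt S y (t + int r)" unfolding cnt_def by simp
  have "{j \<in> S. y j \<le> t} \<subseteq> \<pi> ` {j \<in> S. x j \<le> t + int r}"
  proof
    fix k assume k: "k \<in> {j \<in> S. y j \<le> t}"
    then obtain j where j: "j \<in> S" "k = \<pi> j" using im by blast
    with k d[of j] show "k \<in> \<pi> ` {j \<in> S. x j \<le> t + int r}" by auto
  qed
  hence "card {j \<in> S. y j \<le> t} \<le> card (\<pi> ` {j \<in> S. x j \<le> t + int r})"
    using S by (intro card_mono) auto
  also have "\<dots> \<le> card {j \<in> S. x j \<le> t + int r}" using S by (intro card_image_le) auto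
  finally show "cnt S y t \<le> cnt S x (t + int r)" unfolding cnt_def by simp
qed

lemma near_pointwise:
  assumes "finite S" "\<And>j. j \<in> S \<Longrightarrow> \<bar>x j - y j\<bar> \<le> int r"
  shows "near S r x y"
  using near_of_bij[of S id x y r] assms by auto

lemma near_exists: "finite S \<Longrightarrow> \<exists>r. near S r x y"
proof -
  assume S: "finite S"
  have "near S (nat (\<Sum>j\<in>S. \<bar>x j - y j\<bar>)) x y"
  proof (rule near_pointwise[OF S])
    fix j assume "j \<in> S"
    hence "\<bar>x j - y j\<bar> \<le> (\<Sum>j\<in>S. \<bar>x j - y j\<bar>)" using S by (intro member_le_sum) auto
    thus "\<bar>x j - y j\<bar> \<le> int (nat (\<Sum>j\<in>S. \<bar>x j - y j\<bar>))" by simp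
  qed
  thus ?thesis by blast
qed

lemma near_iff_sdist: "finite S \<Longrightarrow> near S r x y \<longleftrightarrow> sdist S x y \<le> r"
proof
  assume S: "finite S"
  show "near S r x y \<Longrightarrow> sdist S x y \<le> r" unfolding sdist_def by (rule Least_le)
  have "near S (sdist S x y) x y"
    unfolding sdist_def using near_exists[OF S] by (rule LeastI_ex)
  thus "sdist S x y \<le> r \<Longrightarrow> near S r x y" using near_mono[OF S] by blast
qed

lemma sdist_sym: "sdist S x y = sdist S y x"
  unfolding sdist_def using near_sym by metis

lemma sdist_triangle: "finite S \<Longrightarrow> sdist S x z \<le> sdist S x y + sdist S y z"
  using near_trans[of S "sdist S x y" x y "sdist S y z" z] near_iff_sdist by blast

lemma sball_iff: "finite S \<Longrightarrow> y \<in> sball S r z \<longleftrightarrow> y \<in> confs S \<and> sdist S y z \<le> r"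
  unfolding sball_def using near_iff_sdist by auto

lemma neighbours_sym: "y \<in> neighbours S x \<longleftrightarrow> x \<in> neighbours S y"
proof -
  have "x \<in> neighbours S y" if "y \<in> neighbours S x" for x y
  proof -
    from that obtain j where j: "j \<in> S" "y = x(j := x j + 1) \<or> y = x(j := x j - 1)"
      unfolding neighbours_def by auto
    hence "x = y(j := y j + 1) \<or> x = y(j := y j - 1)" by auto
    with j show ?thesis unfolding neighbours_def by auto
  qed
  thus ?thesis by blast
qed

lemma neighbours_irrefl: "x \<notin> neighbours S x"
proof
  assume "x \<in> neighbours S x"
  then obtain j where "x = x(j := x j + 1) \<or> x = x(j := x j - 1)" unfolding neighbours_def by auto
  hence "x j = x j + 1 \<or> x j = x j - 1" by (metis fun_upd_same)
  thus False by auto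
qed

lemma neighbours_eq: "neighbours S x = (\<lambda>j. x(j := x j + 1)) ` S \<union> (\<lambda>j. x(j := x j - 1)) ` S"
  unfolding neighbours_def by auto

lemma finite_neighbours: "finite S \<Longrightarrow> finite (neighbours S x)"
  unfolding neighbours_eq by simp

lemma card_neighbours: "finite S \<Longrightarrow> card (neighbours S x) \<le> 2 * card S"
proof -
  assume S: "finite S"
  have "card (neighbours S x) \<le> card ((\<lambda>j. x(j := x j + 1)) ` S) + card ((\<lambda>j. x(j := x j - 1)) ` S)"
    unfolding neighbours_eq by (rule card_Un_le)
  also have "\<dots> \<le> card S + card S" using S by (intro add_mono card_image_le)
  finally show ?thesis by simp
qed

lemma neighbours_near: "finite S \<Longrightarrow> y \<in> neighbours S x \<Longrightarrow> near S 1 y x"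
  by (rule near_pointwise) (auto simp: neighbours_def)

lemma neighbours_sdist: "finite S \<Longrightarrow> y \<in> neighbours S x \<Longrightarrow> sdist S y z \<le> Suc (sdist S x z)"
  using neighbours_near[of S y x] near_iff_sdist[of S 1 y x] sdist_triangle[of S y z x] by simp

lemma finite_sites: "finite S \<Longrightarrow> finite (sites S l z)"
  unfolding sites_def by simp

lemma card_sites: "finite S \<Longrightarrow> card (sites S l z) \<le> card S * (2 * l + 1)"
proof -
  assume S: "finite S"
  have "card (sites S l z) \<le> (\<Sum>i\<in>S. card {z i - int l..z i + int l})"
    unfolding sites_def by (rule card_UN_le[OF S])
  also have "\<dots> = (\<Sum>i\<in>S. 2 * l + 1)" by (intro sum.cong) auto
  finally show ?thesis by simp
qed

text \<open>The counting function of \<open>y\<close> jumps at \<open>y j\<close>; interleaving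
  forces a particle of \<open>z\<close> within distance \<open>l\<close>. Hence the potential energy
  on a ball is determined by the values of the potential on the finite set
  \<open>sites\<close>.\<close>

lemma sball_sites:
  assumes S: "finite S" and y: "y \<in> sball S l z" and j: "j \<in> S"
  shows "y j \<in> sites S l z"
proof -
  have n: "near S l y z" using y unfolding sball_def by auto
  have "{i \<in> S. y i \<le> y j - 1} \<subset> {i \<in> S. y i \<le> y j}" using j by auto
  hence "cnt S y (y j - 1) < cnt S y (y j)"
    unfolding cnt_def using S by (simp add: psubset_card_mono)
  moreover have "cnt S z (y j - 1 - int l) \<le> cnt S y (y j - 1)"
    using n[unfolded near_def, rule_format, of "y j - 1 - int l"] by simp
  moreover have "cnt S y (y j) \<le> cnt S z (y j + int l)"
    using n unfolding near_def by blast
  ultimately have "cnt S z (y j - 1 - int l) < cnt S z (y j + int l)" by linarith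
  then obtain i where "i \<in> S" "y j - 1 - int l < z i" "z i \<le> y j + int l"
    using cnt_less_imp_ex[OF S] by blast
  thus ?thesis unfolding sites_def by force
qed

text \<open>Every coordinate lies in \<open>sites\<close>, so the ball embeds into a finite product.
  The bound is crude but polynomial in \<open>l\<close> for a fixed number of particles, which any
  exponential gain absorbs.\<close>

lemma sball_finite_card:
  assumes S: "finite S"
  shows "finite (sball S l z)" "card (sball S l z) \<le> (card S * (2 * l + 1)) ^ card S"
proof -
  let ?P = "PiE S (\<lambda>_. sites S l z)"
  have inj: "inj_on (\<lambda>y. restrict y S) (sball S l z)"
  proof (rule inj_onI)
    fix x y assume x: "x \<in> sball S l z" and y: "y \<in> sball S l z" and e: "restrict x S = restrict y S"
    show "x = y"
    proof
      fix j show "x j = y j"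
      proof (cases "j \<in> S")
        case True thus ?thesis using e by (metis restrict_apply')
      next
        case False thus ?thesis using x y unfolding sball_def confs_def by auto
      qed
    qed
  qed
  have sub: "(\<lambda>y. restrict y S) ` sball S l z \<subseteq> ?P"
    using sball_sites[OF S] by (auto simp: PiE_iff)
  have fin: "finite ?P" using S finite_sites[OF S] by (intro finite_PiE) auto
  show "finite (sball S l z)" using inj sub fin by (metis finite_imageD finite_subset)
  have "card (sball S l z) \<le> card ?P" by (rule card_inj_on_le[OF inj sub fin])
  also have "\<dots> = card (sites S l z) ^ card S" using S by (simp add: card_PiE)
  also have "\<dots> \<le> (card S * (2 * l + 1)) ^ card S" by (intro power_mono card_sites[OF S]) auto
  finally show "card (sball S l z) \<le> (card S * (2 * l + 1)) ^ card S" .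
qed

section \<open>From counting functions back to permutations\<close>

lemma ex_argmax:
  fixes f :: "'a \<Rightarrow> 'b :: linorder"
  assumes "finite A" "A \<noteq> {}" shows "\<exists>a\<in>A. \<forall>b\<in>A. f b \<le> f a"
proof -
  have "Max (f ` A) \<in> f ` A" using assms by (intro Max_in) auto
  then obtain a where a: "a \<in> A" "f a = Max (f ` A)" by (metis imageE)
  show ?thesis
  proof (rule bexI[OF _ a(1)], rule ballI)
    fix b assume "b \<in> A"
    thus "f b \<le> f a" unfolding a(2) using assms by (intro Max_ge) auto
  qed
qed

text \<open>Greedy matching of the largest points: in dimension one the counting functions
  determine the bottleneck distance.\<close>

lemma matching_of_counts:
  assumes "finite A" "finite B" "card A = card B"
    and "\<And>t. cnt A x t \<le> cnt B y (t + int r)" "\<And>t. cnt B y t \<le> cnt A x (t + int r)"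
  shows "\<exists>\<pi>. bij_betw \<pi> A B \<and> (\<forall>a\<in>A. \<bar>x a - y (\<pi> a)\<bar> \<le> int r)"
  using assms
proof (induction "card A" arbitrary: A B)
  case 0
  hence "A = {}" "B = {}" by auto
  thus ?case by auto
next
  case (Suc n)
  have full: "cnt A x t = int (card A) \<longleftrightarrow> (\<forall>a\<in>A. x a \<le> t)" if "finite A" for A x t
  proof
    assume "cnt A x t = int (card A)"
    hence "card {j \<in> A. x j \<le> t} = card A" unfolding cnt_def by simp
    hence "{j \<in> A. x j \<le> t} = A" using that by (intro card_subset_eq) auto
    thus "\<forall>a\<in>A. x a \<le> t" by blast
  next
    assume "\<forall>a\<in>A. x a \<le> t"
    hence "{j \<in> A. x j \<le> t} = A" by auto
    thus "cnt A x t = int (card A)" unfolding cnt_def by simp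
  qed
  have rem: "cnt (A - {a}) x t = cnt A x t - (if x a \<le> t then 1 else 0)" if "finite A" "a \<in> A" for A a x t
  proof (cases "x a \<le> t")
    case True
    have "{j \<in> A - {a}. x j \<le> t} = {j \<in> A. x j \<le> t} - {a}" by auto
    moreover have "a \<in> {j \<in> A. x j \<le> t}" using True that by auto
    ultimately have "int (card {j \<in> A - {a}. x j \<le> t}) = int (card {j \<in> A. x j \<le> t}) - 1"
      using that card_Suc_Diff1[of "{j \<in> A. x j \<le> t}" a] by simp
    thus ?thesis using True unfolding cnt_def by simp
  next
    case False
    have "{j \<in> A - {a}. x j \<le> t} = {j \<in> A. x j \<le> t}" using False by auto
    thus ?thesis using False unfolding cnt_def by simp
  qed
  have neA: "A \<noteq> {}" and neB: "B \<noteq> {}" using Suc by auto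
  obtain a where a: "a \<in> A" "\<And>a'. a' \<in> A \<Longrightarrow> x a' \<le> x a"
    using ex_argmax[OF Suc.prems(1) neA, of x] by blast
  obtain b where b: "b \<in> B" "\<And>b'. b' \<in> B \<Longrightarrow> y b' \<le> y b"
    using ex_argmax[OF Suc.prems(2) neB, of y] by blast
  have ca: "cnt A x t = int (card A)" if "x a \<le> t" for t
    using full[OF Suc.prems(1)] a that by force
  have cb: "cnt B y t = int (card B)" if "y b \<le> t" for t
    using full[OF Suc.prems(2)] b that by force
  have ca': "cnt A x t \<le> int (card A) - 1" if "\<not> x a \<le> t" for t
    using full[OF Suc.prems(1)] cnt_le_card[OF Suc.prems(1), of x t] a(1) that by force
  have cb': "cnt B y t \<le> int (card B) - 1" if "\<not> y b \<le> t" for t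
    using full[OF Suc.prems(2)] cnt_le_card[OF Suc.prems(2), of y t] b(1) that by force
  \<comment> \<open>The two maxima lie within \<open>r\<close> of each other: at
    \<open>t = x a\<close> all of \<open>A\<close> is counted, so all of \<open>B\<close> must be
    counted at \<open>t + r\<close>, and symmetrically.\<close>
  have yb: "y b \<le> x a + int r"
    using Suc.prems(3) Suc.prems(4)[of "x a"] ca[of "x a"] cb'[of "x a + int r"] by force
  have xa: "x a \<le> y b + int r"
    using Suc.prems(3) Suc.prems(5)[of "y b"] cb[of "y b"] ca'[of "y b + int r"] by force
  have "\<exists>\<pi>. bij_betw \<pi> (A - {a}) (B - {b}) \<and> (\<forall>a'\<in>A - {a}. \<bar>x a' - y (\<pi> a')\<bar> \<le> int r)"
  proof (rule Suc.hyps(1))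
    show "n = card (A - {a})" "card (A - {a}) = card (B - {b})"
      using Suc a b by auto
    show "finite (A - {a})" "finite (B - {b})" using Suc by auto
    fix t
    \<comment> \<open>The delicate case is that only the right-hand count drops. Then
      \<open>t < x a\<close>, so the left count is at most \<open>card A - 1\<close>, while the
      right count was complete before the removal.\<close>
    show "cnt (A - {a}) x t \<le> cnt (B - {b}) y (t + int r)"
      unfolding rem[OF Suc.prems(1) a(1)] rem[OF Suc.prems(2) b(1)]
      using Suc.prems(3) Suc.prems(4)[of t] ca[of t] cb[of "t + int r"] ca'[of t] yb xa by auto
    show "cnt (B - {b}) y t \<le> cnt (A - {a}) x (t + int r)"
      unfolding rem[OF Suc.prems(1) a(1)] rem[OF Suc.prems(2) b(1)]
      using Suc.prems(3) Suc.prems(5)[of t] cb[of t] ca[of "t + int r"] cb'[of t] yb xa by auto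
  qed
  then obtain \<pi> where \<pi>: "bij_betw \<pi> (A - {a}) (B - {b})" "\<forall>a'\<in>A - {a}. \<bar>x a' - y (\<pi> a')\<bar> \<le> int r"
    by blast
  have 1: "bij_betw (\<pi>(a := b)) (A - {a}) (B - {b})"
    using \<pi>(1) by (rule bij_betw_cong[THEN iffD1, rotated]) auto
  have "bij_betw (\<pi>(a := b)) {a} {b}" by (simp add: bij_betw_def)
  from bij_betw_combine[OF 1 this] have "bij_betw (\<pi>(a := b)) A B"
    using a(1) b(1) by (simp add: insert_absorb)
  moreover have "\<forall>a'\<in>A. \<bar>x a' - y ((\<pi>(a := b)) a')\<bar> \<le> int r" using \<pi>(2) xa yb by auto
  ultimately show ?case by blast
qed

lemma linf_le_iff:
  assumes "N \<ge> 1" shows "linf N z \<le> c \<longleftrightarrow> (\<forall>j<N. \<bar>z j\<bar> \<le> c)"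
proof -
  have "{\<bar>z j\<bar> |j. j < N} = (\<lambda>j. \<bar>z j\<bar>) ` {..<N}" by auto
  thus ?thesis unfolding linf_def using assms by (simp add: Max_le_iff lessThan_empty_iff) blast
qed

lemma dS_le_iff_near:
  assumes N: "N \<ge> 1" and c: "c \<ge> 0"
  shows "dS N x y \<le> c \<longleftrightarrow> near {..<N} (nat \<lfloor>c\<rfloor>) x y"
proof -
  let ?D = "{linf N (\<lambda>j. x j - y (\<pi> j)) | \<pi>. \<pi> permutes {..<N}}"
  have D: "?D = (\<lambda>\<pi>. linf N (\<lambda>j. x j - y (\<pi> j))) ` {\<pi>. \<pi> permutes {..<N}}" by auto
  have fin: "finite ?D" unfolding D using finite_permutations[of "{..<N}"] by simp
  have ne: "?D \<noteq> {}" unfolding D using permutes_id[of "{..<N}"] by blast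
  have "dS N x y \<le> c \<longleftrightarrow> Min ?D \<le> \<lfloor>c\<rfloor>" unfolding dS_def by (simp add: le_floor_iff)
  also have "\<dots> \<longleftrightarrow> (\<exists>\<pi>. \<pi> permutes {..<N} \<and> linf N (\<lambda>j. x j - y (\<pi> j)) \<le> \<lfloor>c\<rfloor>)"
    using Min_le_iff[OF fin ne] by auto
  also have "\<dots> \<longleftrightarrow> (\<exists>\<pi>. \<pi> permutes {..<N} \<and> (\<forall>j<N. \<bar>x j - y (\<pi> j)\<bar> \<le> \<lfloor>c\<rfloor>))"
    using linf_le_iff[OF N] by auto
  also have "\<dots> \<longleftrightarrow> near {..<N} (nat \<lfloor>c\<rfloor>) x y"
  proof
    assume "\<exists>\<pi>. \<pi> permutes {..<N} \<and> (\<forall>j<N. \<bar>x j - y (\<pi> j)\<bar> \<le> \<lfloor>c\<rfloor>)"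
    then obtain \<pi> where p: "\<pi> permutes {..<N}" "\<forall>j<N. \<bar>x j - y (\<pi> j)\<bar> \<le> \<lfloor>c\<rfloor>" by blast
    show "near {..<N} (nat \<lfloor>c\<rfloor>) x y"
      by (rule near_of_bij[OF _ permutes_imp_bij[OF p(1)]]) (use p(2) c in auto)
  next
    assume "near {..<N} (nat \<lfloor>c\<rfloor>) x y"
    then obtain \<pi> where \<pi>: "bij_betw \<pi> {..<N} {..<N}" "\<forall>a<N. \<bar>x a - y (\<pi> a)\<bar> \<le> int (nat \<lfloor>c\<rfloor>)"
      using matching_of_counts[of "{..<N}" "{..<N}" x y "nat \<lfloor>c\<rfloor>"] unfolding near_def by auto
    define \<sigma> where "\<sigma> = (\<lambda>j. if j \<in> {..<N} then \<pi> j else j)"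
    have "bij_betw \<sigma> {..<N} {..<N}"
      using \<pi>(1) by (rule bij_betw_cong[THEN iffD1, rotated]) (auto simp: \<sigma>_def)
    hence "\<sigma> permutes {..<N}" by (rule bij_imp_permutes) (auto simp: \<sigma>_def)
    moreover have "\<forall>j<N. \<bar>x j - y (\<sigma> j)\<bar> \<le> \<lfloor>c\<rfloor>" using \<pi>(2) c by (auto simp: \<sigma>_def)
    ultimately show "\<exists>\<pi>. \<pi> permutes {..<N} \<and> (\<forall>j<N. \<bar>x j - y (\<pi> j)\<bar> \<le> \<lfloor>c\<rfloor>)" by blast
  qed
  finally show ?thesis .
qed

text \<open>Two nonnegative numbers with the same nonnegative upper bounds coincide; this is why the
  sign of \<open>dS\<close> is checked separately.\<close>

lemma dS_eq_sdist: assumes N: "N \<ge> 1" shows "dS N x y = real (sdist {..<N} x y)"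
proof -
  have i: "dS N x y \<in> \<int>" unfolding dS_def by simp
  have le: "dS N x y \<le> c \<longleftrightarrow> real (sdist {..<N} x y) \<le> c" if "c \<ge> 0" for c
    using dS_le_iff_near[OF N that, of x y] near_iff_sdist[of "{..<N}" "nat \<lfloor>c\<rfloor>" x y] that
    by (simp add: le_nat_iff le_floor_iff)
  have "dS N x y \<ge> 0"
  proof -
    let ?D = "{linf N (\<lambda>j. x j - y (\<pi> j)) | \<pi>. \<pi> permutes {..<N}}"
    have D: "?D = (\<lambda>\<pi>. linf N (\<lambda>j. x j - y (\<pi> j))) ` {\<pi>. \<pi> permutes {..<N}}" by auto
    have fin: "finite ?D" unfolding D using finite_permutations[of "{..<N}"] by simp
    have ne: "?D \<noteq> {}" unfolding D using permutes_id[of "{..<N}"] by blast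
    obtain \<pi> where "Min ?D = linf N (\<lambda>j. x j - y (\<pi> j))" using Min_in[OF fin ne] by auto
    moreover have "linf N z \<ge> 0" for z
      using linf_le_iff[OF N, of z "linf N z"] N by (metis abs_ge_zero less_eq_Suc_le One_nat_def order.refl order.trans)
    ultimately show ?thesis unfolding dS_def by simp
  qed
  from le[OF this] le[of "real (sdist {..<N} x y)"] show ?thesis by simp
qed

lemma configs_confs: "configs N = confs {..<N}"
  unfolding configs_def confs_def by auto

lemma cube_eq_sball:
  assumes "N \<ge> 1" "L \<ge> 0" shows "cube N L a = sball {..<N} (nat \<lfloor>L\<rfloor>) a"
  unfolding cube_def sball_def configs_confs using dS_le_iff_near[OF assms] by auto

text \<open>Pigeonhole: \<open>2N\<close> particles cannot meet \<open>2N + 1\<close> disjoint windows, so a half-line can be cut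
  where no particle is close. This is where dimension one enters.\<close>

lemma separating_threshold:
  assumes S: "finite S" and far: "\<not> near S ((4 * card S + 2) * l) x y"
  obtains t n1 n2 where "n1 \<noteq> n2"
    "\<And>u. u \<in> sball S l x \<Longrightarrow> cnt S u t = n1" "\<And>u. u \<in> sball S l y \<Longrightarrow> cnt S u t = n2"
proof -
  have main: "\<exists>t. cnt S x (t - int l) = cnt S x (t + int l) \<and> cnt S y (t - int l) = cnt S y (t + int l)
     \<and> cnt S x t \<noteq> cnt S y t"
    if gt: "cnt S x t0 > cnt S y (t0 + int ((4 * card S + 2) * l))" for x y t0
  proof -
    \<comment> \<open>Centres of consecutive half-open windows of half-width \<open>l\<close> to the
      right of \<open>t0\<close>. The last of the \<open>2 * card S + 1\<close> windows ends at
      \<open>t0 + (4 * card S + 2) * l\<close>, which is the origin of the constant in the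
      hypothesis.\<close>
    define tt where "tt = (\<lambda>i::nat. t0 + int l + 2 * int l * int i)"
    define occ where "occ = (\<lambda>z::config. \<lambda>i. \<exists>j\<in>S. tt i - int l < z j \<and> z j \<le> tt i + int l)"
    have "\<exists>i\<le>2 * card S. \<not> occ x i \<and> \<not> occ y i"
    proof (rule ccontr)
      assume "\<not> ?thesis"
      hence all: "\<And>i. i \<le> 2 * card S \<Longrightarrow> occ x i \<or> occ y i" by blast
      \<comment> \<open>The Boolean tells whether the particle belongs to \<open>x\<close> or to
        \<open>y\<close>; this leaves \<open>2 * card S\<close> values for
        \<open>2 * card S + 1\<close> windows.\<close>
      define P where "P = (\<lambda>i. \<lambda>q::nat \<times> bool. fst q \<in> S \<and>
         (let p = (if snd q then x else y) (fst q) in tt i - int l < p \<and> p \<le> tt i + int l))"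
      have "\<And>i. i \<le> 2 * card S \<Longrightarrow> \<exists>q. P i q"
      proof -
        fix i assume "i \<le> 2 * card S"
        from all[OF this] show "\<exists>q. P i q"
        proof
          assume "occ x i"
          then obtain j where "P i (j, True)" unfolding occ_def P_def Let_def by auto
          thus ?thesis by blast
        next
          assume "occ y i"
          then obtain j where "P i (j, False)" unfolding occ_def P_def Let_def by auto
          thus ?thesis by blast
        qed
      qed
      then obtain q where q: "\<And>i. i \<le> 2 * card S \<Longrightarrow> P i (q i)" by metis
      have "inj_on q {..2 * card S}"
      proof (rule inj_onI, rule ccontr)
        fix i j assume i: "i \<in> {..2 * card S}" and j: "j \<in> {..2 * card S}" and e: "q i = q j" and ne: "i \<noteq> j"
        have "False" if "i < j" "P i (q i)" "P j (q i)" for i j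
        proof -
          have "int i + 1 \<le> int j" using that by simp
          hence "int l * (int i + 1) \<le> int l * int j" by (rule mult_left_mono) simp
          hence "tt i + int l \<le> tt j - int l" unfolding tt_def by (simp add: algebra_simps)
          thus False using that(2,3) unfolding P_def Let_def by auto
        qed
        thus False using q[of i] q[of j] i j e ne by (metis atMost_iff nat_neq_iff)
      qed
      moreover have "q ` {..2 * card S} \<subseteq> S \<times> UNIV"
      proof (rule image_subsetI)
        fix i assume "i \<in> {..2 * card S}"
        hence "fst (q i) \<in> S" using q unfolding P_def by auto
        thus "q i \<in> S \<times> UNIV" by (simp add: mem_Times_iff)
      qed
      moreover have "finite (S \<times> (UNIV :: bool set))" using S by simp
      ultimately have "card {..2 * card S} \<le> card (S \<times> (UNIV :: bool set))"
        by (rule card_inj_on_le)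
      thus False by (simp add: card_cartesian_product)
    qed
    then obtain i where i: "i \<le> 2 * card S" "\<not> occ x i" "\<not> occ y i" by blast
    have ex: "cnt S x (tt i - int l) = cnt S x (tt i + int l)"
      using i(2) by (intro cnt_eq_if_none[OF S]) (auto simp: occ_def)
    have ey: "cnt S y (tt i - int l) = cnt S y (tt i + int l)"
      using i(3) by (intro cnt_eq_if_none[OF S]) (auto simp: occ_def)
    have "int l * int i \<le> int l * int (2 * card S)" using i(1) by (intro mult_left_mono) auto
    hence "tt i \<le> t0 + int ((4 * card S + 2) * l)" unfolding tt_def by (simp add: algebra_simps)
    hence "cnt S y (tt i) \<le> cnt S y (t0 + int ((4 * card S + 2) * l))" by (rule cnt_mono[OF S])
    moreover have "cnt S x t0 \<le> cnt S x (tt i)" by (rule cnt_mono[OF S]) (simp add: tt_def)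
    ultimately show ?thesis using gt ex ey by (intro exI[of _ "tt i"]) auto
  qed
  have "\<exists>t. cnt S x (t - int l) = cnt S x (t + int l) \<and> cnt S y (t - int l) = cnt S y (t + int l)
     \<and> cnt S x t \<noteq> cnt S y t"
    using far main unfolding near_def by (metis not_le)
  then obtain t where t: "cnt S x (t - int l) = cnt S x (t + int l)"
    "cnt S y (t - int l) = cnt S y (t + int l)" "cnt S x t \<noteq> cnt S y t" by blast
  \<comment> \<open>The empty window extends by \<open>l\<close> to both sides of the cut, so the
    count of \<open>u\<close> at \<open>t\<close> is squeezed between two equal counts of
    \<open>z\<close>.\<close>
  have const: "cnt S u t = cnt S z t"
    if "u \<in> sball S l z" "cnt S z (t - int l) = cnt S z (t + int l)" for u z
  proof -
    have n: "near S l u z" using that(1) unfolding sball_def by auto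
    have "cnt S z (t - int l) \<le> cnt S u t"
      using n[unfolded near_def, rule_format, of "t - int l"] by simp
    moreover have "cnt S u t \<le> cnt S z (t + int l)" using n unfolding near_def by blast
    moreover have "cnt S z (t - int l) \<le> cnt S z t" "cnt S z t \<le> cnt S z (t + int l)"
      by (auto intro: cnt_mono[OF S])
    ultimately show ?thesis using that(2) by linarith
  qed
  show ?thesis by (rule that[of "cnt S x t" "cnt S y t" t]) (use t const in auto)
qed

text \<open>The gap has length \<open>4 * l\<close> because moving the two groups towards each other
  by at most \<open>l\<close> each still leaves \<open>2 * l\<close>, which exceeds the range of the
  interaction once \<open>l\<close> is large.\<close>

definition split_at :: "nat set \<Rightarrow> nat \<Rightarrow> config \<Rightarrow> int \<Rightarrow> bool" where
  "split_at S l z t \<longleftrightarrow> (\<exists>j\<in>S. z j \<le> t) \<and> (\<exists>j\<in>S. t < z j) \<and>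
     (\<forall>j\<in>S. z j \<le> t \<or> t + 4 * int l \<le> z j)"

text \<open>Going right from \<open>z i\<close>, each of \<open>card S\<close> consecutive windows
  of length \<open>4 * l\<close> must contain a particle, since otherwise its left end would be a
  split. None of these particles is \<open>i\<close>, so there are too few of them.\<close>

lemma unsplit_diameter:
  assumes S: "finite S" and ns: "\<And>t. \<not> split_at S l z t" and ij: "i \<in> S" "j \<in> S" and l: "l \<ge> 1"
  shows "z j - z i \<le> int (card S * (4 * l))"
proof (rule ccontr)
  assume "\<not> ?thesis"
  hence gt: "z j - z i > int (card S * (4 * l))" by simp
  define tt where "tt = (\<lambda>k::nat. z i + 4 * int l * int k)"
  have "\<exists>a\<in>S. tt k < z a \<and> z a < tt k + 4 * int l" if "k < card S" for k
  proof -
    have "int l * int k \<le> int l * int (card S)" using that by (intro mult_left_mono) auto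
    hence "tt k < z j" using gt unfolding tt_def by (simp add: algebra_simps)
    moreover have "z i \<le> tt k" unfolding tt_def by simp
    ultimately have "\<exists>a\<in>S. \<not> (z a \<le> tt k \<or> tt k + 4 * int l \<le> z a)"
      using ns[of "tt k"] ij unfolding split_at_def by blast
    thus ?thesis by (meson not_le)
  qed
  then obtain a where a: "\<And>k. k < card S \<Longrightarrow> a k \<in> S \<and> tt k < z (a k) \<and> z (a k) < tt k + 4 * int l"
    by metis
  have "inj_on a {..<card S}"
  proof (rule inj_onI, rule ccontr)
    fix k k' assume k: "k \<in> {..<card S}" "k' \<in> {..<card S}" "a k = a k'" "k \<noteq> k'"
    have False if "k < k'" "k' < card S" "a k = a k'" for k k'
    proof -
      have "int k + 1 \<le> int k'" using that by simp
      hence "int l * (int k + 1) \<le> int l * int k'" by (rule mult_left_mono) simp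
      hence "tt k + 4 * int l \<le> tt k'" unfolding tt_def by (simp add: algebra_simps)
      thus False using a[of k] a[of k'] that by auto
    qed
    thus False using k by (metis lessThan_iff nat_neq_iff)
  qed
  moreover have "a ` {..<card S} \<subseteq> S - {i}"
  proof
    fix b assume "b \<in> a ` {..<card S}"
    then obtain k where k: "k < card S" "b = a k" by auto
    have "z i \<le> tt k" unfolding tt_def by simp
    thus "b \<in> S - {i}" using a[OF k(1)] k(2) by auto
  qed
  ultimately have "card {..<card S} \<le> card (S - {i})" using S by (intro card_inj_on_le) auto
  thus False using card_Suc_Diff1[OF S ij(1)] by simp
qed

text \<open>A common site yields particles of \<open>x\<close> and \<open>y\<close> at distance at
  most \<open>2 * l\<close>, and each configuration has diameter at most
  \<open>4 * l * card S\<close>; together this bounds all distances by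
  \<open>(8 * card S + 2) * l\<close>. This is the separation used for pairs of balls from here on,
  and it also suffices for \<open>separating_threshold\<close>.\<close>

lemma unsplit_far_disjoint:
  assumes S: "finite S" and x: "\<And>t. \<not> split_at S l x t" and y: "\<And>t. \<not> split_at S l y t"
    and far: "\<not> near S ((8 * card S + 2) * l) x y" and l: "l \<ge> 1"
  shows "sites S l x \<inter> sites S l y = {}"
proof (rule ccontr)
  assume "\<not> ?thesis"
  then obtain i j where ij: "i \<in> S" "j \<in> S" "\<bar>x i - y j\<bar> \<le> 2 * int l" unfolding sites_def by force
  have "near S ((8 * card S + 2) * l) x y"
  proof (rule near_pointwise[OF S])
    fix a assume a: "a \<in> S"
    show "\<bar>x a - y a\<bar> \<le> int ((8 * card S + 2) * l)"
      using unsplit_diameter[OF S x ij(1) a l] unsplit_diameter[OF S x a ij(1) l]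
        unsplit_diameter[OF S y ij(2) a l] unsplit_diameter[OF S y a ij(2) l] ij(3)
      by (simp add: algebra_simps)
  qed
  thus False using far by simp
qed

section \<open>Finite symmetric matrices\<close>

definition orthofam :: "'a set \<Rightarrow> 'i set \<Rightarrow> ('i \<Rightarrow> 'a \<Rightarrow> real) \<Rightarrow> bool" where
  "orthofam X I \<phi> \<longleftrightarrow>
     (\<forall>i\<in>I. \<forall>k\<in>I. (\<Sum>y\<in>X. \<phi> i y * \<phi> k y) = (if i = k then 1 else 0))"

text \<open>The sum is the squared distance of the unit vector at \<open>x\<close> from the span of
  the family. Both Bessel's inequality and completeness are read off from its value.\<close>

lemma orthofam_residual:
  assumes X: "finite X" and I: "finite I" and o: "orthofam X I \<phi>" and x: "x \<in> X"
  shows "(\<Sum>y\<in>X. ((if y = x then 1 else 0) - (\<Sum>i\<in>I. \<phi> i x * \<phi> i y))\<^sup>2) = 1 - (\<Sum>i\<in>I. (\<phi> i x)\<^sup>2)"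
proof -
  define s where "s = (\<lambda>y. \<Sum>i\<in>I. \<phi> i x * \<phi> i y)"
  have "(\<Sum>y\<in>X. ((if y = x then 1 else 0) - s y)\<^sup>2)
      = (\<Sum>y\<in>X. (if y = x then 1 - 2 * s y else 0) + s y * s y)"
    by (intro sum.cong) (auto simp: power2_eq_square algebra_simps)
  also have "\<dots> = 1 - 2 * s x + (\<Sum>y\<in>X. s y * s y)"
    using X x by (simp add: sum.distrib)
  also have "(\<Sum>y\<in>X. s y * s y) = (\<Sum>i\<in>I. \<Sum>k\<in>I. \<phi> i x * \<phi> k x * (\<Sum>y\<in>X. \<phi> i y * \<phi> k y))"
  proof -
    have "(\<Sum>y\<in>X. s y * s y) = (\<Sum>y\<in>X. \<Sum>i\<in>I. \<Sum>k\<in>I. \<phi> i x * \<phi> k x * (\<phi> i y * \<phi> k y))"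
      unfolding s_def by (simp add: sum_product algebra_simps)
    also have "\<dots> = (\<Sum>i\<in>I. \<Sum>k\<in>I. \<Sum>y\<in>X. \<phi> i x * \<phi> k x * (\<phi> i y * \<phi> k y))"
      by (subst sum.swap, intro sum.cong refl, subst sum.swap, rule refl)
    finally show ?thesis by (simp add: sum_distrib_left)
  qed
  also have "\<dots> = (\<Sum>i\<in>I. \<Sum>k\<in>I. if k = i then \<phi> i x * \<phi> k x else 0)"
    using o unfolding orthofam_def by (intro sum.cong) auto
  also have "\<dots> = s x" using I by (simp add: s_def)
  finally show ?thesis by (simp add: s_def power2_eq_square)
qed

lemma orthofam_bessel:
  assumes "finite X" "finite I" "orthofam X I \<phi>" "x \<in> X"
  shows "(\<Sum>i\<in>I. (\<phi> i x)\<^sup>2) \<le> 1"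
proof -
  have "0 \<le> (\<Sum>y\<in>X. ((if y = x then 1 else 0) - (\<Sum>i\<in>I. \<phi> i x * \<phi> i y))\<^sup>2)"
    by (intro sum_nonneg) simp
  thus ?thesis using orthofam_residual[OF assms] by linarith
qed

lemma orthofam_sum_squares:
  assumes "finite X" "finite I" "orthofam X I \<phi>"
  shows "(\<Sum>x\<in>X. 1 - (\<Sum>i\<in>I. (\<phi> i x)\<^sup>2)) = real (card X) - real (card I)"
proof -
  have "(\<Sum>x\<in>X. \<Sum>i\<in>I. (\<phi> i x)\<^sup>2) = (\<Sum>i\<in>I. \<Sum>x\<in>X. \<phi> i x * \<phi> i x)"
    by (subst sum.swap) (simp add: power2_eq_square)
  also have "\<dots> = (\<Sum>i\<in>I. 1)" using assms(3) unfolding orthofam_def by (intro sum.cong) auto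
  finally show ?thesis by (simp add: sum_subtractf)
qed

text \<open>The squared distances of all unit vectors from the span add up to
  \<open>card X - card I = 0\<close>, so each of them vanishes.\<close>

lemma orthofam_complete:
  assumes X: "finite X" and I: "finite I" and o: "orthofam X I \<phi>" and c: "card I = card X"
    and x: "x \<in> X" and y: "y \<in> X"
  shows "(\<Sum>i\<in>I. \<phi> i x * \<phi> i y) = (if y = x then 1 else 0)"
proof -
  have nn: "\<forall>x\<in>X. 0 \<le> 1 - (\<Sum>i\<in>I. (\<phi> i x)\<^sup>2)" using orthofam_bessel[OF X I o] by auto
  have "(\<Sum>x\<in>X. 1 - (\<Sum>i\<in>I. (\<phi> i x)\<^sup>2)) = 0" using orthofam_sum_squares[OF X I o] c by simp
  hence "1 - (\<Sum>i\<in>I. (\<phi> i x)\<^sup>2) = 0" using nn x X by (subst (asm) sum_nonneg_eq_0_iff) auto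
  hence "(\<Sum>y\<in>X. ((if y = x then 1 else 0) - (\<Sum>i\<in>I. \<phi> i x * \<phi> i y))\<^sup>2) = 0"
    using orthofam_residual[OF X I o x] by simp
  hence "((if y = x then 1 else 0) - (\<Sum>i\<in>I. \<phi> i x * \<phi> i y))\<^sup>2 = 0"
    using X y by (subst (asm) sum_nonneg_eq_0_iff) auto
  thus ?thesis by simp
qed

lemma orthofam_expand:
  assumes X: "finite X" and I: "finite I" and o: "orthofam X I \<phi>" and c: "card I = card X" and z: "z \<in> X"
  shows "f z = (\<Sum>i\<in>I. \<phi> i z * (\<Sum>y\<in>X. \<phi> i y * f y))"
proof -
  have "(\<Sum>i\<in>I. \<phi> i z * (\<Sum>y\<in>X. \<phi> i y * f y)) = (\<Sum>i\<in>I. \<Sum>y\<in>X. \<phi> i z * \<phi> i y * f y)"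
    by (simp add: sum_distrib_left mult.assoc)
  also have "\<dots> = (\<Sum>y\<in>X. (\<Sum>i\<in>I. \<phi> i z * \<phi> i y) * f y)"
    by (subst sum.swap) (simp add: sum_distrib_right)
  also have "\<dots> = (\<Sum>y\<in>X. if y = z then f y else 0)"
    using orthofam_complete[OF X I o c z] by (intro sum.cong) auto
  also have "\<dots> = f z" using X z by simp
  finally show ?thesis by simp
qed

section \<open>Eigenvectors by maximizing the quadratic form\<close>

lemma closed_Collect_Ball:
  assumes "\<And>i. i \<in> I \<Longrightarrow> closed {f. P i f}" shows "closed {f. \<forall>i\<in>I. P i f}"
proof -
  have "{f. \<forall>i\<in>I. P i f} = (\<Inter>i\<in>I. {f. P i f})" by auto
  thus ?thesis using assms by (simp add: closed_INT)
qed

lemma compact_PiE_fun: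
  assumes "\<And>i. compact (K i)" shows "compact (Pi\<^sub>E UNIV K)"
proof -
  have "compactin (product_topology (\<lambda>i. euclidean) UNIV) (Pi\<^sub>E UNIV K)"
    unfolding compactin_PiE using assms by simp
  thus ?thesis by (simp add: euclidean_product_topology)
qed

lemma symmetric_form_swap:
  fixes h :: "'a \<Rightarrow> 'a \<Rightarrow> real"
  assumes "\<And>x y. x \<in> X \<Longrightarrow> y \<in> X \<Longrightarrow> h x y = h y x"
  shows "(\<Sum>x\<in>X. f x * (\<Sum>y\<in>X. h x y * g y)) = (\<Sum>x\<in>X. g x * (\<Sum>y\<in>X. h x y * f y))"
proof -
  have "(\<Sum>x\<in>X. f x * (\<Sum>y\<in>X. h x y * g y)) = (\<Sum>x\<in>X. \<Sum>y\<in>X. f x * h x y * g y)"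
    by (simp add: sum_distrib_left mult.assoc)
  also have "\<dots> = (\<Sum>y\<in>X. \<Sum>x\<in>X. g y * (h y x * f x))"
    by (subst sum.swap) (auto intro!: sum.cong simp: assms)
  finally show ?thesis by (simp add: sum_distrib_left)
qed

text \<open>The quadratic form is maximized over the unit vectors orthogonal to the given
  eigenvectors. Symmetry makes this complement invariant, and the first variation shows that a
  maximizer is an eigenvector.\<close>

lemma eigenvector_orthogonal_exists:
  fixes h :: "'a \<Rightarrow> 'a \<Rightarrow> real"
  assumes X: "finite X" and I: "finite I" and o: "orthofam X I \<phi>" and c: "card I < card X"
    and sym: "\<And>x y. x \<in> X \<Longrightarrow> y \<in> X \<Longrightarrow> h x y = h y x"
    and ev: "\<And>i x. i \<in> I \<Longrightarrow> x \<in> X \<Longrightarrow> (\<Sum>y\<in>X. h x y * \<phi> i y) = e i * \<phi> i x"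
  shows "\<exists>f \<mu>. (\<Sum>y\<in>X. f y * f y) = 1 \<and> (\<forall>i\<in>I. (\<Sum>y\<in>X. \<phi> i y * f y) = 0) \<and>
           (\<forall>x\<in>X. (\<Sum>y\<in>X. h x y * f y) = \<mu> * f x)"
proof -
  define Q where "Q = (\<lambda>f::'a \<Rightarrow> real. \<Sum>x\<in>X. f x * (\<Sum>y\<in>X. h x y * f y))"
  \<comment> \<open>Values outside \<open>X\<close> are fixed to zero. The constrained unit sphere
    becomes a closed subset of a product of compact factors, although the functions live on the
    whole type.\<close>
  define K where "K = Pi\<^sub>E UNIV (\<lambda>y. if y \<in> X then {-1..1::real} else {0})"
  define U where "U = K \<inter> {f. (\<Sum>y\<in>X. f y * f y) = 1 \<and> (\<forall>i\<in>I. (\<Sum>y\<in>X. \<phi> i y * f y) = 0)}"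
  have coord: "continuous_on T (\<lambda>f::'a \<Rightarrow> real. f y)" for T y
    by (rule continuous_on_subset[OF continuous_on_product_coordinates]) simp
  have "closed {f::'a \<Rightarrow> real. (\<Sum>y\<in>X. f y * f y) = 1 \<and> (\<forall>i\<in>I. (\<Sum>y\<in>X. \<phi> i y * f y) = 0)}"
    by (intro closed_Collect_conj closed_Collect_Ball closed_Collect_eq continuous_intros coord)
  hence cU: "compact U" unfolding U_def K_def by (intro compact_Int_closed compact_PiE_fun) auto
  have normalize: "\<exists>g\<in>U. \<forall>x\<in>X. f x = sqrt (\<Sum>y\<in>X. f y * f y) * g x"
    if orth: "\<forall>i\<in>I. (\<Sum>y\<in>X. \<phi> i y * f y) = 0" and nz: "(\<Sum>y\<in>X. f y * f y) > 0" for f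
  proof -
    define r where "r = sqrt (\<Sum>y\<in>X. f y * f y)"
    have r: "r > 0" "r * r = (\<Sum>y\<in>X. f y * f y)" using nz unfolding r_def by auto
    define g where "g = (\<lambda>y. if y \<in> X then f y / r else 0)"
    have n1: "(\<Sum>y\<in>X. g y * g y) = 1"
    proof -
      have "(\<Sum>y\<in>X. g y * g y) = (\<Sum>y\<in>X. f y * f y / (r * r))"
        unfolding g_def by (intro sum.cong) auto
      also have "\<dots> = (\<Sum>y\<in>X. f y * f y) / (r * r)" by (simp add: sum_divide_distrib)
      finally show ?thesis using r nz by simp
    qed
    have "(\<Sum>y\<in>X. \<phi> i y * g y) = (\<Sum>y\<in>X. \<phi> i y * f y) / r" for i
      unfolding g_def by (simp add: sum_divide_distrib)
    hence o1: "\<forall>i\<in>I. (\<Sum>y\<in>X. \<phi> i y * g y) = 0" using orth by simp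
    have "g \<in> K" unfolding K_def
    proof (rule PiE_I)
      fix y
      show "g y \<in> (if y \<in> X then {-1..1} else {0})"
      proof (cases "y \<in> X")
        case True
        have "g y * g y \<le> (\<Sum>y\<in>X. g y * g y)"
          using True X by (intro member_le_sum) auto
        hence "(g y)\<^sup>2 \<le> 1" using n1 by (simp add: power2_eq_square)
        hence "\<bar>g y\<bar> \<le> 1" by (simp add: abs_square_le_1)
        thus ?thesis using True by auto
      qed (auto simp: g_def)
    qed simp
    hence "g \<in> U" unfolding U_def using n1 o1 by auto
    moreover have "\<forall>x\<in>X. f x = r * g x" using r unfolding g_def by auto
    ultimately show ?thesis unfolding r_def by blast
  qed
  have "\<exists>x\<in>X. 1 - (\<Sum>i\<in>I. (\<phi> i x)\<^sup>2) \<noteq> 0"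
  proof (rule ccontr)
    assume "\<not> ?thesis"
    hence "(\<Sum>x\<in>X. 1 - (\<Sum>i\<in>I. (\<phi> i x)\<^sup>2)) = 0" by (intro sum.neutral) auto
    thus False using orthofam_sum_squares[OF X I o] c by simp
  qed
  then obtain x0 where x0: "x0 \<in> X" "1 - (\<Sum>i\<in>I. (\<phi> i x0)\<^sup>2) \<noteq> 0" by blast
  \<comment> \<open>The part of the unit vector at \<open>x0\<close> orthogonal to the span. It is
    nonzero because the family is too small to span everything, so the constraint set is
    nonempty.\<close>
  define d where "d = (\<lambda>y. (if y = x0 then 1 else 0) - (\<Sum>i\<in>I. \<phi> i x0 * \<phi> i y))"
  have "(\<Sum>y\<in>X. d y * d y) = 1 - (\<Sum>i\<in>I. (\<phi> i x0)\<^sup>2)"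
    using orthofam_residual[OF X I o x0(1)] unfolding d_def by (simp add: power2_eq_square)
  hence dpos: "(\<Sum>y\<in>X. d y * d y) > 0"
    using x0(2) sum_nonneg[of X "\<lambda>y. d y * d y"] by force
  have "(\<Sum>y\<in>X. \<phi> k y * d y) = 0" if k: "k \<in> I" for k
  proof -
    have "(\<Sum>y\<in>X. \<phi> k y * d y) = (\<Sum>y\<in>X. (if y = x0 then \<phi> k y else 0)) - (\<Sum>y\<in>X. \<Sum>i\<in>I. \<phi> i x0 * (\<phi> k y * \<phi> i y))"
    proof -
      have "\<phi> k y * d y = (if y = x0 then \<phi> k y else 0) - (\<Sum>i\<in>I. \<phi> i x0 * (\<phi> k y * \<phi> i y))" for y
        unfolding d_def by (simp add: right_diff_distrib sum_distrib_left mult.left_commute)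
      thus ?thesis by (simp add: sum_subtractf)
    qed
    also have "(\<Sum>y\<in>X. \<Sum>i\<in>I. \<phi> i x0 * (\<phi> k y * \<phi> i y)) = (\<Sum>i\<in>I. \<phi> i x0 * (\<Sum>y\<in>X. \<phi> k y * \<phi> i y))"
      by (subst sum.swap) (simp add: sum_distrib_left)
    also have "\<dots> = (\<Sum>i\<in>I. if i = k then \<phi> i x0 else 0)"
      using o k unfolding orthofam_def by (intro sum.cong) auto
    finally show ?thesis using X I x0(1) k by simp
  qed
  hence "U \<noteq> {}" using normalize[of d] dpos by blast
  moreover have "continuous_on U Q" unfolding Q_def by (intro continuous_intros coord)
  ultimately obtain f0 where f0: "f0 \<in> U" and max: "\<And>g. g \<in> U \<Longrightarrow> Q g \<le> Q f0"
    using continuous_attains_sup[OF cU] by blast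
  define \<mu> where "\<mu> = Q f0"
  have n0: "(\<Sum>y\<in>X. f0 y * f0 y) = 1" and o0: "\<And>i. i \<in> I \<Longrightarrow> (\<Sum>y\<in>X. \<phi> i y * f0 y) = 0"
    using f0 unfolding U_def by auto
  have Qle: "Q f \<le> \<mu> * (\<Sum>y\<in>X. f y * f y)" if orth: "\<forall>i\<in>I. (\<Sum>y\<in>X. \<phi> i y * f y) = 0" for f
  proof (cases "(\<Sum>y\<in>X. f y * f y) > 0")
    case True
    define r where "r = sqrt (\<Sum>y\<in>X. f y * f y)"
    have rr: "r * r = (\<Sum>y\<in>X. f y * f y)" using True unfolding r_def by auto
    obtain g where g: "g \<in> U" "\<forall>x\<in>X. f x = r * g x" using normalize[OF orth True] unfolding r_def by blast
    have "Q f = r * r * Q g" unfolding Q_def using g(2)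
      by (simp add: sum_distrib_left algebra_simps)
    also have "\<dots> \<le> r * r * \<mu>" unfolding \<mu>_def by (intro mult_left_mono max g) simp
    finally show ?thesis using rr by (simp add: mult.commute)
  next
    case False
    hence "(\<Sum>y\<in>X. f y * f y) = 0" using sum_nonneg[of X "\<lambda>y. f y * f y"] by force
    hence "\<forall>y\<in>X. f y = 0" using X by (subst (asm) sum_nonneg_eq_0_iff) auto
    thus ?thesis unfolding Q_def by simp
  qed
  define Hf where "Hf = (\<lambda>x. \<Sum>y\<in>X. h x y * f0 y)"
  \<comment> \<open>The defect of the eigenvalue equation. It is orthogonal to \<open>f0\<close> and
    to the family, hence an admissible direction of variation.\<close>
  define g where "g = (\<lambda>x. Hf x - \<mu> * f0 x)"
  have fH: "(\<Sum>x\<in>X. f0 x * Hf x) = \<mu>" unfolding \<mu>_def Q_def Hf_def by simp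
  have gf: "(\<Sum>x\<in>X. g x * f0 x) = 0"
    using fH n0 unfolding g_def by (simp add: algebra_simps sum_subtractf flip: sum_distrib_left)
  have go: "(\<Sum>y\<in>X. \<phi> i y * g y) = 0" if i: "i \<in> I" for i
  proof -
    have "(\<Sum>x\<in>X. \<phi> i x * Hf x) = (\<Sum>x\<in>X. f0 x * (\<Sum>y\<in>X. h x y * \<phi> i y))"
      unfolding Hf_def by (rule symmetric_form_swap[OF sym])
    also have "\<dots> = (\<Sum>x\<in>X. e i * (\<phi> i x * f0 x))" using ev[OF i] by (intro sum.cong) auto
    also have "\<dots> = 0" using o0[OF i] by (simp flip: sum_distrib_left)
    finally have 1: "(\<Sum>x\<in>X. \<phi> i x * Hf x) = 0" .
    have "(\<Sum>y\<in>X. \<phi> i y * g y) = (\<Sum>x\<in>X. \<phi> i x * Hf x) - \<mu> * (\<Sum>y\<in>X. \<phi> i y * f0 y)"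
      unfolding g_def by (simp add: algebra_simps sum_subtractf sum_distrib_left)
    thus ?thesis using 1 o0[OF i] by simp
  qed
  define c2 where "c2 = (\<Sum>x\<in>X. g x * g x)"
  have gH: "(\<Sum>x\<in>X. g x * Hf x) = c2"
  proof -
    have "(\<Sum>x\<in>X. g x * Hf x) = (\<Sum>x\<in>X. g x * g x + \<mu> * (g x * f0 x))"
      unfolding g_def by (intro sum.cong) (auto simp: algebra_simps)
    thus ?thesis using gf by (simp add: sum.distrib c2_def flip: sum_distrib_left)
  qed
  \<comment> \<open>Maximality along \<open>f0 + t * g\<close>: the left side is linear in
    \<open>t\<close>, the right side quadratic, so a small positive \<open>t\<close> forces the
    defect to vanish.\<close>
  have key: "2 * t * c2 \<le> t * t * (\<mu> * c2 - Q g)" for t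
  proof -
    define f where "f = (\<lambda>x. f0 x + t * g x)"
    have "(\<Sum>y\<in>X. \<phi> i y * f y) = (\<Sum>y\<in>X. \<phi> i y * f0 y) + t * (\<Sum>y\<in>X. \<phi> i y * g y)" for i
      unfolding f_def by (simp add: algebra_simps sum.distrib sum_distrib_left)
    hence "\<forall>i\<in>I. (\<Sum>y\<in>X. \<phi> i y * f y) = 0" using o0 go by simp
    from Qle[OF this] have 1: "Q f \<le> \<mu> * (\<Sum>y\<in>X. f y * f y)" .
    have "(\<Sum>y\<in>X. f y * f y) = (\<Sum>y\<in>X. f0 y * f0 y) + 2 * t * (\<Sum>y\<in>X. g y * f0 y) + t * t * c2"
      unfolding f_def c2_def by (simp add: algebra_simps sum.distrib sum_distrib_left)
    hence 2: "(\<Sum>y\<in>X. f y * f y) = 1 + t * t * c2" using n0 gf by simp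
    have "Q f = (\<Sum>x\<in>X. (f0 x + t * g x) * (Hf x + t * (\<Sum>y\<in>X. h x y * g y)))"
      unfolding Q_def f_def Hf_def by (simp add: algebra_simps sum.distrib sum_distrib_left)
    also have "\<dots> = (\<Sum>x\<in>X. f0 x * Hf x) + t * (\<Sum>x\<in>X. g x * Hf x)
         + t * (\<Sum>x\<in>X. f0 x * (\<Sum>y\<in>X. h x y * g y)) + t * t * Q g"
      unfolding Q_def by (simp add: distrib_left distrib_right sum.distrib sum_distrib_left algebra_simps)
    also have "(\<Sum>x\<in>X. f0 x * (\<Sum>y\<in>X. h x y * g y)) = (\<Sum>x\<in>X. g x * Hf x)"
      unfolding Hf_def by (rule symmetric_form_swap[OF sym])
    finally have "Q f = \<mu> + 2 * t * c2 + t * t * Q g" using fH gH by (simp add: algebra_simps)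
    thus ?thesis using 1 2 by (simp add: algebra_simps)
  qed
  have "c2 = 0"
  proof (rule ccontr)
    assume "c2 \<noteq> 0"
    hence c2: "c2 > 0" unfolding c2_def using sum_nonneg[of X "\<lambda>y. g y * g y"] by force
    define D where "D = \<bar>\<mu> * c2 - Q g\<bar> + 1"
    have D: "D > 0" "\<mu> * c2 - Q g \<le> D" unfolding D_def by auto
    define t where "t = c2 / D"
    have t: "t > 0" unfolding t_def using c2 D by simp
    have "t * t * (\<mu> * c2 - Q g) \<le> t * t * D" using D by (intro mult_left_mono) auto
    also have "\<dots> = t * c2" unfolding t_def using D by simp
    finally have "2 * t * c2 \<le> t * c2" using key[of t] by linarith
    thus False using t c2 by simp
  qed
  hence "\<forall>x\<in>X. g x = 0" unfolding c2_def using X by (subst (asm) sum_nonneg_eq_0_iff) auto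
  hence "\<forall>x\<in>X. (\<Sum>y\<in>X. h x y * f0 y) = \<mu> * f0 x" unfolding g_def Hf_def by auto
  thus ?thesis using n0 o0 by blast
qed

text \<open>Eigenvectors are added one at a time until there are \<open>card X\<close> of them. They
  are then renumbered by the points of \<open>X\<close>, the index set that
  \<open>cube_localizing\<close> asks for.\<close>

lemma spectral_theorem_finite:
  fixes h :: "'a \<Rightarrow> 'a \<Rightarrow> real"
  assumes X: "finite X" and sym: "\<And>x y. x \<in> X \<Longrightarrow> y \<in> X \<Longrightarrow> h x y = h y x"
  obtains \<phi> e where "orthofam X X \<phi>"
    "\<And>i x. i \<in> X \<Longrightarrow> x \<in> X \<Longrightarrow> (\<Sum>y\<in>X. h x y * \<phi> i y) = e i * \<phi> i x"
proof -
  have "k \<le> card X \<Longrightarrow> \<exists>\<phi> e. orthofam X {..<k} \<phi> \<and>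
      (\<forall>i<k. \<forall>x\<in>X. (\<Sum>y\<in>X. h x y * \<phi> i y) = e i * \<phi> i x)" for k :: nat
  proof (induction k)
    case 0
    show ?case by (auto simp: orthofam_def)
  next
    case (Suc k)
    then obtain \<phi> e where IH: "orthofam X {..<k} \<phi>"
      "\<forall>i<k. \<forall>x\<in>X. (\<Sum>y\<in>X. h x y * \<phi> i y) = e i * \<phi> i x" by auto
    have "\<exists>f \<mu>. (\<Sum>y\<in>X. f y * f y) = 1 \<and> (\<forall>i\<in>{..<k}. (\<Sum>y\<in>X. \<phi> i y * f y) = 0) \<and>
           (\<forall>x\<in>X. (\<Sum>y\<in>X. h x y * f y) = \<mu> * f x)"
      using IH Suc.prems by (intro eigenvector_orthogonal_exists[OF X _ IH(1) _ sym]) auto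
    then obtain f \<mu> where f: "(\<Sum>y\<in>X. f y * f y) = 1" "\<forall>i\<in>{..<k}. (\<Sum>y\<in>X. \<phi> i y * f y) = 0"
           "\<forall>x\<in>X. (\<Sum>y\<in>X. h x y * f y) = \<mu> * f x" by blast
    have f2: "\<forall>i\<in>{..<k}. (\<Sum>y\<in>X. f y * \<phi> i y) = 0" using f(2) by (simp add: mult.commute)
    have "orthofam X {..<Suc k} (\<phi>(k := f))"
      unfolding orthofam_def using IH(1) f(1,2) f2
      by (auto simp: less_Suc_eq orthofam_def)
    moreover have "\<forall>i<Suc k. \<forall>x\<in>X. (\<Sum>y\<in>X. h x y * (\<phi>(k := f)) i y) = (e(k := \<mu>)) i * (\<phi>(k := f)) i x"
      using IH(2) f(3) by (auto simp: less_Suc_eq)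
    ultimately show ?case by blast
  qed
  from this[of "card X"] obtain \<phi> e where p: "orthofam X {..<card X} \<phi>"
      "\<forall>i<card X. \<forall>x\<in>X. (\<Sum>y\<in>X. h x y * \<phi> i y) = e i * \<phi> i x" by auto
  obtain b where b: "bij_betw b X {..<card X}"
    using ex_bij_betw_finite_nat[OF X] atLeast0LessThan by metis
  have bi: "b i < card X" "b i = b k \<longleftrightarrow> i = k" if "i \<in> X" "k \<in> X" for i k
    using b that by (auto simp: bij_betw_def inj_on_def)
  show ?thesis
  proof (rule that[of "\<phi> \<circ> b" "e \<circ> b"])
    show "orthofam X X (\<phi> \<circ> b)" unfolding orthofam_def
    proof (intro ballI)
      fix i k assume "i \<in> X" "k \<in> X"
      thus "(\<Sum>y\<in>X. (\<phi> \<circ> b) i y * (\<phi> \<circ> b) k y) = (if i = k then 1 else 0)"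
        using p(1) bi[of i k] bi[of k i] unfolding orthofam_def by simp
    qed
    show "(\<Sum>y\<in>X. h x y * (\<phi> \<circ> b) i y) = (e \<circ> b) i * (\<phi> \<circ> b) i x" if "i \<in> X" "x \<in> X" for i x
      using p(2) bi[of i i] that by simp
  qed
qed

text \<open>Pairing the equation with \<open>\<phi> i\<close> shows that the coefficient of
  \<open>f\<close> is that of \<open>g\<close> divided by \<open>e i - E\<close>. The index set is
  kept apart from \<open>X\<close> so that products of two eigenbases fit.\<close>

lemma resolvent_expansion:
  fixes h :: "'a \<Rightarrow> 'a \<Rightarrow> real"
  assumes X: "finite X" and I: "finite I" "card I = card X" and o: "orthofam X I \<phi>"
    and sym: "\<And>x y. x \<in> X \<Longrightarrow> y \<in> X \<Longrightarrow> h x y = h y x"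
    and ev: "\<And>i x. i \<in> I \<Longrightarrow> x \<in> X \<Longrightarrow> (\<Sum>y\<in>X. h x y * \<phi> i y) = e i * \<phi> i x"
    and f: "\<And>x. x \<in> X \<Longrightarrow> (\<Sum>y\<in>X. h x y * f y) - E * f x = g x"
    and ne: "\<And>i. i \<in> I \<Longrightarrow> e i \<noteq> E" and z: "z \<in> X"
  shows "f z = (\<Sum>i\<in>I. \<phi> i z * ((\<Sum>y\<in>X. \<phi> i y * g y) / (e i - E)))"
proof -
  have "(\<Sum>y\<in>X. \<phi> i y * f y) = (\<Sum>y\<in>X. \<phi> i y * g y) / (e i - E)" if i: "i \<in> I" for i
  proof -
    have "(\<Sum>y\<in>X. \<phi> i y * g y) = (\<Sum>x\<in>X. \<phi> i x * (\<Sum>y\<in>X. h x y * f y)) - E * (\<Sum>x\<in>X. \<phi> i x * f x)"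
      using f by (simp add: algebra_simps sum_distrib_left flip: sum_subtractf)
    also have "(\<Sum>x\<in>X. \<phi> i x * (\<Sum>y\<in>X. h x y * f y)) = (\<Sum>x\<in>X. f x * (\<Sum>y\<in>X. h x y * \<phi> i y))"
      by (rule symmetric_form_swap[OF sym])
    also have "\<dots> = e i * (\<Sum>x\<in>X. \<phi> i x * f x)"
      using ev[OF i] by (simp add: sum_distrib_left algebra_simps)
    finally show ?thesis using ne[OF i] by (simp add: field_simps)
  qed
  thus ?thesis using orthofam_expand[OF X I(1) o I(2) z, of f] by simp
qed

section \<open>Singular balls and eigenfunction decay\<close>

definition energy :: "real \<Rightarrow> (int \<Rightarrow> real) \<Rightarrow> (int \<Rightarrow> real) \<Rightarrow> nat set \<Rightarrow> config \<Rightarrow> real" where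
  "energy lam v U S y = lam * (\<Sum>j\<in>S. v (y j)) + (\<Sum>j\<in>S. \<Sum>i\<in>{i \<in> S. i < j}. U (y i - y j))"

text \<open>The equation is imposed on \<open>A\<close> only, while neighbours are taken in
  \<open>Om\<close>. Hops out of \<open>Om\<close> are dropped, as in the restricted Hamiltonian,
  and the values on \<open>Om - A\<close> act as free boundary data.\<close>

definition sol :: "nat set \<Rightarrow> config set \<Rightarrow> (config \<Rightarrow> real) \<Rightarrow> real \<Rightarrow> config set \<Rightarrow> (config \<Rightarrow> real) \<Rightarrow> bool" where
  "sol S Om W E A f \<longleftrightarrow> (\<forall>y\<in>A. W y * f y - (\<Sum>y'\<in>neighbours S y \<inter> Om. f y') = E * f y)"

definition spec :: "nat set \<Rightarrow> (config \<Rightarrow> real) \<Rightarrow> config set \<Rightarrow> real set" where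
  "spec S W X = {e. \<exists>f. (\<exists>x\<in>X. f x \<noteq> 0) \<and> sol S X W e X f}"

text \<open>Singularity is expressed by solutions rather than by the Green function, so that it is a closed
  condition on potential and energy. The number \<open>Q\<close> is the reciprocal of the decay factor.\<close>

definition sing :: "nat set \<Rightarrow> config set \<Rightarrow> (config \<Rightarrow> real) \<Rightarrow> real \<Rightarrow> nat \<Rightarrow> config \<Rightarrow> real \<Rightarrow> bool" where
  "sing S Om W E l z Q \<longleftrightarrow> (\<exists>f. f z = 1 \<and> sol S Om W E (sball S l z \<inter> Om) f \<and>
     (\<forall>y\<in>Om. sdist S y z = l + 1 \<longrightarrow> \<bar>f y\<bar> \<le> Q))"

definition ham_kernel :: "nat set \<Rightarrow> (config \<Rightarrow> real) \<Rightarrow> config \<Rightarrow> config \<Rightarrow> real" where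
  "ham_kernel S W x y = (if x = y then W x else 0) - (if y \<in> neighbours S x then 1 else 0)"

lemma ham_kernel_sym: "ham_kernel S W x y = ham_kernel S W y x"
  unfolding ham_kernel_def using neighbours_sym[of y S x] by auto

lemma ham_kernel_sum:
  assumes X: "finite X" and x: "x \<in> X"
  shows "(\<Sum>y\<in>X. ham_kernel S W x y * f y) = W x * f x - (\<Sum>y\<in>neighbours S x \<inter> X. f y)"
proof -
  have "(\<Sum>y\<in>X. ham_kernel S W x y * f y) = (\<Sum>y\<in>X. (if x = y then W x * f y else 0) - (if y \<in> neighbours S x then f y else 0))"
    by (intro sum.cong) (auto simp: ham_kernel_def left_diff_distrib)
  also have "\<dots> = W x * f x - (\<Sum>y\<in>X. if y \<in> neighbours S x then f y else 0)"
    using X x by (simp add: sum_subtractf)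
  also have "(\<Sum>y\<in>X. if y \<in> neighbours S x then f y else 0) = (\<Sum>y\<in>neighbours S x \<inter> X. f y)"
    using sum.inter_restrict[OF X, of f "neighbours S x"] by (simp add: Int_commute)
  finally show ?thesis .
qed

section \<open>Spectra and resolvent estimates\<close>

lemma sol_eigenbasis:
  assumes X: "finite X"
  obtains \<phi> e where "orthofam X X \<phi>" "\<And>i. i \<in> X \<Longrightarrow> sol S X W (e i) X (\<phi> i)"
proof -
  obtain \<phi> e where o: "orthofam X X \<phi>"
    and s: "\<And>i x. i \<in> X \<Longrightarrow> x \<in> X \<Longrightarrow> (\<Sum>y\<in>X. ham_kernel S W x y * \<phi> i y) = e i * \<phi> i x"
    by (rule spectral_theorem_finite[OF X, of "ham_kernel S W"]) (use ham_kernel_sym in blast)+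
  show ?thesis
  proof (rule that[OF o])
    fix i assume "i \<in> X"
    thus "sol S X W (e i) X (\<phi> i)" unfolding sol_def using s ham_kernel_sum[OF X] by simp
  qed
qed

lemma orthofam_abs_le_1:
  assumes "finite X" "orthofam X I \<phi>" "i \<in> I" "x \<in> X" shows "\<bar>\<phi> i x\<bar> \<le> 1"
proof -
  have "\<phi> i x * \<phi> i x \<le> (\<Sum>y\<in>X. \<phi> i y * \<phi> i y)" using assms by (intro member_le_sum) auto
  also have "\<dots> = 1" using assms unfolding orthofam_def by auto
  finally have "(\<phi> i x)\<^sup>2 \<le> 1" by (simp add: power2_eq_square)
  thus ?thesis by (simp add: abs_square_le_1)
qed

lemma orthofam_nonzero:
  assumes "orthofam X I \<phi>" "i \<in> I" shows "\<exists>x\<in>X. \<phi> i x \<noteq> 0"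
proof (rule ccontr)
  assume "\<not> ?thesis"
  hence "(\<Sum>y\<in>X. \<phi> i y * \<phi> i y) = 0" by (intro sum.neutral) auto
  thus False using assms unfolding orthofam_def by auto
qed

text \<open>The eigenvalues of one eigenbasis exhaust the spectrum: at any other energy
  \<open>resolvent_expansion\<close> with right-hand side zero leaves only the zero
  solution.\<close>

lemma spec_finite_card:
  assumes X: "finite X"
  shows "finite (spec S W X)" "card (spec S W X) \<le> card X"
proof -
  obtain \<phi> e where o: "orthofam X X \<phi>" and s: "\<And>i. i \<in> X \<Longrightarrow> sol S X W (e i) X (\<phi> i)"
    using sol_eigenbasis[OF X] by metis
  have "spec S W X \<subseteq> e ` X"
  proof
    fix \<mu> assume "\<mu> \<in> spec S W X"
    then obtain f x where f: "x \<in> X" "f x \<noteq> 0" "sol S X W \<mu> X f" unfolding spec_def by auto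
    show "\<mu> \<in> e ` X"
    proof (rule ccontr)
      assume n: "\<mu> \<notin> e ` X"
      have "f x = (\<Sum>i\<in>X. \<phi> i x * ((\<Sum>y\<in>X. \<phi> i y * 0) / (e i - \<mu>)))"
      proof (rule resolvent_expansion[OF X X refl o, of "ham_kernel S W"])
        show "(\<Sum>y\<in>X. ham_kernel S W x y * f y) - \<mu> * f x = 0" if "x \<in> X" for x
          using that f(3) ham_kernel_sum[OF X that] unfolding sol_def by simp
        show "(\<Sum>y\<in>X. ham_kernel S W x y * \<phi> i y) = e i * \<phi> i x" if "i \<in> X" "x \<in> X" for i x
          using s[OF that(1)] that ham_kernel_sum[OF X that(2)] unfolding sol_def by simp
      qed (use n f ham_kernel_sym in auto)
      thus False using f(2) by simp
    qed
  qed
  thus "finite (spec S W X)" "card (spec S W X) \<le> card X"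
    using X by (auto intro: finite_subset) (meson card_image_le card_mono finite_imageI le_trans)
qed

lemma spec_shift:
  assumes "\<And>y. y \<in> X \<Longrightarrow> W' y = W y + c" "e \<in> spec S W' X"
  shows "e - c \<in> spec S W X"
proof -
  obtain f where f: "\<exists>x\<in>X. f x \<noteq> 0" "sol S X W' e X f" using assms(2) unfolding spec_def by auto
  have "sol S X W (e - c) X f" unfolding sol_def
  proof
    fix y assume y: "y \<in> X"
    have "W' y * f y - (\<Sum>y'\<in>neighbours S y \<inter> X. f y') = e * f y" using f(2) y unfolding sol_def by auto
    thus "W y * f y - (\<Sum>y'\<in>neighbours S y \<inter> X. f y') = (e - c) * f y"
      using assms(1)[OF y] by (simp add: algebra_simps)
  qed
  thus ?thesis using f unfolding spec_def by auto
qed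

lemma spec_eigen:
  assumes "sol S X W e X f" "x \<in> X" "f x \<noteq> 0" shows "e \<in> spec S W X"
  using assms unfolding spec_def by auto

text \<open>Eigenfunctions are bounded by one, so an entry of the resolvent is at most
  \<open>card X / \<epsilon>\<close>; summing over the source costs the second factor
  \<open>card X\<close>.\<close>

lemma resolvent_bound:
  assumes X: "finite X" and eps: "\<epsilon> > 0" and nr: "\<And>e. e \<in> spec S W X \<Longrightarrow> \<bar>e - E\<bar> \<ge> \<epsilon>"
    and f: "\<And>y. y \<in> X \<Longrightarrow> W y * f y - (\<Sum>y'\<in>neighbours S y \<inter> X. f y') - E * f y = g y"
    and g: "\<And>y. y \<in> X \<Longrightarrow> \<bar>g y\<bar> \<le> G" and z: "z \<in> X"
  shows "\<bar>f z\<bar> \<le> (real (card X))\<^sup>2 * G / \<epsilon>"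
proof -
  obtain \<phi> e where o: "orthofam X X \<phi>" and s: "\<And>i. i \<in> X \<Longrightarrow> sol S X W (e i) X (\<phi> i)"
    using sol_eigenbasis[OF X] by metis
  have ei: "\<bar>e i - E\<bar> \<ge> \<epsilon>" if "i \<in> X" for i
    using nr s[OF that] orthofam_nonzero[OF o that] spec_eigen by blast
  have G: "G \<ge> 0" using g[OF z] by linarith
  have "f z = (\<Sum>i\<in>X. \<phi> i z * ((\<Sum>y\<in>X. \<phi> i y * g y) / (e i - E)))"
  proof (rule resolvent_expansion[OF X X refl o, of "ham_kernel S W"])
    show "(\<Sum>y\<in>X. ham_kernel S W x y * f y) - E * f x = g x" if "x \<in> X" for x
      using f[OF that] ham_kernel_sum[OF X that] by simp
    show "(\<Sum>y\<in>X. ham_kernel S W x y * \<phi> i y) = e i * \<phi> i x" if "i \<in> X" "x \<in> X" for i x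
      using s[OF that(1)] that ham_kernel_sum[OF X that(2)] unfolding sol_def by simp
    show "e i \<noteq> E" if "i \<in> X" for i using ei[OF that] eps by auto
  qed (use z ham_kernel_sym in auto)
  also have "\<bar>\<dots>\<bar> \<le> (\<Sum>i\<in>X. \<bar>\<phi> i z * ((\<Sum>y\<in>X. \<phi> i y * g y) / (e i - E))\<bar>)" by (rule sum_abs)
  also have "\<dots> \<le> (\<Sum>i\<in>X. real (card X) * G / \<epsilon>)"
  proof (rule sum_mono)
    fix i assume i: "i \<in> X"
    have "\<bar>\<Sum>y\<in>X. \<phi> i y * g y\<bar> \<le> (\<Sum>y\<in>X. \<bar>\<phi> i y * g y\<bar>)" by (rule sum_abs)
    also have "\<dots> \<le> (\<Sum>y\<in>X. 1 * G)"
      unfolding abs_mult using orthofam_abs_le_1[OF X o i] g by (intro sum_mono mult_mono) auto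
    finally have 1: "\<bar>\<Sum>y\<in>X. \<phi> i y * g y\<bar> \<le> real (card X) * G" by simp
    have "\<bar>\<phi> i z * ((\<Sum>y\<in>X. \<phi> i y * g y) / (e i - E))\<bar> = \<bar>\<phi> i z\<bar> * (\<bar>\<Sum>y\<in>X. \<phi> i y * g y\<bar> / \<bar>e i - E\<bar>)"
      by (simp add: abs_mult)
    also have "\<dots> \<le> 1 * (real (card X) * G / \<epsilon>)"
      using orthofam_abs_le_1[OF X o i z] 1 ei[OF i] eps G
      by (intro mult_mono frac_le) auto
    finally show "\<bar>\<phi> i z * ((\<Sum>y\<in>X. \<phi> i y * g y) / (e i - E))\<bar> \<le> real (card X) * G / \<epsilon>" by simp
  qed
  finally show ?thesis by (simp add: power2_eq_square mult.assoc)
qed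

lemma abs_sum_neighbours_le:
  assumes S: "finite S" and A: "A \<subseteq> neighbours S y" and b: "\<And>y'. y' \<in> A \<Longrightarrow> \<bar>f y'\<bar> \<le> B" and B: "B \<ge> 0"
  shows "\<bar>\<Sum>y'\<in>A. f y'\<bar> \<le> 2 * real (card S) * B"
proof -
  have "\<bar>\<Sum>y'\<in>A. f y'\<bar> \<le> (\<Sum>y'\<in>A. \<bar>f y'\<bar>)" by (rule sum_abs)
  also have "\<dots> \<le> (\<Sum>y'\<in>A. B)" using b by (rule sum_mono)
  also have "\<dots> = real (card A) * B" by simp
  also have "\<dots> \<le> real (2 * card S) * B"
    using card_mono[OF finite_neighbours[OF S] A] card_neighbours[OF S, of y] B by (intro mult_right_mono) linarith+
  finally show ?thesis by simp
qed

text \<open>Hops that leave the ball are moved to the right-hand side. A hop changes the distance by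
  at most one, so only values at distance exactly \<open>r + 1\<close> enter.\<close>

lemma ball_resolvent_bound:
  assumes S: "finite S" and Om: "Om \<subseteq> confs S"
    and eps: "\<epsilon> > 0" and nr: "\<And>e. e \<in> spec S W (sball S r x \<inter> Om) \<Longrightarrow> \<bar>e - E\<bar> \<ge> \<epsilon>"
    and f: "sol S Om W E (sball S r x \<inter> Om) f"
    and b: "\<And>y. y \<in> Om \<Longrightarrow> sdist S y x = r + 1 \<Longrightarrow> \<bar>f y\<bar> \<le> B" and B: "B \<ge> 0"
    and z: "z \<in> sball S r x \<inter> Om"
  shows "\<bar>f z\<bar> \<le> (real (card (sball S r x)))\<^sup>2 * (2 * real (card S)) / \<epsilon> * B"
proof -
  let ?X = "sball S r x \<inter> Om"
  have X: "finite ?X" using sball_finite_card(1)[OF S] by blast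
  have "\<bar>f z\<bar> \<le> (real (card ?X))\<^sup>2 * (2 * real (card S) * B) / \<epsilon>"
  proof (rule resolvent_bound[OF X eps nr _ _ z])
    fix y assume y: "y \<in> ?X"
    have "(\<Sum>y'\<in>neighbours S y \<inter> Om. f y') = (\<Sum>y'\<in>neighbours S y \<inter> ?X. f y') + (\<Sum>y'\<in>neighbours S y \<inter> (Om - ?X). f y')"
      using finite_neighbours[OF S, of y]
      by (subst sum.union_disjoint[symmetric]) (auto intro!: sum.cong)
    thus "W y * f y - (\<Sum>y'\<in>neighbours S y \<inter> ?X. f y') - E * f y = (\<Sum>y'\<in>neighbours S y \<inter> (Om - ?X). f y')"
      using f y unfolding sol_def by force
    show "\<bar>\<Sum>y'\<in>neighbours S y \<inter> (Om - ?X). f y'\<bar> \<le> 2 * real (card S) * B"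
    proof (rule abs_sum_neighbours_le[OF S _ _ B])
      fix y' assume y': "y' \<in> neighbours S y \<inter> (Om - ?X)"
      have "sdist S y x \<le> r" using y sball_iff[OF S] by auto
      hence "sdist S y' x \<le> r + 1" using neighbours_sdist[OF S, of y' y x] y' by auto
      moreover have "\<not> sdist S y' x \<le> r" using y' sball_iff[OF S] Om by auto
      ultimately show "\<bar>f y'\<bar> \<le> B" using b[of y'] y' by auto
    qed auto
  qed auto
  also have "\<dots> \<le> (real (card (sball S r x)))\<^sup>2 * (2 * real (card S) * B) / \<epsilon>"
    using B eps sball_finite_card(1)[OF S]
    by (intro divide_right_mono mult_right_mono power_mono) (auto intro!: card_mono)
  finally show ?thesis by (simp add: mult.assoc)
qed

text \<open>By linearity, a solution violating the bound becomes a witness of singularity after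
  division by \<open>f z\<close>.\<close>

lemma not_sing_bound:
  assumes ns: "\<not> sing S Om W E l z Q" and f: "sol S Om W E (sball S l z \<inter> Om) f"
    and b: "\<And>y. y \<in> Om \<Longrightarrow> sdist S y z = l + 1 \<Longrightarrow> \<bar>f y\<bar> \<le> b" and Q: "Q > 0" and b0: "b \<ge> 0"
  shows "\<bar>f z\<bar> \<le> b / Q"
proof (rule ccontr)
  assume "\<not> ?thesis"
  hence gt: "b / Q < \<bar>f z\<bar>" by simp
  hence fz: "\<bar>f z\<bar> > 0" using Q b0 by (meson divide_nonneg_pos le_less_trans)
  define g where "g = (\<lambda>y. f y / f z)"
  have "sol S Om W E (sball S l z \<inter> Om) g" unfolding sol_def
  proof
    fix y assume y: "y \<in> sball S l z \<inter> Om"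
    have "(W y * f y - (\<Sum>y'\<in>neighbours S y \<inter> Om. f y')) / f z = E * f y / f z"
      using f y unfolding sol_def by auto
    thus "W y * g y - (\<Sum>y'\<in>neighbours S y \<inter> Om. g y') = E * g y"
      unfolding g_def by (simp add: diff_divide_distrib sum_divide_distrib)
  qed
  moreover have "g z = 1" using fz unfolding g_def by auto
  moreover have "\<bar>g y\<bar> \<le> Q" if "y \<in> Om" "sdist S y z = l + 1" for y
  proof -
    have "\<bar>f y\<bar> \<le> b" using b that by auto
    also have "b \<le> Q * \<bar>f z\<bar>" using gt Q by (simp add: field_simps)
    finally show ?thesis unfolding g_def using fz by (simp add: field_simps)
  qed
  ultimately show False using ns unfolding sing_def by blast
qed

section \<open>Decay along concentric balls\<close>

definition ball_max :: "nat set \<Rightarrow> config set \<Rightarrow> (config \<Rightarrow> real) \<Rightarrow> config \<Rightarrow> nat \<Rightarrow> real" where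
  "ball_max S Om f x r = Max ((\<lambda>y. \<bar>f y\<bar>) ` (sball S r x \<inter> Om))"

lemma sball_center: "finite S \<Longrightarrow> x \<in> confs S \<Longrightarrow> x \<in> sball S r x"
  unfolding sball_def using near_refl by auto

lemma ball_max_ge: "finite S \<Longrightarrow> y \<in> sball S r x \<Longrightarrow> y \<in> Om \<Longrightarrow> \<bar>f y\<bar> \<le> ball_max S Om f x r"
  unfolding ball_max_def using sball_finite_card(1)[of S r x] by (intro Max_ge) auto

lemma ball_max_le:
  assumes "finite S" "x \<in> Om" "Om \<subseteq> confs S" "\<And>y. y \<in> sball S r x \<Longrightarrow> y \<in> Om \<Longrightarrow> \<bar>f y\<bar> \<le> c"
  shows "ball_max S Om f x r \<le> c"
proof -
  have "sball S r x \<inter> Om \<noteq> {}" using sball_center[of S x r] assms by auto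
  thus ?thesis unfolding ball_max_def using sball_finite_card(1)[of S r x] assms by (subst Max_le_iff) auto
qed

lemma ball_max_mono:
  assumes "finite S" "x \<in> Om" "Om \<subseteq> confs S" "r \<le> s" shows "ball_max S Om f x r \<le> ball_max S Om f x s"
  using assms by (intro ball_max_le) (auto intro!: ball_max_ge simp: sball_iff)

lemma ball_max_nonneg:
  assumes "finite S" "x \<in> Om" "Om \<subseteq> confs S" shows "0 \<le> ball_max S Om f x r"
proof -
  have "\<bar>f x\<bar> \<le> ball_max S Om f x r" using sball_center[OF assms(1)] assms by (intro ball_max_ge) auto
  thus ?thesis by linarith
qed

text \<open>A good radius gains the factor \<open>\<theta>\<close> at the price of \<open>s\<close>
  units of radius; a bad one costs a single unit and loses nothing, by monotonicity. Thus
  \<open>n\<close> gains are available as soon as the distance to \<open>T\<close> covers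
  \<open>n * s\<close> and the bad radii.\<close>

lemma radial_descent:
  fixes M :: "nat \<Rightarrow> real"
  assumes mono: "\<And>r. r < T \<Longrightarrow> M r \<le> M (Suc r)" and nn: "\<And>r. 0 \<le> M r"
    and step: "\<And>r. r \<notin> Bad \<Longrightarrow> r + s \<le> T \<Longrightarrow> M r \<le> \<theta> * M (r + s)"
    and th: "0 \<le> \<theta>" and Bad: "finite Bad" and s: "s > 0"
  shows "r \<le> T \<Longrightarrow> n * s + card (Bad \<inter> {r..<T}) \<le> T - r \<Longrightarrow> M r \<le> \<theta> ^ n * M T"
proof (induction "T - r" arbitrary: r n rule: less_induct)
  case less
  show ?case
  proof (cases "r = T")
    case True
    hence "n = 0" using less.prems s by auto
    thus ?thesis using True by simp
  next
    case False
    hence rT: "r < T" using less.prems by simp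
    show ?thesis
    proof (cases "r \<in> Bad \<or> n = 0")
      case True
      have "card (Bad \<inter> {Suc r..<T}) + (if r \<in> Bad then 1 else 0) \<le> card (Bad \<inter> {r..<T})"
      proof (cases "r \<in> Bad")
        case b: True
        have "Bad \<inter> {r..<T} = insert r (Bad \<inter> {Suc r..<T})" using b rT by auto
        thus ?thesis using b Bad by simp
      next
        case False
        thus ?thesis using Bad by (auto intro!: card_mono)
      qed
      moreover have "card (Bad \<inter> {Suc r..<T}) \<le> T - Suc r"
        using card_mono[of "{Suc r..<T}" "Bad \<inter> {Suc r..<T}"] by simp
      ultimately have "n * s + card (Bad \<inter> {Suc r..<T}) \<le> T - Suc r"
        using True less.prems rT by (auto split: if_splits)
      hence "M (Suc r) \<le> \<theta> ^ n * M T" using rT by (intro less.hyps) auto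
      thus ?thesis using mono[OF rT] by linarith
    next
      case False
      then obtain k where k: "n = Suc k" by (cases n) auto
      have rs: "r + s \<le> T" using less.prems k by auto
      have "card (Bad \<inter> {r + s..<T}) \<le> card (Bad \<inter> {r..<T})" using Bad by (intro card_mono) auto
      hence "M (r + s) \<le> \<theta> ^ k * M T" using rs s less.prems k by (intro less.hyps) auto
      hence "\<theta> * M (r + s) \<le> \<theta> * (\<theta> ^ k * M T)" using th by (rule mult_left_mono)
      thus ?thesis using step[of r] False rs k by simp
    qed
  qed
qed

text \<open>Solving the equation for the diagonal term bounds \<open>f\<close> on each ball by
  \<open>\<theta>\<close> times its maximum one step further out, and \<open>l + 1\<close> such
  steps beat \<open>Q\<close>. This serves the initial scale, where strong disorder spreads the
  diagonal entries.\<close>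

lemma far_diagonal_not_sing:
  assumes S: "finite S" and Om: "Om \<subseteq> confs S" and z: "z \<in> Om"
    and eta: "\<eta> > 0" and far: "\<And>u. u \<in> sball S l z \<inter> Om \<Longrightarrow> \<bar>W u - E\<bar> \<ge> \<eta>"
    and th: "2 * real (card S) / \<eta> \<le> \<theta>" "\<theta> < 1" and Q: "Q \<ge> 0" "\<theta> ^ (l + 1) * Q < 1"
  shows "\<not> sing S Om W E l z Q"
proof
  assume "sing S Om W E l z Q"
  then obtain f where f: "f z = 1" "sol S Om W E (sball S l z \<inter> Om) f"
    "\<And>y. y \<in> Om \<Longrightarrow> sdist S y z = l + 1 \<Longrightarrow> \<bar>f y\<bar> \<le> Q" unfolding sing_def by blast
  let ?M = "ball_max S Om f z"
  have th0: "\<theta> \<ge> 0" using th(1) eta by (meson divide_nonneg_pos mult_nonneg_nonneg of_nat_0_le_iff order_trans zero_le_numeral)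
  have Mn: "0 \<le> ?M r" for r by (rule ball_max_nonneg[OF S z Om])
  have step: "?M r \<le> \<theta> * ?M (r + 1)" if r: "r \<le> l" for r
  proof (rule ball_max_le[OF S z Om])
    fix y assume y: "y \<in> sball S r z" "y \<in> Om"
    have yl: "y \<in> sball S l z \<inter> Om" using y r sball_iff[OF S] by auto
    have "(W y - E) * f y = (\<Sum>y'\<in>neighbours S y \<inter> Om. f y')"
      using f(2) yl unfolding sol_def by (auto simp: algebra_simps)
    moreover have "\<bar>\<Sum>y'\<in>neighbours S y \<inter> Om. f y'\<bar> \<le> 2 * real (card S) * ?M (r + 1)"
    proof (rule abs_sum_neighbours_le[OF S _ _ Mn])
      fix y' assume y': "y' \<in> neighbours S y \<inter> Om"
      have "sdist S y' z \<le> r + 1" using neighbours_sdist[OF S, of y' y z] y' y sball_iff[OF S] by auto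
      thus "\<bar>f y'\<bar> \<le> ?M (r + 1)" using y' Om by (intro ball_max_ge[OF S]) (auto simp: sball_iff[OF S])
    qed auto
    ultimately have "\<bar>W y - E\<bar> * \<bar>f y\<bar> \<le> 2 * real (card S) * ?M (r + 1)" by (simp flip: abs_mult)
    moreover have "\<eta> * \<bar>f y\<bar> \<le> \<bar>W y - E\<bar> * \<bar>f y\<bar>" using far[OF yl] by (intro mult_right_mono) auto
    ultimately have "\<bar>f y\<bar> \<le> 2 * real (card S) / \<eta> * ?M (r + 1)" using eta by (simp add: field_simps)
    also have "\<dots> \<le> \<theta> * ?M (r + 1)" using th(1) Mn by (rule mult_right_mono)
    finally show "\<bar>f y\<bar> \<le> \<theta> * ?M (r + 1)" .
  qed
  \<comment> \<open>The bound \<open>Q\<close> is known on the outermost sphere only. A larger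
    maximum would be attained in the ball of radius \<open>l\<close>, where it is at most
    \<open>\<theta> < 1\<close> times itself.\<close>
  have top: "?M (l + 1) \<le> Q"
  proof (rule ccontr)
    assume gt: "\<not> ?M (l + 1) \<le> Q"
    have "?M (l + 1) \<le> max Q (?M l)"
    proof (rule ball_max_le[OF S z Om])
      fix y assume y: "y \<in> sball S (l + 1) z" "y \<in> Om"
      show "\<bar>f y\<bar> \<le> max Q (?M l)"
      proof (cases "sdist S y z = l + 1")
        case True thus ?thesis using f(3)[OF y(2)] by auto
      next
        case False
        hence "y \<in> sball S l z" using y by (auto simp: sball_iff[OF S])
        thus ?thesis using ball_max_ge[OF S _ y(2), of l z f] by fastforce
      qed
    qed
    hence "?M (l + 1) \<le> \<theta> * ?M (l + 1)" using gt step[of l] by auto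
    hence "(1 - \<theta>) * ?M (l + 1) \<le> 0" by (simp add: algebra_simps)
    hence "?M (l + 1) \<le> 0" using th(2) by (simp add: mult_le_0_iff)
    thus False using gt Q(1) by linarith
  qed
  have "?M 0 \<le> \<theta> ^ (l + 1) * ?M (l + 1)"
    using radial_descent[of "l + 1" ?M "{}" 1 \<theta> 0 "l + 1"] step Mn th0
      ball_max_mono[OF S z Om] by auto
  also have "\<dots> \<le> \<theta> ^ (l + 1) * Q" using top th0 by (intro mult_left_mono) auto
  finally have "?M 0 < 1" using Q(2) by linarith
  moreover have "\<bar>f z\<bar> \<le> ?M 0" using sball_center[OF S, of z 0] z Om by (intro ball_max_ge[OF S]) auto
  ultimately show False using f(1) by simp
qed

text \<open>Non-resonance carries bounds from the sphere at distance \<open>r + 1\<close> into the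
  ball of radius \<open>r\<close> with loss \<open>\<Phi>\<close>; non-singular small balls centred
  on that sphere gain \<open>1 / Q\<close> relative to the ball of radius \<open>r + l + 2\<close>.
  Radii whose sphere meets a singular centre are skipped by \<open>radial_descent\<close>. A cluster
  of singular centres of radius \<open>k\<close> blocks at most \<open>2 * k + 1\<close> radii,
  whence the term \<open>6 * (2 * k + 1)\<close>.\<close>

lemma scale_step_not_sing:
  assumes S: "finite S" and Om: "Om \<subseteq> confs S" and x: "x \<in> Om" and eps: "\<epsilon> > 0"
    and nr: "\<And>r e. r \<le> L \<Longrightarrow> e \<in> spec S W (sball S r x \<inter> Om) \<Longrightarrow> \<bar>e - E\<bar> \<ge> \<epsilon>"
    and Z: "finite Z" "card Z \<le> 6"
    and cov: "\<And>z. z \<in> sball S L x \<inter> Om \<Longrightarrow> sing S Om W E l z Q \<Longrightarrow> \<exists>z0\<in>Z. sdist S z z0 \<le> k"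
    and Phi: "(real (card (sball S L x)))\<^sup>2 * (2 * real (card S)) / \<epsilon> \<le> \<Phi>" "1 \<le> \<Phi>"
    and Q: "Q > 0" "Q' \<ge> 0"
    and n: "n * (l + 2) + 6 * (2 * k + 1) \<le> L + 1" "(\<Phi> / Q) ^ n * (\<Phi> * Q') < 1"
  shows "\<not> sing S Om W E L x Q'"
proof
  assume "sing S Om W E L x Q'"
  then obtain f where f: "f x = 1" "sol S Om W E (sball S L x \<inter> Om) f"
    "\<And>y. y \<in> Om \<Longrightarrow> sdist S y x = L + 1 \<Longrightarrow> \<bar>f y\<bar> \<le> Q'" unfolding sing_def by blast
  let ?M = "ball_max S Om f x"
  have Mn: "0 \<le> ?M r" for r by (rule ball_max_nonneg[OF S x Om])
  have P: "(real (card (sball S r x)))\<^sup>2 * (2 * real (card S)) / \<epsilon> \<le> \<Phi>" if "r \<le> L" for r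
  proof -
    have "sball S r x \<subseteq> sball S L x" using that by (auto simp: sball_iff[OF S])
    hence "card (sball S r x) \<le> card (sball S L x)" by (intro card_mono sball_finite_card(1)[OF S])
    hence "(real (card (sball S r x)))\<^sup>2 * (2 * real (card S)) / \<epsilon> \<le> (real (card (sball S L x)))\<^sup>2 * (2 * real (card S)) / \<epsilon>"
      using eps by (intro divide_right_mono mult_right_mono power_mono) auto
    thus ?thesis using Phi(1) by linarith
  qed
  have ball: "?M r \<le> \<Phi> * B" if r: "r \<le> L" and B: "B \<ge> 0"
    and b: "\<And>y. y \<in> Om \<Longrightarrow> sdist S y x = r + 1 \<Longrightarrow> \<bar>f y\<bar> \<le> B" for r B
  proof (rule ball_max_le[OF S x Om])
    fix y assume y: "y \<in> sball S r x" "y \<in> Om"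
    have "sol S Om W E (sball S r x \<inter> Om) f"
      using f(2) r unfolding sol_def by (auto simp: sball_iff[OF S])
    hence "\<bar>f y\<bar> \<le> (real (card (sball S r x)))\<^sup>2 * (2 * real (card S)) / \<epsilon> * B"
      using y nr[OF r] b B by (intro ball_resolvent_bound[OF S Om eps, of W r x E f]) auto
    also have "\<dots> \<le> \<Phi> * B" using P[OF r] B by (rule mult_right_mono)
    finally show "\<bar>f y\<bar> \<le> \<Phi> * B" .
  qed
  have top: "?M (L + 1) \<le> \<Phi> * Q'"
  proof (rule ball_max_le[OF S x Om])
    fix y assume y: "y \<in> sball S (L + 1) x" "y \<in> Om"
    show "\<bar>f y\<bar> \<le> \<Phi> * Q'"
    proof (cases "sdist S y x = L + 1")
      case True
      hence "\<bar>f y\<bar> \<le> 1 * Q'" using f(3)[OF y(2)] by auto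
      also have "\<dots> \<le> \<Phi> * Q'" using Phi(2) Q(2) by (rule mult_right_mono)
      finally show ?thesis .
    next
      case False
      hence "y \<in> sball S L x" using y by (auto simp: sball_iff[OF S])
      hence "\<bar>f y\<bar> \<le> ?M L" using y by (intro ball_max_ge[OF S]) auto
      also have "\<dots> \<le> \<Phi> * Q'" using f(3) Q(2) by (intro ball) auto
      finally show ?thesis .
    qed
  qed
  \<comment> \<open>The offset is one because the ball of radius \<open>r\<close> is controlled by
    the points at distance \<open>r + 1\<close>.\<close>
  define Bad where "Bad = {r. \<exists>z \<in> sball S L x \<inter> Om. sing S Om W E l z Q \<and> sdist S z x = r + 1}"
  have "Bad \<subseteq> (\<Union>z0\<in>Z. {sdist S z0 x - k - 1..sdist S z0 x + k - 1})"
  proof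
    fix r assume "r \<in> Bad"
    then obtain z where z: "z \<in> sball S L x \<inter> Om" "sing S Om W E l z Q" "sdist S z x = r + 1"
      unfolding Bad_def by blast
    then obtain z0 where z0: "z0 \<in> Z" "sdist S z z0 \<le> k" using cov by blast
    have "sdist S z x \<le> sdist S z z0 + sdist S z0 x" "sdist S z0 x \<le> sdist S z z0 + sdist S z x"
      using sdist_triangle[OF S] sdist_sym by metis+
    thus "r \<in> (\<Union>z0\<in>Z. {sdist S z0 x - k - 1..sdist S z0 x + k - 1})"
      using z0 z(3) by (intro UN_I[OF z0(1)]) auto
  qed
  moreover have "finite (\<Union>z0\<in>Z. {sdist S z0 x - k - 1..sdist S z0 x + k - 1})" using Z by auto
  ultimately have Bf: "finite Bad"
    and Bc0: "card Bad \<le> card (\<Union>z0\<in>Z. {sdist S z0 x - k - 1..sdist S z0 x + k - 1})"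
    by (auto intro: finite_subset card_mono)
  note Bc0
  also have "\<dots> \<le> (\<Sum>z0\<in>Z. card {sdist S z0 x - k - 1..sdist S z0 x + k - 1})" by (rule card_UN_le[OF Z(1)])
  also have "\<dots> \<le> (\<Sum>z0\<in>Z. 2 * k + 1)" by (intro sum_mono) auto
  also have "\<dots> = card Z * (2 * k + 1)" by simp
  also have "\<dots> \<le> 6 * (2 * k + 1)" using Z(2) by (intro mult_right_mono) auto
  finally have Bc: "card Bad \<le> 6 * (2 * k + 1)" .
  have step: "?M r \<le> \<Phi> / Q * ?M (r + (l + 2))" if r: "r \<notin> Bad" "r + (l + 2) \<le> L + 1" for r
  proof -
    have "?M r \<le> \<Phi> * (?M (r + (l + 2)) / Q)"
    proof (rule ball)
      show "r \<le> L" using r by simp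
      show "0 \<le> ?M (r + (l + 2)) / Q" using Mn Q by simp
      fix y assume y: "y \<in> Om" "sdist S y x = r + 1"
      have yL: "y \<in> sball S L x \<inter> Om" using y r Om by (auto simp: sball_iff[OF S])
      hence ns: "\<not> sing S Om W E l y Q" using r(1) y(2) unfolding Bad_def by blast
      show "\<bar>f y\<bar> \<le> ?M (r + (l + 2)) / Q"
      proof (rule not_sing_bound[OF ns _ _ Q(1) Mn])
        have "sball S l y \<subseteq> sball S L x"
        proof
          fix u assume u: "u \<in> sball S l y"
          hence "sdist S u x \<le> l + (r + 1)"
            using sdist_triangle[OF S, of u x y] y(2) by (auto simp: sball_iff[OF S])
          thus "u \<in> sball S L x" using u r(2) by (auto simp: sball_iff[OF S])
        qed
        thus "sol S Om W E (sball S l y \<inter> Om) f" using f(2) unfolding sol_def by auto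
        fix u assume u: "u \<in> Om" "sdist S u y = l + 1"
        have "sdist S u x \<le> r + (l + 2)" using sdist_triangle[OF S, of u x y] u y by simp
        thus "\<bar>f u\<bar> \<le> ?M (r + (l + 2))" using u Om by (intro ball_max_ge[OF S]) (auto simp: sball_iff[OF S])
      qed
    qed
    thus ?thesis by simp
  qed
  have "?M 0 \<le> (\<Phi> / Q) ^ n * ?M (L + 1)"
  proof (rule radial_descent[of "L + 1" ?M Bad "l + 2"])
    have "card (Bad \<inter> {0..<L + 1}) \<le> card Bad" using Bf by (intro card_mono) auto
    thus "n * (l + 2) + card (Bad \<inter> {0..<L + 1}) \<le> L + 1 - 0" using Bc n(1) by linarith
    show "0 \<le> \<Phi> / Q" using Phi Q by auto
  qed (use step Mn Bf ball_max_mono[OF S x Om] in auto)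
  also have "\<dots> \<le> (\<Phi> / Q) ^ n * (\<Phi> * Q')" using top Phi Q by (intro mult_left_mono) auto
  finally have "?M 0 < 1" using n(2) by linarith
  moreover have "\<bar>f x\<bar> \<le> ?M 0" using sball_center[OF S, of x 0] x Om by (intro ball_max_ge[OF S]) auto
  ultimately show False using f(1) by simp
qed

text \<open>Without a singular centre the maximum of \<open>\<bar>f\<bar>\<close> would be at most
  itself divided by \<open>Q > 1\<close>. Once a singular \<open>z\<close> is fixed, every centre
  beyond distance \<open>k\<close> from it is non-singular, and each use of a small ball gains
  \<open>1 / Q\<close> while approaching \<open>z\<close> by at most \<open>l + 1\<close>.\<close>

lemma eigenfunction_decay:
  assumes S: "finite S" and Om: "Om \<subseteq> confs S" "finite Om"
    and f: "sol S Om W E Om f" and n1: "(\<Sum>y\<in>Om. f y * f y) = 1" and Q: "Q > 1"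
    and cl: "\<And>z w. z \<in> Om \<Longrightarrow> w \<in> Om \<Longrightarrow> sing S Om W E l z Q \<Longrightarrow> sing S Om W E l w Q \<Longrightarrow> sdist S z w \<le> k"
  shows "\<exists>z\<in>Om. \<forall>y\<in>Om. \<forall>n. n * (l + 1) + k < sdist S y z \<longrightarrow> \<bar>f y\<bar> \<le> (1 / Q) ^ n"
proof -
  have step: "\<bar>f y\<bar> \<le> b / Q" if "y \<in> Om" "\<not> sing S Om W E l y Q" "b \<ge> 0"
    "\<And>u. u \<in> Om \<Longrightarrow> sdist S u y = l + 1 \<Longrightarrow> \<bar>f u\<bar> \<le> b" for y b
    using that f Q by (intro not_sing_bound[of S Om W E l y Q f b]) (auto simp: sol_def)
  have le1: "\<bar>f y\<bar> \<le> 1" if "y \<in> Om" for y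
  proof -
    have "f y * f y \<le> (\<Sum>y\<in>Om. f y * f y)" using that Om by (intro member_le_sum) auto
    hence "(f y)\<^sup>2 \<le> 1" using n1 by (simp add: power2_eq_square)
    thus ?thesis by (simp add: abs_square_le_1)
  qed
  have "\<exists>z\<in>Om. sing S Om W E l z Q"
  proof (rule ccontr)
    assume no: "\<not> ?thesis"
    have ne: "Om \<noteq> {}" using n1 by auto
    obtain y where y: "y \<in> Om" "\<And>u. u \<in> Om \<Longrightarrow> \<bar>f u\<bar> \<le> \<bar>f y\<bar>"
      using ex_argmax[OF Om(2) ne, of "\<lambda>u. \<bar>f u\<bar>"] by blast
    have "\<bar>f y\<bar> \<le> \<bar>f y\<bar> / Q" using y no by (intro step) auto
    hence "\<bar>f y\<bar> * (Q - 1) \<le> 0" using Q by (simp add: field_simps)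
    hence "\<bar>f y\<bar> \<le> 0" using Q by (simp add: mult_le_0_iff)
    hence "\<forall>u\<in>Om. f u = 0" using y(2) by fastforce
    thus False using n1 by simp
  qed
  then obtain z where z: "z \<in> Om" "sing S Om W E l z Q" by blast
  have "\<bar>f y\<bar> \<le> (1 / Q) ^ n" if "y \<in> Om" "n * (l + 1) + k < sdist S y z" for y n
    using that
  proof (induction n arbitrary: y)
    case 0 thus ?case using le1 by simp
  next
    case (Suc n)
    have ns: "\<not> sing S Om W E l y Q" using cl[OF Suc.prems(1) z(1) _ z(2)] Suc.prems(2) by auto
    have "\<bar>f y\<bar> \<le> (1 / Q) ^ n / Q"
    proof (rule step[OF Suc.prems(1) ns])
      fix u assume u: "u \<in> Om" "sdist S u y = l + 1"
      have "sdist S y z \<le> sdist S u y + sdist S u z"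
        using sdist_triangle[OF S, of y z u] sdist_sym[of S y u] by simp
      hence "n * (l + 1) + k < sdist S u z" using Suc.prems(2) u(2) by simp
      thus "\<bar>f u\<bar> \<le> (1 / Q) ^ n" using Suc.IH u(1) by blast
    qed (use Q in auto)
    thus ?case by simp
  qed
  thus ?thesis using z(1) by blast
qed

section \<open>Balls around split configurations\<close>

text \<open>Localization expressed without a centre. This form is suited to products: an
  eigenfunction of two non-interacting systems has small correlations as soon as one factor
  does.\<close>

definition corr_loc :: "nat set \<Rightarrow> (config \<Rightarrow> real) \<Rightarrow> config set \<Rightarrow> nat \<Rightarrow> real \<Rightarrow> bool" where
  "corr_loc S W X l \<delta> \<longleftrightarrow> (\<forall>f e. sol S X W e X f \<and> (\<Sum>y\<in>X. f y * f y) = 1 \<longrightarrow>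
     (\<forall>y\<in>X. \<forall>z\<in>X. l \<le> sdist S y z \<longrightarrow> \<bar>f y * f z\<bar> \<le> \<delta>))"

lemma corr_locD:
  "corr_loc S W X l \<delta> \<Longrightarrow> sol S X W e X f \<Longrightarrow> (\<Sum>y\<in>X. f y * f y) = 1 \<Longrightarrow> y \<in> X \<Longrightarrow> z \<in> X \<Longrightarrow>
     l \<le> sdist S y z \<Longrightarrow> \<bar>f y * f z\<bar> \<le> \<delta>"
  unfolding corr_loc_def by blast

definition restr :: "nat set \<Rightarrow> config \<Rightarrow> config" where
  "restr J y = (\<lambda>j. if j \<in> J then y j else 0)"

text \<open>Configurations vanish off their labels, so addition juxtaposes two disjoint
  groups.\<close>

definition glue :: "config \<Rightarrow> config \<Rightarrow> config" where
  "glue y1 y2 = (\<lambda>j. y1 j + y2 j)"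

lemma cnt_restr: "cnt J (restr J y) s = cnt J y s"
  by (rule cnt_cong) (simp add: restr_def)

lemma sdist_restr: "sdist J (restr J y) (restr J z) = sdist J y z"
  unfolding sdist_def near_def cnt_restr ..

lemma cnt_union: "finite J \<Longrightarrow> finite K \<Longrightarrow> J \<inter> K = {} \<Longrightarrow> cnt (J \<union> K) y s = cnt J y s + cnt K y s"
proof -
  assume a: "finite J" "finite K" "J \<inter> K = {}"
  have "{j \<in> J \<union> K. y j \<le> s} = {j \<in> J. y j \<le> s} \<union> {j \<in> K. y j \<le> s}" by auto
  thus ?thesis unfolding cnt_def using a by (simp add: card_Un_disjoint disjoint_iff)
qed

lemma cnt_full: "finite J \<Longrightarrow> cnt J y s = int (card J) \<longleftrightarrow> (\<forall>j\<in>J. y j \<le> s)"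
proof
  assume J: "finite J" and "cnt J y s = int (card J)"
  hence "card {j \<in> J. y j \<le> s} = card J" unfolding cnt_def by simp
  hence "{j \<in> J. y j \<le> s} = J" using J by (intro card_subset_eq) auto
  thus "\<forall>j\<in>J. y j \<le> s" by blast
next
  assume "\<forall>j\<in>J. y j \<le> s"
  hence "{j \<in> J. y j \<le> s} = J" by auto
  thus "cnt J y s = int (card J)" unfolding cnt_def by simp
qed

lemma cnt_zero: "finite J \<Longrightarrow> cnt J y s = 0 \<longleftrightarrow> (\<forall>j\<in>J. s < y j)"
  unfolding cnt_def by (auto simp: card_eq_0_iff)

lemma sball_iff_cnt:
  "y \<in> sball S l z \<longleftrightarrow> y \<in> confs S \<and> (\<forall>s. cnt S z (s - int l) \<le> cnt S y s \<and> cnt S y s \<le> cnt S z (s + int l))"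
  unfolding sball_def near_def
proof (intro iffI; clarsimp)
  fix s assume "\<forall>t. cnt S y t \<le> cnt S z (t + int l) \<and> cnt S z t \<le> cnt S y (t + int l)"
  from this[rule_format, of "s - int l"] show "cnt S z (s - int l) \<le> cnt S y s" by simp
next
  fix s assume "\<forall>s. cnt S z (s - int l) \<le> cnt S y s \<and> cnt S y s \<le> cnt S z (s + int l)"
  from this[rule_format, of "s + int l"] show "cnt S z s \<le> cnt S y (s + int l)" by simp
qed

text \<open>Counts add over disjoint groups. The use is in the contrapositive: if two configurations
  are far apart, one of the groups is.\<close>

lemma sdist_union_le:
  assumes "finite J" "finite K" "J \<inter> K = {}"
  shows "sdist (J \<union> K) y z \<le> max (sdist J y z) (sdist K y z)"
proof -
  let ?r = "max (sdist J y z) (sdist K y z)"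
  have "near J ?r y z" "near K ?r y z" using assms near_iff_sdist by auto
  hence "near (J \<union> K) ?r y z" unfolding near_def cnt_union[OF assms] by (meson add_mono)
  thus ?thesis using assms near_iff_sdist by blast
qed

lemma energy_glue:
  assumes fin: "finite J" "finite K" and disj: "J \<inter> K = {}"
    and y1: "y1 \<in> confs J" and y2: "y2 \<in> confs K"
    and U: "\<And>i j. i \<in> J \<Longrightarrow> j \<in> K \<Longrightarrow> U (y1 i - y2 j) = 0 \<and> U (y2 j - y1 i) = 0"
  shows "energy lam v U (J \<union> K) (glue y1 y2) = energy lam v U J y1 + energy lam v U K y2"
proof -
  let ?y = "glue y1 y2"
  have yJ: "?y j = y1 j" if "j \<in> J" for j using that y2 disj unfolding glue_def confs_def by auto
  have yK: "?y j = y2 j" if "j \<in> K" for j using that y1 disj unfolding glue_def confs_def by auto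
  have split: "(\<Sum>j\<in>J \<union> K. F j) = (\<Sum>j\<in>J. F j) + (\<Sum>j\<in>K. F j)" for F :: "nat \<Rightarrow> real"
    using fin disj by (rule sum.union_disjoint)
  have split2: "(\<Sum>i\<in>{i \<in> J \<union> K. i < j}. F i) = (\<Sum>i\<in>{i \<in> J. i < j}. F i) + (\<Sum>i\<in>{i \<in> K. i < j}. F i)"
    for F :: "nat \<Rightarrow> real" and j
  proof -
    have "{i \<in> J \<union> K. i < j} = {i \<in> J. i < j} \<union> {i \<in> K. i < j}" by auto
    thus ?thesis using fin disj by (simp add: sum.union_disjoint disjoint_iff)
  qed
  have 1: "(\<Sum>j\<in>J \<union> K. v (?y j)) = (\<Sum>j\<in>J. v (y1 j)) + (\<Sum>j\<in>K. v (y2 j))"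
    unfolding split using yJ yK by (intro arg_cong2[of _ _ _ _ "(+)"] sum.cong) auto
  have 2: "(\<Sum>j\<in>J. \<Sum>i\<in>{i \<in> J \<union> K. i < j}. U (?y i - ?y j)) = (\<Sum>j\<in>J. \<Sum>i\<in>{i \<in> J. i < j}. U (y1 i - y1 j))"
  proof (rule sum.cong[OF refl])
    fix j assume j: "j \<in> J"
    have "(\<Sum>i\<in>{i \<in> K. i < j}. U (?y i - ?y j)) = 0" using U[OF j] yJ[OF j] yK by (intro sum.neutral) auto
    moreover have "(\<Sum>i\<in>{i \<in> J. i < j}. U (?y i - ?y j)) = (\<Sum>i\<in>{i \<in> J. i < j}. U (y1 i - y1 j))"
      using yJ j by (intro sum.cong) auto
    ultimately show "(\<Sum>i\<in>{i \<in> J \<union> K. i < j}. U (?y i - ?y j)) = (\<Sum>i\<in>{i \<in> J. i < j}. U (y1 i - y1 j))"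
      unfolding split2 by simp
  qed
  have 3: "(\<Sum>j\<in>K. \<Sum>i\<in>{i \<in> J \<union> K. i < j}. U (?y i - ?y j)) = (\<Sum>j\<in>K. \<Sum>i\<in>{i \<in> K. i < j}. U (y2 i - y2 j))"
  proof (rule sum.cong[OF refl])
    fix j assume j: "j \<in> K"
    have "(\<Sum>i\<in>{i \<in> J. i < j}. U (?y i - ?y j)) = 0" using U[OF _ j] yJ yK[OF j] by (intro sum.neutral) auto
    moreover have "(\<Sum>i\<in>{i \<in> K. i < j}. U (?y i - ?y j)) = (\<Sum>i\<in>{i \<in> K. i < j}. U (y2 i - y2 j))"
      using yK j by (intro sum.cong) auto
    ultimately show "(\<Sum>i\<in>{i \<in> J \<union> K. i < j}. U (?y i - ?y j)) = (\<Sum>i\<in>{i \<in> K. i < j}. U (y2 i - y2 j))"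
      unfolding split2 by simp
  qed
  show ?thesis unfolding energy_def 1 split[of "\<lambda>j. \<Sum>i\<in>{i \<in> J \<union> K. i < j}. U (?y i - ?y j)"] 2 3
    by (simp add: algebra_simps)
qed

lemma restr_glue:
  assumes "y1 \<in> confs J" "y2 \<in> confs K" "J \<inter> K = {}"
  shows "restr J (glue y1 y2) = y1" "restr K (glue y1 y2) = y2"
  using assms unfolding restr_def glue_def confs_def by (auto simp: fun_eq_iff)

lemma glue_restr: "y \<in> confs (J \<union> K) \<Longrightarrow> J \<inter> K = {} \<Longrightarrow> glue (restr J y) (restr K y) = y"
  unfolding restr_def glue_def confs_def by (auto simp: fun_eq_iff)

lemma restr_confs: "restr J y \<in> confs J"
  unfolding restr_def confs_def by auto

lemma glue_confs: "y1 \<in> confs J \<Longrightarrow> y2 \<in> confs K \<Longrightarrow> glue y1 y2 \<in> confs (J \<union> K)"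
  unfolding glue_def confs_def by auto

lemma cnt_glue:
  assumes "finite J" "finite K" "J \<inter> K = {}" "y1 \<in> confs J" "y2 \<in> confs K"
  shows "cnt (J \<union> K) (glue y1 y2) s = cnt J y1 s + cnt K y2 s"
  using cnt_union[OF assms(1-3), of "glue y1 y2" s] restr_glue[OF assms(4,5,3)]
    cnt_restr[of J "glue y1 y2" s] cnt_restr[of K "glue y1 y2" s] by simp

text \<open>A ball around a split configuration has, up to relabelling, a product structure: the
  component of the centre is a product of two regions for fewer particles which do not interact.\<close>

lemma split_not_sing:
  assumes fin: "finite J" "finite K" and disj: "J \<inter> K = {}"
    and z: "z \<in> region (J \<union> K) lo hi"
    and zJ: "\<And>j. j \<in> J \<Longrightarrow> z j \<le> t" and zK: "\<And>j. j \<in> K \<Longrightarrow> t + 4 * int l \<le> z j" and l: "l \<ge> 1"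
    and U: "\<And>u. \<bar>u\<bar> \<ge> 2 * int l \<Longrightarrow> U u = 0"
  obtains lo1 hi1 lo2 hi2 where
    "region J lo1 hi1 \<subseteq> sball J l (restr J z)" "region K lo2 hi2 \<subseteq> sball K l (restr K z)"
    "\<And>lam v E \<epsilon> \<delta> Q. \<epsilon> > 0 \<Longrightarrow> Q \<ge> 0 \<Longrightarrow> \<delta> \<ge> 0 \<Longrightarrow>
       corr_loc J (energy lam v U J) (region J lo1 hi1) l \<delta> \<Longrightarrow>
       corr_loc K (energy lam v U K) (region K lo2 hi2) l \<delta> \<Longrightarrow>
       (\<And>e. e \<in> spec (J \<union> K) (energy lam v U (J \<union> K)) (sball (J \<union> K) l z \<inter> region (J \<union> K) lo hi)
          \<Longrightarrow> \<bar>e - E\<bar> \<ge> \<epsilon>) \<Longrightarrow>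
       (real (card (sball (J \<union> K) l z)))\<^sup>2 * (2 * real (card (J \<union> K))) * \<delta> / \<epsilon> * Q < 1 \<Longrightarrow>
       \<not> sing (J \<union> K) (region (J \<union> K) lo hi) (energy lam v U (J \<union> K)) E l z Q"
proof -
  define S where "S = J \<union> K"
  define Om where "Om = region S lo hi"
  have S: "finite S" using fin S_def by simp
  have Omc: "Om \<subseteq> confs S" unfolding Om_def region_def by auto
  \<comment> \<open>A level between the two groups: on the product built below, the lower group
    stays at or below \<open>t + l\<close> and the upper one at or above
    \<open>t + 3 * l\<close>.\<close>
  define t0 where "t0 = t + int l"
  define lo' where "lo' = (\<lambda>s. max (lo s) (cnt S z (s - int l)))"
  define hi' where "hi' = (\<lambda>s. min (hi s) (cnt S z (s + int l)))"
  \<comment> \<open>Below \<open>t0\<close> only the lower group is counted, and from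
    \<open>t0\<close> on it is complete. The bounds on the joint count therefore separate into
    bounds for each group, those of the upper one after subtracting \<open>card J\<close>.\<close>
  define lo1 where "lo1 = (\<lambda>s. if s < t0 then lo' s else int (card J))"
  define hi1 where "hi1 = (\<lambda>s. if s < t0 then hi' s else int (card J))"
  define lo2 where "lo2 = (\<lambda>s. if s < t0 then 0 else lo' s - int (card J))"
  define hi2 where "hi2 = (\<lambda>s. if s < t0 then 0 else hi' s - int (card J))"
  define R where "R = sball S l z \<inter> Om"
  define R1 where "R1 = region J lo1 hi1"
  define R2 where "R2 = region K lo2 hi2"
  have Rc: "R \<subseteq> confs S" "R1 \<subseteq> confs J" "R2 \<subseteq> confs K"
    unfolding R_def R1_def R2_def region_def using Omc by auto
  have R_iff: "y \<in> R \<longleftrightarrow> y \<in> confs S \<and> (\<forall>s. lo' s \<le> cnt S y s \<and> cnt S y s \<le> hi' s)" for y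
    unfolding R_def Om_def region_def lo'_def hi'_def Int_iff sball_iff_cnt by auto
  have cz: "cnt S z s = cnt J z s + cnt K z s" for s unfolding S_def by (rule cnt_union[OF fin disj])
  have czK: "cnt K z s = 0" if "s < t + 4 * int l" for s using cnt_zero[OF fin(2)] zK that by force
  have czJ: "cnt J z s = int (card J)" if "s \<ge> t" for s using cnt_full[OF fin(1)] zJ that by force
  have low1: "y j \<le> t0" if "y \<in> R1" "j \<in> J" for y j
  proof -
    have "lo1 t0 \<le> cnt J y t0" using that(1) unfolding R1_def region_def by blast
    hence "int (card J) \<le> cnt J y t0" unfolding lo1_def by simp
    hence "cnt J y t0 = int (card J)" using cnt_le_card[OF fin(1), of y t0] by linarith
    thus ?thesis using cnt_full[OF fin(1)] that(2) by auto
  qed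
  have high2: "t + 3 * int l \<le> y j" if "y \<in> R2" "j \<in> K" for y j
  proof -
    have "cnt K y (t + 3 * int l - 1) \<le> hi2 (t + 3 * int l - 1)"
      using that(1) unfolding R2_def region_def by blast
    also have "\<dots> = hi' (t + 3 * int l - 1) - int (card J)" using l unfolding hi2_def t0_def by simp
    also have "\<dots> \<le> 0" unfolding hi'_def cz using czK[of "t + 3 * int l - 1 + int l"]
      cnt_le_card[OF fin(1), of z "t + 3 * int l - 1 + int l"] by simp
    finally have "cnt K y (t + 3 * int l - 1) = 0" using cnt_nonneg[of K y] by (simp add: order_antisym)
    thus ?thesis using cnt_zero[OF fin(2)] that(2) by force
  qed
  have glueR: "glue y1 y2 \<in> R" if y: "y1 \<in> R1" "y2 \<in> R2" for y1 y2
    unfolding R_iff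
  proof (intro conjI allI)
    have c: "y1 \<in> confs J" "y2 \<in> confs K" using y Rc by auto
    show "glue y1 y2 \<in> confs S" unfolding S_def using glue_confs c by blast
    fix s
    have m: "cnt S (glue y1 y2) s = cnt J y1 s + cnt K y2 s"
      unfolding S_def by (rule cnt_glue[OF fin disj c])
    have b1: "lo1 s \<le> cnt J y1 s \<and> cnt J y1 s \<le> hi1 s" using y(1) unfolding R1_def region_def by auto
    have b2: "lo2 s \<le> cnt K y2 s \<and> cnt K y2 s \<le> hi2 s" using y(2) unfolding R2_def region_def by auto
    show "lo' s \<le> cnt S (glue y1 y2) s" "cnt S (glue y1 y2) s \<le> hi' s"
      using b1 b2 unfolding m lo1_def lo2_def hi1_def hi2_def by (auto split: if_splits)
  qed
  have splitR: "restr J y \<in> R1 \<and> restr K y \<in> R2"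
    if y: "y \<in> R" "\<And>j. j \<in> J \<Longrightarrow> y j \<le> t0" "\<And>j. j \<in> K \<Longrightarrow> t0 < y j" for y
  proof -
    have c: "cnt S y s = cnt J (restr J y) s + cnt K (restr K y) s" for s
      unfolding S_def cnt_restr by (rule cnt_union[OF fin disj])
    have k0: "cnt K (restr K y) s = 0" if "s < t0" for s
      unfolding cnt_restr using cnt_zero[OF fin(2)] y(3) that by force
    have jf: "cnt J (restr J y) s = int (card J)" if "s \<ge> t0" for s
      unfolding cnt_restr using cnt_full[OF fin(1)] y(2) that by force
    have b: "lo' s \<le> cnt S y s \<and> cnt S y s \<le> hi' s" for s using y(1) R_iff by auto
    have "lo1 s \<le> cnt J (restr J y) s \<and> cnt J (restr J y) s \<le> hi1 s" for s
      using b[of s] k0[of s] jf[of s] unfolding c lo1_def hi1_def by auto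
    moreover have "lo2 s \<le> cnt K (restr K y) s \<and> cnt K (restr K y) s \<le> hi2 s" for s
      using b[of s] k0[of s] jf[of s] unfolding c lo2_def hi2_def by auto
    ultimately show ?thesis unfolding R1_def R2_def region_def using restr_confs by auto
  qed
  have sub1: "R1 \<subseteq> sball J l (restr J z)"
  proof
    fix y assume y: "y \<in> R1"
    have "cnt J z (s - int l) \<le> cnt J y s \<and> cnt J y s \<le> cnt J z (s + int l)" for s
    proof (cases "s < t0")
      case True
      hence "lo' s \<le> cnt J y s" "cnt J y s \<le> hi' s"
        using y unfolding R1_def region_def lo1_def hi1_def by (auto split: if_splits dest!: spec[of _ s])
      moreover have "cnt K z (s - int l) = 0" "cnt K z (s + int l) = 0" using True l t0_def by (auto intro!: czK)
      ultimately show ?thesis unfolding lo'_def hi'_def cz by auto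
    next
      case False
      hence "cnt J y s = int (card J)"
        using y unfolding R1_def region_def lo1_def hi1_def by (auto dest!: spec[of _ s])
      moreover have "cnt J z (s + int l) = int (card J)" using False t0_def by (intro czJ) auto
      ultimately show ?thesis using cnt_le_card[OF fin(1), of z "s - int l"] by simp
    qed
    thus "y \<in> sball J l (restr J z)" unfolding sball_iff_cnt cnt_restr using y Rc by auto
  qed
  have sub2: "R2 \<subseteq> sball K l (restr K z)"
  proof
    fix y assume y: "y \<in> R2"
    have "cnt K z (s - int l) \<le> cnt K y s \<and> cnt K y s \<le> cnt K z (s + int l)" for s
    proof (cases "s < t0")
      case True
      hence "cnt K y s = 0"
        using y unfolding R2_def region_def lo2_def hi2_def by (auto dest!: spec[of _ s])
      moreover have "cnt K z (s - int l) = 0" using True l t0_def by (auto intro!: czK)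
      ultimately show ?thesis using cnt_nonneg[of K z] by simp
    next
      case False
      hence "lo' s - int (card J) \<le> cnt K y s" "cnt K y s \<le> hi' s - int (card J)"
        using y unfolding R2_def region_def lo2_def hi2_def by (auto split: if_splits dest!: spec[of _ s])
      moreover have "cnt J z (s - int l) = int (card J)" "cnt J z (s + int l) = int (card J)"
        using False t0_def by (auto intro!: czJ)
      ultimately show ?thesis unfolding lo'_def hi'_def cz by auto
    qed
    thus "y \<in> sball K l (restr K z)" unfolding sball_iff_cnt cnt_restr using y Rc by auto
  qed
  have fR: "finite R" "finite R1" "finite R2"
    using sball_finite_card(1) S fin sub1 sub2 unfolding R_def by (auto intro: finite_subset)
  \<comment> \<open>The ball is invariant under permutations of all labels, so it also contains
    configurations in which particles of the two groups are exchanged. \<open>X\<close> is the part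
    around \<open>z\<close> in which the labels keep to their groups.\<close>
  define X where "X = (\<lambda>(a, b). glue a b) ` (R1 \<times> R2)"
  have inj: "inj_on (\<lambda>(a, b). glue a b) (R1 \<times> R2)"
  proof (rule inj_onI, clarsimp)
    fix a b a' b' assume a: "a \<in> R1" "b \<in> R2" "a' \<in> R1" "b' \<in> R2" "glue a b = glue a' b'"
    show "a = a' \<and> b = b'"
      using restr_glue[of a J b K] restr_glue[of a' J b' K] a Rc disj by (metis subsetD)
  qed
  have X_iff: "y \<in> X \<longleftrightarrow> y \<in> confs S \<and> restr J y \<in> R1 \<and> restr K y \<in> R2" for y
  proof
    assume "y \<in> X"
    then obtain a b where ab: "a \<in> R1" "b \<in> R2" "y = glue a b" unfolding X_def by auto
    have "restr J y = a" "restr K y = b" unfolding ab(3) using restr_glue[of a J b K] ab Rc disj by blast+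
    thus "y \<in> confs S \<and> restr J y \<in> R1 \<and> restr K y \<in> R2" using ab glueR Rc by auto
  next
    assume "y \<in> confs S \<and> restr J y \<in> R1 \<and> restr K y \<in> R2"
    thus "y \<in> X" unfolding X_def using glue_restr[of y J K] disj S_def by force
  qed
  have XR: "X \<subseteq> R" unfolding X_def using glueR by auto
  have fX: "finite X" "card X = card (R1 \<times> R2)"
    unfolding X_def using fR card_image[OF inj] by auto
  have sumX: "(\<Sum>y\<in>X. F y) = (\<Sum>(a, b)\<in>R1 \<times> R2. F (glue a b))" for F :: "config \<Rightarrow> real"
    unfolding X_def using sum.reindex[OF inj, of F] by (simp add: case_prod_unfold comp_def)
  have zX: "z \<in> X"
  proof -
    have zS: "z \<in> Om" using z unfolding Om_def S_def .
    hence "z \<in> R" unfolding R_def using sball_center[OF S] Omc by auto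
    moreover have "z j \<le> t0" if "j \<in> J" for j using zJ[OF that] unfolding t0_def by simp
    moreover have "t0 < z j" if "j \<in> K" for j using zK[OF that] l unfolding t0_def by simp
    ultimately show ?thesis using splitR[of z] zS Omc unfolding X_iff by auto
  qed
  \<comment> \<open>One hop cannot carry a particle of the upper group down to \<open>t0\<close>,
    while the lower bound on the count demands \<open>card J\<close> particles there. Hence the
    whole lower group stays, and no hop inside the ball leaves \<open>X\<close>.\<close>
  have closedX: "y' \<in> X" if y: "y \<in> X" "y' \<in> neighbours S y" "y' \<in> R" for y y'
  proof -
    obtain j where j: "j \<in> S" "y' = y(j := y j + 1) \<or> y' = y(j := y j - 1)" using y(2) unfolding neighbours_def by auto
    have yJ: "y i \<le> t0" if "i \<in> J" for i using low1[of "restr J y" i] y(1) that unfolding X_iff restr_def by auto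
    have yK: "t + 3 * int l \<le> y i" if "i \<in> K" for i using high2[of "restr K y" i] y(1) that unfolding X_iff restr_def by auto
    have K': "t0 < y' i" if i: "i \<in> K" for i
      using yK[OF i] j(2) l unfolding t0_def by auto
    have "cnt S z t \<le> cnt S y' t0"
      using y(3) unfolding R_iff lo'_def t0_def by (auto dest!: spec[of _ "t + int l"])
    moreover have "cnt S z t = int (card J)" unfolding cz using czJ[of t] czK[of t] l by auto
    moreover have "cnt S y' t0 = cnt J y' t0 + cnt K y' t0" unfolding S_def by (rule cnt_union[OF fin disj])
    moreover have "cnt K y' t0 = 0" using cnt_zero[OF fin(2)] K' by auto
    ultimately have "cnt J y' t0 = int (card J)" using cnt_le_card[OF fin(1), of y' t0] by linarith
    hence "\<And>i. i \<in> J \<Longrightarrow> y' i \<le> t0" using cnt_full[OF fin(1)] by auto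
    thus ?thesis using splitR[OF y(3) _ K'] y(3) Rc unfolding X_iff by auto
  qed
  have nbsum: "(\<Sum>y'\<in>neighbours S (glue a b) \<inter> X. F y') =
      (\<Sum>a'\<in>neighbours J a \<inter> R1. F (glue a' b)) + (\<Sum>b'\<in>neighbours K b \<inter> R2. F (glue a b'))"
    if ab: "a \<in> R1" "b \<in> R2" for a b and F :: "config \<Rightarrow> real"
  proof -
    have c: "a \<in> confs J" "b \<in> confs K" using ab Rc by auto
    let ?A = "(\<lambda>a'. glue a' b) ` (neighbours J a \<inter> R1)" and ?B = "(\<lambda>b'. glue a b') ` (neighbours K b \<inter> R2)"
    have mj: "(glue a b)(j := glue a b j + d) = glue (a(j := a j + d)) b" for j d
      unfolding glue_def by auto
    have mk: "(glue a b)(j := glue a b j + d) = glue a (b(j := b j + d))" for j d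
      unfolding glue_def by auto
    have nb: "y \<in> neighbours T x \<longleftrightarrow> (\<exists>j\<in>T. \<exists>d\<in>{1,-1}. y = x(j := x j + d))" for y T x
      unfolding neighbours_def by auto
    have eq: "neighbours S (glue a b) \<inter> X = ?A \<union> ?B"
    proof (intro equalityI subsetI)
      fix y assume y: "y \<in> neighbours S (glue a b) \<inter> X"
      then obtain j d where jd: "j \<in> S" "d \<in> {1,-1}" "y = (glue a b)(j := glue a b j + d)"
        using nb[of y S "glue a b"] by blast
      show "y \<in> ?A \<union> ?B"
      proof (cases "j \<in> J")
        case True
        have y': "y = glue (a(j := a j + d)) b" using jd mj by simp
        have cj: "a(j := a j + d) \<in> confs J" using c(1) True unfolding confs_def by auto
        have "restr J y = a(j := a j + d)" unfolding y' by (rule restr_glue(1)[OF cj c(2) disj])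
        hence "a(j := a j + d) \<in> R1" using y X_iff by auto
        moreover have "a(j := a j + d) \<in> neighbours J a" unfolding nb using True jd by blast
        ultimately show ?thesis using y' by blast
      next
        case False
        hence jK: "j \<in> K" using jd(1) S_def by auto
        have y': "y = glue a (b(j := b j + d))" using jd mk by simp
        have cj: "b(j := b j + d) \<in> confs K" using c(2) jK unfolding confs_def by auto
        have "restr K y = b(j := b j + d)" unfolding y' by (rule restr_glue(2)[OF c(1) cj disj])
        hence "b(j := b j + d) \<in> R2" using y X_iff by auto
        moreover have "b(j := b j + d) \<in> neighbours K b" unfolding nb using jK jd by blast
        ultimately show ?thesis using y' by blast
      qed
    next
      fix y assume "y \<in> ?A \<union> ?B"
      thus "y \<in> neighbours S (glue a b) \<inter> X"
      proof
        assume "y \<in> ?A"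
        then obtain a' where a': "a' \<in> neighbours J a" "a' \<in> R1" "y = glue a' b" by auto
        then obtain j d where jd: "j \<in> J" "d \<in> {1,-1}" "a' = a(j := a j + d)" unfolding nb by blast
        have "y = (glue a b)(j := glue a b j + d)" unfolding mj a'(3) jd(3) ..
        hence "y \<in> neighbours S (glue a b)" unfolding nb S_def using jd by blast
        thus ?thesis using a' ab unfolding X_def by auto
      next
        assume "y \<in> ?B"
        then obtain b' where b': "b' \<in> neighbours K b" "b' \<in> R2" "y = glue a b'" by auto
        then obtain j d where jd: "j \<in> K" "d \<in> {1,-1}" "b' = b(j := b j + d)" unfolding nb by blast
        have "y = (glue a b)(j := glue a b j + d)" unfolding mk b'(3) jd(3) ..
        hence "y \<in> neighbours S (glue a b)" unfolding nb S_def using jd by blast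
        thus ?thesis using b' ab unfolding X_def by auto
      qed
    qed
    have mi: "glue u w = glue u' w' \<longleftrightarrow> u = u' \<and> w = w'" if "u \<in> R1" "w \<in> R2" "u' \<in> R1" "w' \<in> R2" for u w u' w'
      using inj that by (auto simp: inj_on_def)
    have "?A \<inter> ?B = {}" using mi ab neighbours_irrefl by fastforce
    moreover have "inj_on (\<lambda>a'. glue a' b) (neighbours J a \<inter> R1)" "inj_on (\<lambda>b'. glue a b') (neighbours K b \<inter> R2)"
      using mi ab by (auto simp: inj_on_def)
    ultimately show ?thesis unfolding eq using fR
      by (subst sum.union_disjoint) (auto simp: sum.reindex)
  qed
  have main: "\<not> sing S Om (energy lam v U S) E l z Q"
    if eps: "\<epsilon> > 0" and Q: "Q \<ge> 0" and del: "\<delta> \<ge> 0"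
      and loc1: "corr_loc J (energy lam v U J) R1 l \<delta>" and loc2: "corr_loc K (energy lam v U K) R2 l \<delta>"
      and nr: "\<And>e. e \<in> spec S (energy lam v U S) R \<Longrightarrow> \<bar>e - E\<bar> \<ge> \<epsilon>"
      and sm: "(real (card (sball S l z)))\<^sup>2 * (2 * real (card S)) * \<delta> / \<epsilon> * Q < 1"
    for lam v E \<epsilon> \<delta> Q
  proof
    let ?W = "energy lam v U S" and ?W1 = "energy lam v U J" and ?W2 = "energy lam v U K"
    assume "sing S Om ?W E l z Q"
    then obtain f where f: "f z = 1" "sol S Om ?W E R f"
      "\<And>y. y \<in> Om \<Longrightarrow> sdist S y z = l + 1 \<Longrightarrow> \<bar>f y\<bar> \<le> Q" unfolding sing_def R_def by blast
    obtain \<phi> e1 where o1: "orthofam R1 R1 \<phi>" and s1: "\<And>i. i \<in> R1 \<Longrightarrow> sol J R1 ?W1 (e1 i) R1 (\<phi> i)"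
      using sol_eigenbasis[OF fR(2)] by metis
    obtain \<psi> e2 where o2: "orthofam R2 R2 \<psi>" and s2: "\<And>i. i \<in> R2 \<Longrightarrow> sol K R2 ?W2 (e2 i) R2 (\<psi> i)"
      using sol_eigenbasis[OF fR(3)] by metis
    \<comment> \<open>Products of the eigenfunctions of the two groups form an eigenbasis on
      \<open>X\<close>, with sums of eigenvalues.\<close>
    define \<xi> where "\<xi> = (\<lambda>(a, b) y. \<phi> a (restr J y) * \<psi> b (restr K y))"
    define ee where "ee = (\<lambda>(a, b). e1 a + e2 b)"
    have chi: "\<xi> (a, b) (glue c d) = \<phi> a c * \<psi> b d" if "c \<in> R1" "d \<in> R2" for a b c d
    proof -
      have "restr J (glue c d) = c" "restr K (glue c d) = d" using restr_glue[of c J d K] that Rc disj by blast+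
      thus ?thesis unfolding \<xi>_def by simp
    qed
    have o: "orthofam X (R1 \<times> R2) \<xi>" unfolding orthofam_def
    proof (intro ballI)
      fix i k assume i: "i \<in> R1 \<times> R2" and k: "k \<in> R1 \<times> R2"
      obtain a b where ab: "i = (a, b)" by (cases i)
      obtain c d where cd: "k = (c, d)" by (cases k)
      have "(\<Sum>y\<in>X. \<xi> i y * \<xi> k y) = (\<Sum>(p, q)\<in>R1 \<times> R2. (\<phi> a p * \<phi> c p) * (\<psi> b q * \<psi> d q))"
        unfolding sumX ab cd by (intro sum.cong) (auto simp: chi)
      also have "\<dots> = (\<Sum>p\<in>R1. \<phi> a p * \<phi> c p) * (\<Sum>q\<in>R2. \<psi> b q * \<psi> d q)"
        by (simp add: sum_product sum.cartesian_product)
      also have "\<dots> = (if i = k then 1 else 0)"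
        using o1 o2 i k unfolding orthofam_def ab cd by auto
      finally show "(\<Sum>y\<in>X. \<xi> i y * \<xi> k y) = (if i = k then 1 else 0)" .
    qed
    have Wm: "?W (glue a b) = ?W1 a + ?W2 b" if "a \<in> R1" "b \<in> R2" for a b
      unfolding S_def
    proof (rule energy_glue[OF fin disj])
      fix i j assume ij: "i \<in> J" "j \<in> K"
      have "\<bar>a i - b j\<bar> \<ge> 2 * int l" "\<bar>b j - a i\<bar> \<ge> 2 * int l"
        using low1[OF that(1) ij(1)] high2[OF that(2) ij(2)] unfolding t0_def by auto
      thus "U (a i - b j) = 0 \<and> U (b j - a i) = 0" using U by auto
    qed (use that Rc in auto)
    have ev: "?W y * \<xi> i y - (\<Sum>y'\<in>neighbours S y \<inter> X. \<xi> i y') = ee i * \<xi> i y"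
      if i: "i \<in> R1 \<times> R2" and y: "y \<in> X" for i y
    proof -
      obtain a b where ab: "i = (a, b)" by (cases i)
      obtain c d where cd: "c \<in> R1" "d \<in> R2" "y = glue c d" using y unfolding X_def by auto
      have 1: "?W1 c * \<phi> a c - (\<Sum>c'\<in>neighbours J c \<inter> R1. \<phi> a c') = e1 a * \<phi> a c"
        using s1[of a] i ab cd unfolding sol_def by auto
      have 2: "?W2 d * \<psi> b d - (\<Sum>d'\<in>neighbours K d \<inter> R2. \<psi> b d') = e2 b * \<psi> b d"
        using s2[of b] i ab cd unfolding sol_def by auto
      have "(\<Sum>y'\<in>neighbours S y \<inter> X. \<xi> i y') = (\<Sum>c'\<in>neighbours J c \<inter> R1. \<phi> a c' * \<psi> b d) + (\<Sum>d'\<in>neighbours K d \<inter> R2. \<phi> a c * \<psi> b d')"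
        unfolding cd(3) nbsum[OF cd(1,2)] ab using cd
        by (intro arg_cong2[of _ _ _ _ "(+)"] sum.cong) (auto simp: chi)
      also have "\<dots> = (\<Sum>c'\<in>neighbours J c \<inter> R1. \<phi> a c') * \<psi> b d + \<phi> a c * (\<Sum>d'\<in>neighbours K d \<inter> R2. \<psi> b d')"
        by (simp add: sum_distrib_left sum_distrib_right)
      finally have 3: "(\<Sum>y'\<in>neighbours S y \<inter> X. \<xi> i y') = (?W1 c * \<phi> a c - e1 a * \<phi> a c) * \<psi> b d + \<phi> a c * (?W2 d * \<psi> b d - e2 b * \<psi> b d)"
        using 1 2 by (simp add: algebra_simps)
      show ?thesis unfolding 3 unfolding cd(3) Wm[OF cd(1,2)] ab chi[OF cd(1,2)] ee_def by (simp add: algebra_simps)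
    qed
    \<comment> \<open>As \<open>X\<close> is closed under hops, a product eigenfunction extended by
      zero is an eigenfunction on the ball; non-resonance of the ball thus applies to every sum of
      eigenvalues.\<close>
    have ee: "\<bar>ee i - E\<bar> \<ge> \<epsilon>" if i: "i \<in> R1 \<times> R2" for i
    proof (rule nr)
      obtain y0 where y0: "y0 \<in> X" "\<xi> i y0 \<noteq> 0" using orthofam_nonzero[OF o i] by blast
      define F where "F = (\<lambda>y. if y \<in> X then \<xi> i y else 0)"
      have "sol S R ?W (ee i) R F" unfolding sol_def
      proof
        fix y assume y: "y \<in> R"
        have sm: "(\<Sum>y'\<in>neighbours S y \<inter> R. F y') = (\<Sum>y'\<in>neighbours S y \<inter> X. \<xi> i y')"
          using XR finite_neighbours[OF S, of y] by (intro sum.mono_neutral_cong_right) (auto simp: F_def)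
        show "?W y * F y - (\<Sum>y'\<in>neighbours S y \<inter> R. F y') = ee i * F y"
        proof (cases "y \<in> X")
          case True thus ?thesis unfolding sm using ev[OF i True] by (simp add: F_def)
        next
          case False
          have "neighbours S y \<inter> X = {}" using closedX[of _ y] False y neighbours_sym by blast
          thus ?thesis unfolding sm using False by (simp add: F_def)
        qed
      qed
      thus "ee i \<in> spec S ?W R" using y0 XR by (intro spec_eigen[of S R ?W _ F y0]) (auto simp: F_def)
    qed
    \<comment> \<open>The source collects the hops out of the ball. It lives at distance
      \<open>l\<close> from the centre, exactly where the correlations are at most
      \<open>\<delta>\<close>.\<close>
    define g where "g = (\<lambda>y. \<Sum>y'\<in>neighbours S y \<inter> (Om - R). f y')"
    have feq: "(\<Sum>y'\<in>X. ham_kernel S ?W y y' * f y') - E * f y = g y" if y: "y \<in> X" for y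
    proof -
      have "neighbours S y \<inter> Om = (neighbours S y \<inter> X) \<union> (neighbours S y \<inter> (Om - R))"
        using closedX[OF y] XR unfolding R_def by blast
      moreover have "(neighbours S y \<inter> X) \<inter> (neighbours S y \<inter> (Om - R)) = {}" using XR by auto
      ultimately have "(\<Sum>y'\<in>neighbours S y \<inter> Om. f y') = (\<Sum>y'\<in>neighbours S y \<inter> X. f y') + g y"
        unfolding g_def using finite_neighbours[OF S, of y] by (simp add: sum.union_disjoint)
      thus ?thesis using ham_kernel_sum[OF fX(1) y, of S ?W f] f(2) y XR unfolding sol_def by force
    qed
    have out: "sdist S y' z = l + 1 \<and> l \<le> sdist S y z" if y: "y \<in> X" "y' \<in> neighbours S y \<inter> (Om - R)" for y y'
    proof -
      have "\<not> sdist S y' z \<le> l" using y(2) Omc unfolding R_def by (auto simp: sball_iff[OF S])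
      moreover have "sdist S y z \<le> l" using y(1) XR unfolding R_def by (auto simp: sball_iff[OF S])
      ultimately show ?thesis using neighbours_sdist[OF S, of y' y z] y(2) by auto
    qed
    have gb: "\<bar>g y\<bar> \<le> 2 * real (card S) * Q" if y: "y \<in> X" for y
      unfolding g_def using out[OF y] f(3) by (intro abs_sum_neighbours_le[OF S _ _ Q]) auto
    have gz: "l \<le> sdist S y z" if "y \<in> X" "g y \<noteq> 0" for y
      using out[OF that(1)] that(2) unfolding g_def by (metis (no_types, lifting) sum.neutral)
    have n1: "(\<Sum>y\<in>R1. \<phi> a y * \<phi> a y) = 1" if "a \<in> R1" for a using o1 that unfolding orthofam_def by auto
    have n2: "(\<Sum>y\<in>R2. \<psi> a y * \<psi> a y) = 1" if "a \<in> R2" for a using o2 that unfolding orthofam_def by auto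
    have corr: "\<bar>\<xi> i z * \<xi> i y\<bar> \<le> \<delta>" if i: "i \<in> R1 \<times> R2" and y: "y \<in> X" "l \<le> sdist S y z" for i y
    proof -
      obtain a b where ab: "i = (a, b)" "a \<in> R1" "b \<in> R2" using i by auto
      let ?p = "\<phi> a (restr J y) * \<phi> a (restr J z)" and ?q = "\<psi> b (restr K y) * \<psi> b (restr K z)"
      have mem: "restr J y \<in> R1" "restr J z \<in> R1" "restr K y \<in> R2" "restr K z \<in> R2" using y zX X_iff by auto
      have eq: "\<bar>\<xi> i z * \<xi> i y\<bar> = \<bar>?p\<bar> * \<bar>?q\<bar>" unfolding \<xi>_def ab(1) by (simp add: abs_mult)
      have p1: "\<bar>?p\<bar> \<le> 1" unfolding abs_mult
        using orthofam_abs_le_1[OF fR(2) o1 ab(2)] mem by (intro mult_le_one) auto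
      have q1: "\<bar>?q\<bar> \<le> 1" unfolding abs_mult
        using orthofam_abs_le_1[OF fR(3) o2 ab(3)] mem by (intro mult_le_one) auto
      have "l \<le> sdist J y z \<or> l \<le> sdist K y z"
        using sdist_union_le[OF fin disj, of y z] y(2) unfolding S_def by auto
      thus ?thesis
      proof
        assume "l \<le> sdist J y z"
        hence "\<bar>?p\<bar> \<le> \<delta>"
          by (intro corr_locD[OF loc1 s1[OF ab(2)] n1[OF ab(2)] mem(1,2)]) (simp add: sdist_restr)
        thus ?thesis unfolding eq using q1 mult_mono[of "\<bar>?p\<bar>" \<delta> "\<bar>?q\<bar>" 1] by simp
      next
        assume "l \<le> sdist K y z"
        hence "\<bar>?q\<bar> \<le> \<delta>"
          by (intro corr_locD[OF loc2 s2[OF ab(3)] n2[OF ab(3)] mem(3,4)]) (simp add: sdist_restr)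
        thus ?thesis unfolding eq using p1 mult_mono[of "\<bar>?p\<bar>" 1 "\<bar>?q\<bar>" \<delta>] by simp
      qed
    qed
    have "f z = (\<Sum>i\<in>R1 \<times> R2. \<xi> i z * ((\<Sum>y\<in>X. \<xi> i y * g y) / (ee i - E)))"
    proof (rule resolvent_expansion[OF fX(1) _ _ o, of "ham_kernel S ?W"])
      show "finite (R1 \<times> R2)" using fR by auto
      show "card (R1 \<times> R2) = card X" using fX by simp
      show "(\<Sum>y\<in>X. ham_kernel S ?W x y * \<xi> i y) = ee i * \<xi> i x" if "i \<in> R1 \<times> R2" "x \<in> X" for i x
        using ham_kernel_sum[OF fX(1) that(2)] ev[OF that] by simp
      show "ee i \<noteq> E" if "i \<in> R1 \<times> R2" for i using ee[OF that] eps by auto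
    qed (use feq zX ham_kernel_sym in auto)
    also have "\<bar>\<dots>\<bar> \<le> (\<Sum>i\<in>R1 \<times> R2. \<bar>\<xi> i z * ((\<Sum>y\<in>X. \<xi> i y * g y) / (ee i - E))\<bar>)" by (rule sum_abs)
    also have "\<dots> \<le> (\<Sum>i\<in>R1 \<times> R2. real (card X) * (\<delta> * (2 * real (card S) * Q)) / \<epsilon>)"
    proof (rule sum_mono)
      fix i assume i: "i \<in> R1 \<times> R2"
      have "\<bar>\<xi> i z * (\<Sum>y\<in>X. \<xi> i y * g y)\<bar> \<le> (\<Sum>y\<in>X. \<bar>(\<xi> i z * \<xi> i y) * g y\<bar>)"
        unfolding sum_distrib_left using sum_abs[of "\<lambda>y. \<xi> i z * (\<xi> i y * g y)" X] by (simp add: mult.assoc)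
      also have "\<dots> \<le> (\<Sum>y\<in>X. \<delta> * (2 * real (card S) * Q))"
      proof (rule sum_mono)
        fix y assume y: "y \<in> X"
        show "\<bar>(\<xi> i z * \<xi> i y) * g y\<bar> \<le> \<delta> * (2 * real (card S) * Q)"
        proof (cases "g y = 0")
          case False
          thus ?thesis unfolding abs_mult[of "\<xi> i z * \<xi> i y"]
            using corr[OF i y gz[OF y False]] gb[OF y] by (intro mult_mono) auto
        next
          case True
          thus ?thesis using del Q by simp
        qed
      qed
      finally have "\<bar>\<xi> i z * (\<Sum>y\<in>X. \<xi> i y * g y)\<bar> \<le> real (card X) * (\<delta> * (2 * real (card S) * Q))" by simp
      hence "\<bar>\<xi> i z * (\<Sum>y\<in>X. \<xi> i y * g y)\<bar> / \<bar>ee i - E\<bar> \<le> real (card X) * (\<delta> * (2 * real (card S) * Q)) / \<epsilon>"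
        using ee[OF i] eps del Q by (intro frac_le) auto
      thus "\<bar>\<xi> i z * ((\<Sum>y\<in>X. \<xi> i y * g y) / (ee i - E))\<bar> \<le> real (card X) * (\<delta> * (2 * real (card S) * Q)) / \<epsilon>"
        by (simp add: abs_mult)
    qed
    also have "\<dots> = (real (card X))\<^sup>2 * (2 * real (card S) * \<delta> * Q / \<epsilon>)"
      using fX(2) by (simp add: power2_eq_square)
    also have "\<dots> \<le> (real (card (sball S l z)))\<^sup>2 * (2 * real (card S) * \<delta> * Q / \<epsilon>)"
    proof (intro mult_right_mono power_mono)
      have "card X \<le> card (sball S l z)"
        using XR unfolding R_def by (intro card_mono sball_finite_card(1)[OF S]) auto
      thus "real (card X) \<le> real (card (sball S l z))" by simp
    qed (use del Q eps in auto)
    also have "\<dots> < 1" using sm by (simp add: algebra_simps)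
    finally show False using f(1) by simp
  qed
  show ?thesis
    by (rule that[of lo1 hi1 lo2 hi2]) (use sub1 sub2 main in \<open>auto simp: R1_def R2_def S_def Om_def R_def\<close>)
qed

section \<open>Averaging over shifts of the potential\<close>

text \<open>Smoothness of the density is recorded as a Lipschitz bound inside the support. Together
  with the lower bound \<open>\<rho>min\<close> it compares translates of the density
  multiplicatively.\<close>

locale anderson =
  fixes \<rho> :: "real \<Rightarrow> real" and vmax \<rho>min \<rho>max C\<rho> :: real
  assumes rho_meas[measurable]: "\<rho> \<in> borel_measurable borel"
    and rho_prob: "prob_space (density lborel (\<lambda>x. ennreal (\<rho> x)))"
    and vmax: "vmax > 0"
    and supp: "\<And>v. v \<notin> {0..vmax} \<Longrightarrow> \<rho> v = 0"
    and rmin: "\<rho>min > 0" and rmax: "\<rho>max > 0"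
    and rbd: "\<And>v. v \<in> {0..vmax} \<Longrightarrow> \<rho>min \<le> \<rho> v \<and> \<rho> v \<le> \<rho>max"
    and lip0: "C\<rho> \<ge> 0"
    and lip: "\<And>x y. x \<in> {0<..<vmax} \<Longrightarrow> y \<in> {0<..<vmax} \<Longrightarrow> \<bar>\<rho> x - \<rho> y\<bar> \<le> C\<rho> * \<bar>x - y\<bar>"
begin

section \<open>The law of the potential\<close>

definition D :: "real measure" where "D = density lborel (\<lambda>x. ennreal (\<rho> x))"

definition \<mu> :: "(int \<Rightarrow> real) measure" where "\<mu> = PiM UNIV (\<lambda>_. D)"

lemma sets_D[measurable_cong, simp]: "sets D = sets borel" unfolding D_def by simp

lemma space_D[simp]: "space D = UNIV" unfolding D_def by simp

lemma prob_D: "prob_space D" unfolding D_def by (rule rho_prob)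

sublocale DP: product_prob_space "\<lambda>_::int. D" UNIV
  using prob_D by (intro product_prob_spaceI)

text \<open>The index set is countable, so the product sigma-algebra is the Borel one, and
  measurability of events can be derived from closedness.\<close>

lemma sets_mu[simp, measurable_cong]: "sets \<mu> = sets borel"
proof -
  have "sets \<mu> = sets (PiM UNIV (\<lambda>_::int. borel :: real measure))" unfolding \<mu>_def by (intro sets_PiM_cong) auto
  thus ?thesis using sets_PiM_equal_borel by simp
qed

lemma space_mu[simp]: "space \<mu> = UNIV" unfolding \<mu>_def by (simp add: space_PiM)

lemma prob_mu: "prob_space \<mu>" unfolding \<mu>_def by (intro prob_space_PiM prob_D)

sublocale mu: prob_space \<mu> by (rule prob_mu)

lemma rho_nonneg: "0 \<le> \<rho> x" using supp[of x] rbd[of x] rmin by (cases "x \<in> {0..vmax}") auto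

lemma rho_le: "\<rho> x \<le> \<rho>max" using supp[of x] rbd[of x] rmax by (cases "x \<in> {0..vmax}") auto

text \<open>A translate exceeds \<open>\<rho>\<close> by at most \<open>C\<rho> * \<delta>\<close>,
  which is at most \<open>C\<rho> * \<delta> / \<rho>min\<close> times \<open>\<rho>\<close>. The
  indicator discards the points coming from the left of the support, where \<open>\<rho>\<close>
  vanishes and no such comparison is possible.\<close>

lemma D_shift:
  assumes g[measurable]: "g \<in> borel_measurable borel" and a: "0 \<le> a" "a \<le> \<delta>"
  shows "(\<integral>\<^sup>+x. g x * indicator {a..} x \<partial>D) \<le> ennreal (1 + C\<rho> * \<delta> / \<rho>min) * (\<integral>\<^sup>+x. g (x + a) \<partial>D)"
proof -
  let ?c = "1 + C\<rho> * \<delta> / \<rho>min"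
  have c: "?c \<ge> 1" using lip0 a rmin by simp
  have "(\<integral>\<^sup>+x. g x * indicator {a..} x \<partial>D) = (\<integral>\<^sup>+x. ennreal (\<rho> x) * (g x * indicator {a..} x) \<partial>lborel)"
    unfolding D_def by (subst nn_integral_density) auto
  also have "\<dots> = (\<integral>\<^sup>+x. ennreal (\<rho> (a + x)) * (g (a + x) * indicator {a..} (a + x)) \<partial>lborel)"
    using nn_integral_real_affine[of "\<lambda>x. ennreal (\<rho> x) * (g x * indicator {a..} x)" 1 a] by simp
  also have "\<dots> \<le> (\<integral>\<^sup>+x. ennreal ?c * (ennreal (\<rho> x) * g (x + a)) \<partial>lborel)"
  proof (rule nn_integral_mono_AE)
    \<comment> \<open>Leaving out three points puts both \<open>x\<close> and \<open>a + x\<close>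
      into the open interval of the Lipschitz bound in the remaining case.\<close>
    have "AE x in lborel. x \<noteq> 0 \<and> x \<noteq> vmax \<and> x \<noteq> vmax - a"
      by (intro AE_conjI AE_lborel_singleton)
    thus "AE x in lborel. ennreal (\<rho> (a + x)) * (g (a + x) * indicator {a..} (a + x)) \<le> ennreal ?c * (ennreal (\<rho> x) * g (x + a))"
    proof (eventually_elim)
      fix x :: real assume x: "x \<noteq> 0 \<and> x \<noteq> vmax \<and> x \<noteq> vmax - a"
      show "ennreal (\<rho> (a + x)) * (g (a + x) * indicator {a..} (a + x)) \<le> ennreal ?c * (ennreal (\<rho> x) * g (x + a))"
      proof (cases "x < 0")
        case True thus ?thesis by simp
      next
        case False
        have "\<rho> (a + x) \<le> ?c * \<rho> x"
        proof (cases "a + x > vmax")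
          case True
          hence "\<rho> (a + x) = 0" using supp by auto
          moreover have "0 \<le> ?c * \<rho> x" using c rho_nonneg[of x] by (intro mult_nonneg_nonneg) auto
          ultimately show ?thesis by simp
        next
          case f2: False
          have in1: "x \<in> {0<..<vmax}" "a + x \<in> {0<..<vmax}" using False f2 x a by auto
          have "\<rho> (a + x) \<le> \<rho> x + C\<rho> * a" using lip[OF in1(2,1)] a by simp
          also have "C\<rho> * a \<le> C\<rho> * \<delta>" using a lip0 by (intro mult_left_mono)
          also have "C\<rho> * \<delta> = C\<rho> * \<delta> / \<rho>min * \<rho>min" using rmin by simp
          also have "\<dots> \<le> C\<rho> * \<delta> / \<rho>min * \<rho> x"
            using rbd[of x] in1 lip0 a rmin by (intro mult_left_mono) auto
          finally show ?thesis by (simp add: algebra_simps)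
        qed
        hence "ennreal (\<rho> (a + x)) \<le> ennreal (?c * \<rho> x)" by (rule ennreal_leI)
        also have "\<dots> = ennreal ?c * ennreal (\<rho> x)"
          using c rho_nonneg[of x] by (intro ennreal_mult) linarith+
        finally have "ennreal (\<rho> (a + x)) \<le> ennreal ?c * ennreal (\<rho> x)" .
        hence "ennreal (\<rho> (a + x)) * (g (a + x) * 1) \<le> (ennreal ?c * ennreal (\<rho> x)) * (g (a + x) * 1)"
          by (rule mult_right_mono) simp
        thus ?thesis using False by (simp add: mult.assoc add.commute)
      qed
    qed
  qed
  also have "\<dots> = ennreal ?c * (\<integral>\<^sup>+x. ennreal (\<rho> x) * g (x + a) \<partial>lborel)"
    by (rule nn_integral_cmult) measurable
  also have "(\<integral>\<^sup>+x. ennreal (\<rho> x) * g (x + a) \<partial>lborel) = (\<integral>\<^sup>+x. g (x + a) \<partial>D)"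
    unfolding D_def by (subst nn_integral_density) auto
  finally show ?thesis .
qed

text \<open>Coordinates are shifted one at a time, each for one factor of \<open>D_shift\<close>.
  The shifts may differ from site to site, so that sites outside a half-line can be given the shift
  zero.\<close>

lemma PiM_shift:
  assumes I: "finite I" and a: "\<And>u. 0 \<le> a u" "\<And>u. a u \<le> \<delta>"
    and f: "f \<in> borel_measurable (PiM I (\<lambda>_::int. D))"
  shows "(\<integral>\<^sup>+w. f w * (\<Prod>u\<in>I. indicator {a u..} (w u)) \<partial>PiM I (\<lambda>_. D))
    \<le> ennreal ((1 + C\<rho> * \<delta> / \<rho>min) ^ card I) * (\<integral>\<^sup>+w. f (\<lambda>u\<in>I. w u + a u) \<partial>PiM I (\<lambda>_. D))"
  using I f
proof (induction I arbitrary: f rule: finite_induct)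
  case empty
  show ?case by (simp add: PiM_empty nn_integral_count_space_finite)
next
  case (insert i I)
  let ?c = "1 + C\<rho> * \<delta> / \<rho>min"
  have c: "?c \<ge> 1" using lip0 a[of 0] rmin by simp
  note [measurable] = insert.prems
  have ext: "(\<lambda>u\<in>insert i I. (w(i := x)) u + a u) = (\<lambda>u\<in>I. w u + a u)(i := x + a i)" for w x
    using insert.hyps by (auto simp: fun_eq_iff)
  have mf: "(\<lambda>w. \<integral>\<^sup>+x. f (w(i := x + a i)) \<partial>D) \<in> borel_measurable (PiM I (\<lambda>_. D))"
    by measurable
  have "(\<integral>\<^sup>+w. f w * (\<Prod>u\<in>insert i I. indicator {a u..} (w u)) \<partial>PiM (insert i I) (\<lambda>_. D))
     = (\<integral>\<^sup>+w. (\<integral>\<^sup>+x. f (w(i := x)) * (\<Prod>u\<in>insert i I. indicator {a u..} ((w(i := x)) u)) \<partial>D) \<partial>PiM I (\<lambda>_. D))"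
    using insert.hyps by (intro DP.product_nn_integral_insert) (auto)
  also have "\<dots> = (\<integral>\<^sup>+w. (\<integral>\<^sup>+x. f (w(i := x)) * indicator {a i..} x \<partial>D) * (\<Prod>u\<in>I. indicator {a u..} (w u)) \<partial>PiM I (\<lambda>_. D))"
  proof (rule nn_integral_cong)
    fix w assume w: "w \<in> space (PiM I (\<lambda>_. D))"
    have "(\<Prod>u\<in>insert i I. indicator {a u..} ((w(i := x)) u)) = indicator {a i..} x * (\<Prod>u\<in>I. indicator {a u..} (w u) :: ennreal)" for x
      using insert.hyps by (simp, intro arg_cong2[of _ _ _ _ "(*)"] prod.cong) auto
    moreover have "(\<lambda>x. f (w(i := x))) \<in> borel_measurable D"
      by (rule measurable_compose[OF _ insert.prems], rule measurable_fun_upd[where J = I]) (use w in auto)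
    ultimately show "(\<integral>\<^sup>+x. f (w(i := x)) * (\<Prod>u\<in>insert i I. indicator {a u..} ((w(i := x)) u)) \<partial>D)
       = (\<integral>\<^sup>+x. f (w(i := x)) * indicator {a i..} x \<partial>D) * (\<Prod>u\<in>I. indicator {a u..} (w u))"
      by (simp add: mult.assoc[symmetric] nn_integral_multc)
  qed
  also have "\<dots> \<le> (\<integral>\<^sup>+w. (ennreal ?c * (\<integral>\<^sup>+x. f (w(i := x + a i)) \<partial>D)) * (\<Prod>u\<in>I. indicator {a u..} (w u)) \<partial>PiM I (\<lambda>_. D))"
  proof (rule nn_integral_mono, rule mult_right_mono)
    fix w assume w: "w \<in> space (PiM I (\<lambda>_. D))"
    have "(\<lambda>x. f (w(i := x))) \<in> borel_measurable D"
      by (rule measurable_compose[OF _ insert.prems], rule measurable_fun_upd[where J = I]) (use w in auto)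
    thus "(\<integral>\<^sup>+x. f (w(i := x)) * indicator {a i..} x \<partial>D) \<le> ennreal ?c * (\<integral>\<^sup>+x. f (w(i := x + a i)) \<partial>D)"
      using a by (intro D_shift) auto
  qed simp
  also have "\<dots> = ennreal ?c * (\<integral>\<^sup>+w. (\<integral>\<^sup>+x. f (w(i := x + a i)) \<partial>D) * (\<Prod>u\<in>I. indicator {a u..} (w u)) \<partial>PiM I (\<lambda>_. D))"
  proof -
    have "(\<lambda>w. (\<integral>\<^sup>+x. f (w(i := x + a i)) \<partial>D) * (\<Prod>u\<in>I. indicator {a u..} (w u))) \<in> borel_measurable (PiM I (\<lambda>_. D))"
      using insert.hyps by measurable
    thus ?thesis by (subst nn_integral_cmult[symmetric]) (auto simp: mult.assoc)
  qed
  also have "\<dots> \<le> ennreal ?c * (ennreal (?c ^ card I) * (\<integral>\<^sup>+w. (\<integral>\<^sup>+x. f ((\<lambda>u\<in>I. w u + a u)(i := x + a i)) \<partial>D) \<partial>PiM I (\<lambda>_. D)))"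
    by (intro mult_left_mono insert.IH mf) simp
  also have "(\<integral>\<^sup>+w. (\<integral>\<^sup>+x. f ((\<lambda>u\<in>I. w u + a u)(i := x + a i)) \<partial>D) \<partial>PiM I (\<lambda>_. D))
    = (\<integral>\<^sup>+w. f (\<lambda>u\<in>insert i I. w u + a u) \<partial>PiM (insert i I) (\<lambda>_. D))"
    unfolding ext[symmetric] using insert.hyps by (intro DP.product_nn_integral_insert[symmetric]) (auto)
  also have "ennreal ?c * (ennreal (?c ^ card I) * (\<integral>\<^sup>+w. f (\<lambda>u\<in>insert i I. w u + a u) \<partial>PiM (insert i I) (\<lambda>_. D)))
    = ennreal (?c ^ card (insert i I)) * (\<integral>\<^sup>+w. f (\<lambda>u\<in>insert i I. w u + a u) \<partial>PiM (insert i I) (\<lambda>_. D))"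
    using insert.hyps c by (simp add: ennreal_mult mult.assoc)
  finally show ?case .
qed

lemma D_small_interval: assumes "\<delta> \<ge> 0" shows "measure D {..<\<delta>} \<le> \<rho>max * \<delta>"
proof -
  have "emeasure D {..<\<delta>} = (\<integral>\<^sup>+x. ennreal (\<rho> x) * indicator {..<\<delta>} x \<partial>lborel)"
    unfolding D_def by (subst emeasure_density) auto
  also have "\<dots> \<le> (\<integral>\<^sup>+x. ennreal \<rho>max * indicator {0..\<delta>} x \<partial>lborel)"
  proof (rule nn_integral_mono)
    fix x
    show "ennreal (\<rho> x) * indicator {..<\<delta>} x \<le> ennreal \<rho>max * indicator {0..\<delta>} x"
      using supp[of x] rho_le[of x] by (auto simp: indicator_def ennreal_leI)
  qed
  also have "\<dots> = ennreal (\<rho>max * \<delta>)"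
    using assms rmax by (simp add: nn_integral_cmult ennreal_mult)
  finally show ?thesis
    using assms rmax DP.M.emeasure_eq_measure by simp
qed

definition depends :: "int set \<Rightarrow> ((int \<Rightarrow> real) \<Rightarrow> bool) \<Rightarrow> bool" where
  "depends I P \<longleftrightarrow> (\<forall>v w. (\<forall>u\<in>I. v u = w u) \<longrightarrow> P v = P w)"

text \<open>Filling up with zeros extends values on \<open>I\<close> to a full potential without
  affecting the event.\<close>

lemma pred_PiM:
  assumes P: "{v. P v} \<in> sets borel" and dep: "depends I P"
  shows "Measurable.pred (PiM I (\<lambda>_::int. D)) P"
proof -
  have m: "(\<lambda>w u. if u \<in> I then w u else 0) \<in> measurable (PiM I (\<lambda>_::int. D)) \<mu>"
    unfolding \<mu>_def
  proof (rule measurable_PiM_single')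
    fix u :: int
    show "(\<lambda>w. if u \<in> I then w u else 0) \<in> measurable (PiM I (\<lambda>_. D)) D"
      by (cases "u \<in> I") auto
  qed (auto simp: space_PiM)
  have "Measurable.pred \<mu> P" using P by (simp add: pred_def)
  hence "Measurable.pred (PiM I (\<lambda>_::int. D)) (\<lambda>w. P (\<lambda>u. if u \<in> I then w u else 0))"
    by (rule measurable_compose[OF m])
  moreover have "P (\<lambda>u. if u \<in> I then w u else 0) = P w" for w
    using dep[unfolded depends_def, rule_format, of "\<lambda>u. if u \<in> I then w u else 0" w] by auto
  ultimately show ?thesis by simp
qed

lemma mu_eq_PiM:
  assumes P: "{v. P v} \<in> sets borel" and dep: "depends I P" and I: "finite I"
  shows "emeasure \<mu> {v. P v} = emeasure (PiM I (\<lambda>_. D)) {w \<in> space (PiM I (\<lambda>_. D)). P w}"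
proof -
  have "emeasure (PiM I (\<lambda>_. D)) {w \<in> space (PiM I (\<lambda>_. D)). P w}
     = emeasure (distr \<mu> (PiM I (\<lambda>_. D)) (\<lambda>x. restrict x I)) {w \<in> space (PiM I (\<lambda>_. D)). P w}"
    unfolding \<mu>_def using DP.distr_PiM_restrict_finite[OF I] by simp
  also have "\<dots> = emeasure \<mu> ((\<lambda>x. restrict x I) -` {w \<in> space (PiM I (\<lambda>_. D)). P w} \<inter> space \<mu>)"
    using pred_PiM[OF P dep] unfolding \<mu>_def by (intro emeasure_distr measurable_restrict_subset) (auto simp: pred_def)
  also have "(\<lambda>x. restrict x I) -` {w \<in> space (PiM I (\<lambda>_. D)). P w} \<inter> space \<mu> = {v. P v}"
  proof -
    have "P (restrict v I) = P v" for v using dep unfolding depends_def by (metis restrict_apply')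
    thus ?thesis by (auto simp: space_PiM)
  qed
  finally show ?thesis by simp
qed

text \<open>Moving the potential on \<open>Q\<close> by a common amount \<open>s\<close> changes the product density only by a
  bounded factor as long as \<open>s\<close> times the number of sites is small. Averaging over \<open>s\<close> bounds the
  probability of any event that is rare along every such line.\<close>

lemma shift_average:
  assumes P: "{v. P v} \<in> sets borel" and dep: "depends I P" and I: "finite I" and del: "\<delta> > 0"
    and kap: "\<kappa> \<ge> 0" "\<And>v. emeasure lborel {s \<in> {0..\<delta>}. P (\<lambda>u. if u \<in> Q then v u + s else v u)} \<le> ennreal \<kappa>"
  shows "measure \<mu> {v. P v} \<le> real (card I) * \<rho>max * \<delta> + (1 + C\<rho> * \<delta> / \<rho>min) ^ card I * \<kappa> / \<delta>"
proof -
  let ?N = "PiM I (\<lambda>_::int. D)" and ?c = "1 + C\<rho> * \<delta> / \<rho>min"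
  interpret N: prob_space ?N by (intro prob_space_PiM prob_D)
  have c: "?c \<ge> 1" using lip0 del rmin by simp
  note mP[measurable] = pred_PiM[OF P dep]
  \<comment> \<open>On \<open>G\<close> all values are at least \<open>\<delta>\<close>, so every
    indicator in \<open>PiM_shift\<close> equals one. Its complement costs
    \<open>\<rho>max * \<delta>\<close> per site.\<close>
  define G where "G = {w \<in> space ?N. P w \<and> (\<forall>u\<in>I. \<delta> \<le> w u)}"
  have G[measurable]: "G \<in> sets ?N" unfolding G_def using I by measurable
  define sh where "sh = (\<lambda>s w. \<lambda>u\<in>I. w u + (if u \<in> Q then s else (0::real)))"
  have shm: "(\<lambda>(s, w). sh s w) \<in> measurable (lborel \<Otimes>\<^sub>M ?N) ?N"
    unfolding sh_def case_prod_unfold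
    by (rule measurable_restrict) measurable
  have one: "emeasure ?N G \<le> ennreal (?c ^ card I) * (\<integral>\<^sup>+w. indicator {w \<in> space ?N. P w} (sh s w) \<partial>?N)"
    if s: "s \<in> {0..\<delta>}" for s
  proof -
    define a where "a = (\<lambda>u::int. if u \<in> Q then s else 0)"
    have "emeasure ?N G = (\<integral>\<^sup>+w. indicator G w \<partial>?N)" by simp
    also have "\<dots> \<le> (\<integral>\<^sup>+w. indicator {w \<in> space ?N. P w} w * (\<Prod>u\<in>I. indicator {a u..} (w u)) \<partial>?N)"
    proof (rule nn_integral_mono)
      fix w
      show "indicator G w \<le> indicator {w \<in> space ?N. P w} w * (\<Prod>u\<in>I. indicator {a u..} (w u) :: ennreal)"
      proof (cases "w \<in> G")
        case True
        hence "(\<Prod>u\<in>I. indicator {a u..} (w u) :: ennreal) = 1"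
          using s unfolding G_def a_def by (intro prod.neutral) (auto simp: indicator_def)
        thus ?thesis using True unfolding G_def by auto
      qed simp
    qed
    also have "\<dots> \<le> ennreal (?c ^ card I) * (\<integral>\<^sup>+w. indicator {w \<in> space ?N. P w} (\<lambda>u\<in>I. w u + a u) \<partial>?N)"
      using s I by (intro PiM_shift) (auto simp: a_def)
    finally show ?thesis unfolding sh_def a_def .
  qed
  \<comment> \<open>The bound for each \<open>s\<close> is integrated over the interval of shifts.
    Exchanging the integrals leaves, for each fixed potential, the length of the set of bad shifts,
    which is at most \<open>\<kappa>\<close>.\<close>
  have "ennreal \<delta> * emeasure ?N G = (\<integral>\<^sup>+s. emeasure ?N G * indicator {0..\<delta>} s \<partial>lborel)"
    using del by (subst nn_integral_cmult_indicator) (auto simp: mult.commute)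
  also have "\<dots> \<le> (\<integral>\<^sup>+s. ennreal (?c ^ card I) * ((\<integral>\<^sup>+w. indicator {w \<in> space ?N. P w} (sh s w) * indicator {0..\<delta>} s \<partial>?N)) \<partial>lborel)"
  proof (rule nn_integral_mono)
    fix s
    show "emeasure ?N G * indicator {0..\<delta>} s \<le> ennreal (?c ^ card I) * ((\<integral>\<^sup>+w. indicator {w \<in> space ?N. P w} (sh s w) * indicator {0..\<delta>} s \<partial>?N))"
      using one[of s] by (cases "s \<in> {0..\<delta>}") auto
  qed
  also have "\<dots> = ennreal (?c ^ card I) * (\<integral>\<^sup>+s. (\<integral>\<^sup>+w. indicator {w \<in> space ?N. P w} (sh s w) * indicator {0..\<delta>} s \<partial>?N) \<partial>lborel)"
  proof (rule nn_integral_cmult)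
    show "(\<lambda>s. \<integral>\<^sup>+w. indicator {w \<in> space ?N. P w} (sh s w) * indicator {0..\<delta>} s \<partial>?N) \<in> borel_measurable lborel"
      using shm by measurable
  qed
  also have "(\<integral>\<^sup>+s. (\<integral>\<^sup>+w. indicator {w \<in> space ?N. P w} (sh s w) * indicator {0..\<delta>} s \<partial>?N) \<partial>lborel)
     = (\<integral>\<^sup>+w. (\<integral>\<^sup>+s. indicator {w \<in> space ?N. P w} (sh s w) * indicator {0..\<delta>} s \<partial>lborel) \<partial>?N)"
  proof -
    interpret pair_sigma_finite ?N lborel
      by (intro pair_sigma_finite.intro N.sigma_finite_measure_axioms sigma_finite_lborel)
    have "(\<lambda>(w, s). sh s w) \<in> measurable (?N \<Otimes>\<^sub>M lborel) ?N"
      unfolding sh_def case_prod_unfold by (rule measurable_restrict) measurable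
    hence "(\<lambda>x. indicator {w \<in> space ?N. P w} (case x of (w, s) \<Rightarrow> sh s w) :: ennreal) \<in> borel_measurable (?N \<Otimes>\<^sub>M lborel)"
      by (rule measurable_compose) measurable
    hence "(\<lambda>(w, s). indicator {w \<in> space ?N. P w} (sh s w) * indicator {0..\<delta>} s :: ennreal) \<in> borel_measurable (?N \<Otimes>\<^sub>M lborel)"
      unfolding case_prod_unfold by measurable
    thus ?thesis by (rule Fubini')
  qed
  also have "\<dots> \<le> (\<integral>\<^sup>+w. ennreal \<kappa> \<partial>?N)"
  proof (rule nn_integral_mono)
    fix w assume w: "w \<in> space ?N"
    have "indicator {w \<in> space ?N. P w} (sh s w) * indicator {0..\<delta>} s
        = (indicator {s \<in> {0..\<delta>}. P (\<lambda>u. if u \<in> Q then w u + s else w u)} s :: ennreal)" for s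
    proof -
      have "P (sh s w) = P (\<lambda>u. if u \<in> Q then w u + s else w u)"
        using dep[unfolded depends_def, rule_format, of "sh s w" "\<lambda>u. if u \<in> Q then w u + s else w u"]
        by (auto simp: sh_def)
      moreover have "sh s w \<in> space ?N" by (simp add: sh_def space_PiM)
      ultimately show ?thesis by (auto simp: indicator_def)
    qed
    moreover have "{s \<in> {0..\<delta>}. P (\<lambda>u. if u \<in> Q then w u + s else w u)} \<in> sets lborel"
    proof -
      have "(\<lambda>s. (\<lambda>u. if u \<in> Q then w u + s else w u)) \<in> measurable lborel \<mu>"
        unfolding \<mu>_def
      proof (rule measurable_PiM_single')
        fix u :: int show "(\<lambda>s. if u \<in> Q then w u + s else w u) \<in> measurable lborel D" by (cases "u \<in> Q") auto
      qed (auto simp: space_PiM)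
      moreover have "Measurable.pred \<mu> P" using P by (simp add: pred_def)
      ultimately have "Measurable.pred lborel (\<lambda>s. P (\<lambda>u. if u \<in> Q then w u + s else w u))"
        by (rule measurable_compose)
      thus ?thesis by measurable
    qed
    ultimately show "(\<integral>\<^sup>+s. indicator {w \<in> space ?N. P w} (sh s w) * indicator {0..\<delta>} s \<partial>lborel) \<le> ennreal \<kappa>"
      using kap(2)[of w] by simp
  qed
  also have "\<dots> = ennreal \<kappa>" by (simp add: N.emeasure_space_1)
  finally have "ennreal \<delta> * emeasure ?N G \<le> ennreal (?c ^ card I) * ennreal \<kappa>" by (simp add: mult_left_mono)
  hence "ennreal (\<delta> * measure ?N G) \<le> ennreal (?c ^ card I * \<kappa>)"
    using del c kap by (simp add: N.emeasure_eq_measure ennreal_mult)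
  hence "\<delta> * measure ?N G \<le> ?c ^ card I * \<kappa>"
    using c kap by (subst (asm) ennreal_le_iff) auto
  hence mG: "measure ?N G \<le> ?c ^ card I * \<kappa> / \<delta>" using del by (simp add: field_simps)
  have sub: "{w \<in> space ?N. P w} \<subseteq> G \<union> (\<Union>u\<in>I. {w \<in> space ?N. w u \<in> {..<\<delta>}})"
    unfolding G_def by (auto simp: not_le)
  have ms: "{w \<in> space ?N. w u \<in> {..<\<delta>}} \<in> sets ?N" if "u \<in> I" for u using that by measurable
  have mu: "measure ?N {w \<in> space ?N. w u \<in> {..<\<delta>}} \<le> \<rho>max * \<delta>" if u: "u \<in> I" for u
  proof -
    interpret NP: product_prob_space "\<lambda>_::int. D" I using prob_D by (intro product_prob_spaceI)
    have "emeasure ?N {w \<in> space ?N. w u \<in> {..<\<delta>}} = emeasure D {..<\<delta>}"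
      using u by (intro NP.emeasure_PiM_Collect_single) auto
    hence "measure ?N {w \<in> space ?N. w u \<in> {..<\<delta>}} = measure D {..<\<delta>}" by (simp add: measure_def)
    thus ?thesis using D_small_interval[of \<delta>] del by simp
  qed
  have "measure \<mu> {v. P v} = measure ?N {w \<in> space ?N. P w}"
    using mu_eq_PiM[OF P dep I] by (simp add: measure_def)
  also have "\<dots> \<le> measure ?N (G \<union> (\<Union>u\<in>I. {w \<in> space ?N. w u \<in> {..<\<delta>}}))"
    using sub ms I G by (intro N.finite_measure_mono) auto
  also have "\<dots> \<le> measure ?N G + measure ?N (\<Union>u\<in>I. {w \<in> space ?N. w u \<in> {..<\<delta>}})"
    using ms I G by (intro measure_Un_le) auto
  also have "measure ?N (\<Union>u\<in>I. {w \<in> space ?N. w u \<in> {..<\<delta>}}) \<le> (\<Sum>u\<in>I. measure ?N {w \<in> space ?N. w u \<in> {..<\<delta>}})"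
    using ms I by (intro N.finite_measure_subadditive_finite) auto
  also have "\<dots> \<le> (\<Sum>u\<in>I. \<rho>max * \<delta>)" using mu by (rule sum_mono)
  finally show ?thesis using mG by simp
qed

lemma indep_events:
  assumes "finite L" "L \<noteq> {}" and K: "\<And>j. j \<in> L \<Longrightarrow> finite (K j)" and disj: "disjoint_family_on K L"
    and P: "\<And>j. j \<in> L \<Longrightarrow> {v. P j v} \<in> sets borel" and dep: "\<And>j. j \<in> L \<Longrightarrow> depends (K j) (P j)"
  shows "measure \<mu> {v. \<forall>j\<in>L. P j v} = (\<Prod>j\<in>L. measure \<mu> {v. P j v})"
proof -
  have "mu.indep_vars (\<lambda>_. D) (\<lambda>u v. v u) (UNIV :: int set)"
  proof (subst mu.indep_vars_iff_distr_eq_PiM)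
    show "(\<lambda>v. v u) \<in> measurable \<mu> D" for u :: int unfolding \<mu>_def by measurable
    have "distr \<mu> (PiM UNIV (\<lambda>_. D)) (\<lambda>x. \<lambda>i\<in>UNIV. x i) = \<mu>"
    proof -
      have "(\<lambda>x::int \<Rightarrow> real. \<lambda>i\<in>UNIV. x i) = (\<lambda>x. x)" by (auto simp: restrict_def)
      thus ?thesis unfolding \<mu>_def by (simp add: distr_id)
    qed
    moreover have "distr \<mu> D (\<lambda>v. v u) = D" for u :: int
      unfolding \<mu>_def using DP.PiM_component[of u] by simp
    ultimately show "distr \<mu> (PiM UNIV (\<lambda>_. D)) (\<lambda>x. \<lambda>i\<in>UNIV. x i) = PiM UNIV (\<lambda>u. distr \<mu> D (\<lambda>v. v u))"
      unfolding \<mu>_def by simp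
  qed simp
  hence ind: "mu.indep_vars (\<lambda>j. PiM (K j) (\<lambda>_. D)) (\<lambda>j v. restrict (\<lambda>i. v i) (K j)) L"
    using disj by (intro mu.indep_vars_restrict) auto
  have r: "P j (restrict v (K j)) = P j v" if "j \<in> L" for j v
    using dep[OF that] unfolding depends_def by (metis restrict_apply')
  have sp: "restrict v (K j) \<in> space (PiM (K j) (\<lambda>_. D))" for v :: "int \<Rightarrow> real" and j by (simp add: space_PiM)
  have "mu.prob (\<Inter>j\<in>L. (\<lambda>v. restrict (\<lambda>i. v i) (K j)) -` {w \<in> space (PiM (K j) (\<lambda>_. D)). P j w} \<inter> space \<mu>)
     = (\<Prod>j\<in>L. mu.prob ((\<lambda>v. restrict (\<lambda>i. v i) (K j)) -` {w \<in> space (PiM (K j) (\<lambda>_. D)). P j w} \<inter> space \<mu>))"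
    using assms(1,2) pred_PiM[OF P dep] by (intro mu.indep_varsD[OF ind]) (auto simp: pred_def)
  moreover have "(\<lambda>v. restrict (\<lambda>i. v i) (K j)) -` {w \<in> space (PiM (K j) (\<lambda>_. D)). P j w} \<inter> space \<mu> = {v. P j v}"
    if "j \<in> L" for j using r[OF that] sp by auto
  moreover have "(\<Inter>j\<in>L. {v. P j v}) = {v. \<forall>j\<in>L. P j v}" by auto
  ultimately show ?thesis by simp
qed

end

section \<open>Two-volume resonances\<close>

text \<open>Projection along a compact factor preserves closedness, by the tube lemma. This is how
  events that assert the existence of energies and solutions are shown to be Borel.\<close>

lemma closed_Collect_Bex_compact:
  fixes P :: "'a::topological_space \<Rightarrow> 'b::topological_space \<Rightarrow> bool"
  assumes K: "compact K" and cl: "closed {p. P (fst p) (snd p)}"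
  shows "closed {v. \<exists>w\<in>K. P v w}"
proof -
  have op: "open (- {p. P (fst p) (snd p)})" using cl by (simp add: open_Compl)
  have "open (- {v. \<exists>w\<in>K. P v w})"
  proof (subst open_subopen, rule ballI)
    fix v assume v: "v \<in> - {v. \<exists>w\<in>K. P v w}"
    hence "{v} \<times> K \<subseteq> - {p. P (fst p) (snd p)}" by auto
    from Elementary_Topology.tube_lemma[OF K op this] obtain A where A: "v \<in> A" "open A" "A \<times> K \<subseteq> - {p. P (fst p) (snd p)}" by blast
    have "A \<subseteq> - {v. \<exists>w\<in>K. P v w}" using A(3) by auto
    thus "\<exists>T. open T \<and> v \<in> T \<and> T \<subseteq> - {v. \<exists>w\<in>K. P v w}" using A by blast
  qed
  thus ?thesis by (simp add: closed_def)
qed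

lemma sol_cong:
  assumes "\<And>y. y \<in> A \<Longrightarrow> W y = W' y" "\<And>y. y \<in> A \<Longrightarrow> f y = f' y"
    "\<And>y y'. y \<in> A \<Longrightarrow> y' \<in> neighbours S y \<inter> Om \<Longrightarrow> f y' = f' y'"
  shows "sol S Om W E A f = sol S Om W' E A f'"
proof -
  have "(\<Sum>y'\<in>neighbours S y \<inter> Om. f y') = (\<Sum>y'\<in>neighbours S y \<inter> Om. f' y')" if "y \<in> A" for y
    using assms(3)[OF that] by (intro sum.cong) auto
  thus ?thesis unfolding sol_def using assms by auto
qed

text \<open>A common form of the conditions behind \<open>sing\<close> and \<open>spec\<close>, so
  that one measurability proof serves both.\<close>

definition dirsol :: "nat set \<Rightarrow> config set \<Rightarrow> config set \<Rightarrow> config set \<Rightarrow> config \<Rightarrow> real \<Rightarrow>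
    (config \<Rightarrow> real) \<Rightarrow> real \<Rightarrow> (config \<Rightarrow> real) \<Rightarrow> bool" where
  "dirsol S Om A B x Q W e f \<longleftrightarrow> f x = 1 \<and> sol S Om W e A f \<and> (\<forall>y\<in>B. \<bar>f y\<bar> \<le> Q)"

text \<open>Only the values on a finite set matter; setting the others to zero makes the solution
  bounded.\<close>

lemma dirsol_bounded:
  assumes S: "finite S" and A: "finite A" "finite B" and d: "dirsol S Om A B x Q W e f"
  obtains n :: nat and f' where "dirsol S Om A B x Q W e f'" "\<And>y. \<bar>f' y\<bar> \<le> real n"
proof -
  define F where "F = insert x (A \<union> B \<union> (\<Union>y\<in>A. neighbours S y))"
  have F: "finite F" unfolding F_def using A finite_neighbours[OF S] by auto
  define f' where "f' = (\<lambda>y. if y \<in> F then f y else 0)"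
  have "sol S Om W e A f' = sol S Om W e A f" by (rule sol_cong) (auto simp: f'_def F_def)
  hence 1: "dirsol S Om A B x Q W e f'" using d unfolding dirsol_def by (auto simp: f'_def F_def)
  define n where "n = nat \<lceil>\<Sum>y\<in>F. \<bar>f y\<bar>\<rceil>"
  have "\<bar>f' y\<bar> \<le> real n" for y
  proof (cases "y \<in> F")
    case True
    have "\<bar>f y\<bar> \<le> (\<Sum>y\<in>F. \<bar>f y\<bar>)" using True F by (intro member_le_sum) auto
    also have "\<dots> \<le> real n" unfolding n_def by linarith
    finally show ?thesis using True by (simp add: f'_def)
  qed (simp add: f'_def)
  with 1 show ?thesis by (rule that)
qed

lemma dirsol_closed:
  fixes W :: "'a::topological_space \<Rightarrow> config \<Rightarrow> real"
  assumes W: "\<And>y. continuous_on UNIV (\<lambda>p. W (v p) y)" and e: "continuous_on UNIV e"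
    and f: "\<And>y. continuous_on UNIV (\<lambda>p. f p y)"
  shows "closed {p :: 'b::topological_space. dirsol S Om A B x Q (W (v p)) (e p) (f p)}"
  unfolding dirsol_def sol_def
  by (intro closed_Collect_conj closed_Collect_Ball closed_Collect_eq closed_Collect_le
        continuous_intros W e f)

text \<open>With energies and solutions bounded by \<open>n\<close> the event is the projection of a
  closed set along a compact one. By \<open>dirsol_bounded\<close> the union over \<open>n\<close>
  exhausts it.\<close>

lemma dirsol_pair_borel:
  fixes W :: "(int \<Rightarrow> real) \<Rightarrow> config \<Rightarrow> real"
  assumes S: "finite S" and A: "finite A" "finite B" "finite A'" "finite B'"
    and W: "\<And>y. continuous_on UNIV (\<lambda>v. W v y)"
  shows "{v. \<exists>e e' f f'. dirsol S Om A B x Q (W v) e f \<and> dirsol S Om' A' B' x' Q (W v) e' f' \<and> \<bar>e - e'\<bar> \<le> c} \<in> sets borel"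
proof -
  define PP where "PP = (\<lambda>v (w :: (real \<times> real) \<times> ((config \<Rightarrow> real) \<times> (config \<Rightarrow> real))).
     dirsol S Om A B x Q (W v) (fst (fst w)) (fst (snd w)) \<and>
     dirsol S Om' A' B' x' Q (W v) (snd (fst w)) (snd (snd w)) \<and> \<bar>fst (fst w) - snd (fst w)\<bar> \<le> c)"
  define K where "K = (\<lambda>n::nat. ({- real n..real n} \<times> {- real n..real n}) \<times>
     (Pi\<^sub>E (UNIV :: config set) (\<lambda>_. {- real n..real n}) \<times> Pi\<^sub>E (UNIV :: config set) (\<lambda>_. {- real n..real n})))"
  have cK: "compact (K n)" for n unfolding K_def by (intro compact_Times compact_PiE_fun compact_Icc)
  have W': "continuous_on UNIV (\<lambda>p. W (fst p) y)" for y
    using continuous_on_compose2[OF W continuous_on_fst[OF continuous_on_id]] by auto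
  have c1: "continuous_on UNIV (\<lambda>p :: (int \<Rightarrow> real) \<times> ((real \<times> real) \<times> ((config \<Rightarrow> real) \<times> (config \<Rightarrow> real))). fst (fst (snd p)))"
    "continuous_on UNIV (\<lambda>p :: (int \<Rightarrow> real) \<times> ((real \<times> real) \<times> ((config \<Rightarrow> real) \<times> (config \<Rightarrow> real))). snd (fst (snd p)))"
    by (intro continuous_intros)+
  have c2: "continuous_on UNIV (\<lambda>p :: (int \<Rightarrow> real) \<times> ((real \<times> real) \<times> ((config \<Rightarrow> real) \<times> (config \<Rightarrow> real))). fst (snd (snd p)) y)"
    for y
    by (rule continuous_on_product_then_coordinatewise[OF continuous_on_fst[OF continuous_on_snd[OF continuous_on_snd[OF continuous_on_id]]]])
  have c3: "continuous_on UNIV (\<lambda>p :: (int \<Rightarrow> real) \<times> ((real \<times> real) \<times> ((config \<Rightarrow> real) \<times> (config \<Rightarrow> real))). snd (snd (snd p)) y)"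
    for y
    by (rule continuous_on_product_then_coordinatewise[OF continuous_on_snd[OF continuous_on_snd[OF continuous_on_snd[OF continuous_on_id]]]])
  note d1 = dirsol_closed[where v = fst and W = W, OF W' c1(1) c2, of S Om A B x Q]
  note d2 = dirsol_closed[where v = fst and W = W, OF W' c1(2) c3, of S Om' A' B' x' Q]
  have d3: "closed {p :: (int \<Rightarrow> real) \<times> ((real \<times> real) \<times> ((config \<Rightarrow> real) \<times> (config \<Rightarrow> real))).
      \<bar>fst (fst (snd p)) - snd (fst (snd p))\<bar> \<le> c}"
    by (intro closed_Collect_le continuous_on_rabs continuous_on_diff continuous_on_const c1)
  have cl: "closed {p. PP (fst p) (snd p)}" unfolding PP_def
    by (rule closed_Collect_conj[OF d1 closed_Collect_conj[OF d2 d3]])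
  have cn: "closed {v. \<exists>w\<in>K n. PP v w}" for n by (rule closed_Collect_Bex_compact[OF cK cl])
  have "{v. \<exists>e e' f f'. dirsol S Om A B x Q (W v) e f \<and> dirsol S Om' A' B' x' Q (W v) e' f' \<and> \<bar>e - e'\<bar> \<le> c}
      = (\<Union>n. {v. \<exists>w\<in>K n. PP v w})" (is "?L = ?R")
  proof (intro equalityI subsetI)
    fix v assume "v \<in> ?L"
    then obtain e e' f f' where d: "dirsol S Om A B x Q (W v) e f" "dirsol S Om' A' B' x' Q (W v) e' f'" "\<bar>e - e'\<bar> \<le> c" by auto
    obtain n g where g: "dirsol S Om A B x Q (W v) e g" "\<And>y. \<bar>g y\<bar> \<le> real n" using dirsol_bounded[OF S A(1,2) d(1)] by metis
    obtain n' g' where g': "dirsol S Om' A' B' x' Q (W v) e' g'" "\<And>y. \<bar>g' y\<bar> \<le> real n'" using dirsol_bounded[OF S A(3,4) d(2)] by metis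
    define k where "k = n + n' + nat \<lceil>\<bar>e\<bar>\<rceil> + nat \<lceil>\<bar>e'\<bar>\<rceil>"
    have k: "\<bar>e\<bar> \<le> real k" "\<bar>e'\<bar> \<le> real k" "real n \<le> real k" "real n' \<le> real k" unfolding k_def by linarith+
    have kg: "\<bar>g y\<bar> \<le> real k" "\<bar>g' y\<bar> \<le> real k" for y using g(2)[of y] g'(2)[of y] k by linarith+
    have "((e, e'), (g, g')) \<in> K k"
      unfolding K_def mem_Sigma_iff PiE_UNIV_domain Pi_iff atLeastAtMost_iff using k kg by (auto simp: abs_le_iff minus_le_iff)
    moreover have "PP v ((e, e'), (g, g'))" unfolding PP_def using g(1) g'(1) d(3) by simp
    ultimately show "v \<in> ?R" by blast
  next
    fix v assume "v \<in> ?R"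
    thus "v \<in> ?L" unfolding PP_def by auto
  qed
  thus ?thesis using cn by (auto intro!: sets.countable_UN)
qed

lemma spec_iff_dirsol: "e \<in> spec S W X \<longleftrightarrow> (\<exists>x\<in>X. \<exists>f. dirsol S X X {} x 0 W e f)"
proof
  assume "e \<in> spec S W X"
  then obtain f x where f: "x \<in> X" "f x \<noteq> 0" "sol S X W e X f" unfolding spec_def by auto
  have "sol S X W e X (\<lambda>y. f y / f x)" unfolding sol_def
  proof
    fix y assume "y \<in> X"
    hence "(W y * f y - (\<Sum>y'\<in>neighbours S y \<inter> X. f y')) / f x = e * f y / f x" using f(3) unfolding sol_def by auto
    thus "W y * (f y / f x) - (\<Sum>y'\<in>neighbours S y \<inter> X. f y' / f x) = e * (f y / f x)"
      by (simp add: diff_divide_distrib sum_divide_distrib)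
  qed
  hence "dirsol S X X {} x 0 W e (\<lambda>y. f y / f x)" unfolding dirsol_def using f(2) by simp
  thus "\<exists>x\<in>X. \<exists>f. dirsol S X X {} x 0 W e f" using f(1) by blast
next
  assume "\<exists>x\<in>X. \<exists>f. dirsol S X X {} x 0 W e f"
  then obtain x f where "x \<in> X" "f x = 1" "sol S X W e X f" unfolding dirsol_def by blast
  thus "e \<in> spec S W X" by (intro spec_eigen[of S X W e f x]) auto
qed

lemma sing_iff_dirsol:
  "sing S Om W E l z Q \<longleftrightarrow> (\<exists>f. dirsol S Om (sball S l z \<inter> Om) {y \<in> Om. sdist S y z = l + 1} z Q W E f)"
  unfolding sing_def dirsol_def by auto

lemma continuous_energy: "continuous_on UNIV (\<lambda>v. energy lam v U S y)"
  unfolding energy_def by (intro continuous_intros continuous_on_product_then_coordinatewise)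

lemma finite_sphere: "finite S \<Longrightarrow> Om \<subseteq> confs S \<Longrightarrow> finite {y \<in> Om. sdist S y z = l + 1}"
  by (rule finite_subset[OF _ sball_finite_card(1)[of S "l + 1" z]]) (auto simp: sball_iff)

text \<open>A common energy is the case \<open>c = 0\<close> of two energies at distance at most
  \<open>c\<close>.\<close>

lemma sing_pair_borel:
  assumes S: "finite S" and Om: "Om \<subseteq> confs S"
  shows "{v. \<exists>E. sing S Om (energy lam v U S) E l x Q \<and> sing S Om (energy lam v U S) E l y Q} \<in> sets borel"
proof -
  have f: "finite (sball S l z \<inter> Om)" for z using sball_finite_card(1)[OF S] by blast
  have "{v. \<exists>E. sing S Om (energy lam v U S) E l x Q \<and> sing S Om (energy lam v U S) E l y Q} =
    {v. \<exists>e e' f f'. dirsol S Om (sball S l x \<inter> Om) {w \<in> Om. sdist S w x = l + 1} x Q (energy lam v U S) e f \<and>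
       dirsol S Om (sball S l y \<inter> Om) {w \<in> Om. sdist S w y = l + 1} y Q (energy lam v U S) e' f' \<and> \<bar>e - e'\<bar> \<le> 0}"
    unfolding sing_iff_dirsol by (rule Collect_cong) auto
  thus ?thesis
    using dirsol_pair_borel[where W = "\<lambda>v. energy lam v U S", OF S f[of x] finite_sphere[OF S Om, of x l]
        f[of y] finite_sphere[OF S Om, of y l] continuous_energy, of Om x Q Om y 0]
    by simp
qed

lemma spec_close_borel:
  assumes S: "finite S" and X: "finite X" "finite Y"
  shows "{v. \<exists>e\<in>spec S (energy lam v U S) X. \<exists>e'\<in>spec S (energy lam v U S) Y. \<bar>e - e'\<bar> \<le> c} \<in> sets borel"
proof -
  have "{v. \<exists>e\<in>spec S (energy lam v U S) X. \<exists>e'\<in>spec S (energy lam v U S) Y. \<bar>e - e'\<bar> \<le> c} =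
    (\<Union>x\<in>X. \<Union>y\<in>Y. {v. \<exists>e e' f f'. dirsol S X X {} x 0 (energy lam v U S) e f \<and>
        dirsol S Y Y {} y 0 (energy lam v U S) e' f' \<and> \<bar>e - e'\<bar> \<le> c})"
    unfolding Bex_def spec_iff_dirsol by blast
  also have "\<dots> \<in> sets borel"
    using X by (intro sets.finite_UN dirsol_pair_borel[OF S] continuous_energy) auto
  finally show ?thesis .
qed

section \<open>Dependence on the potential and the effect of a shift\<close>

lemma energy_cong:
  assumes "\<And>j. j \<in> S \<Longrightarrow> v (y j) = w (y j)" shows "energy lam v U S y = energy lam w U S y"
  unfolding energy_def using assms by (metis (no_types, lifting) sum.cong)

lemma energy_cong_sball:
  assumes "finite S" "\<And>u. u \<in> sites S l z \<Longrightarrow> v u = w u" "y \<in> sball S l z"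
  shows "energy lam v U S y = energy lam w U S y"
  by (rule energy_cong) (use sball_sites[OF assms(1,3)] assms(2) in auto)

lemma sing_cong:
  assumes S: "finite S" "\<And>u. u \<in> sites S l z \<Longrightarrow> v u = w u"
  shows "sing S Om (energy lam v U S) E l z Q = sing S Om (energy lam w U S) E l z Q"
proof -
  have "sol S Om (energy lam v U S) E (sball S l z \<inter> Om) f = sol S Om (energy lam w U S) E (sball S l z \<inter> Om) f" for f
    by (rule sol_cong) (use energy_cong_sball[OF S] in auto)
  thus ?thesis unfolding sing_def by simp
qed

lemma spec_cong:
  assumes "\<And>y. y \<in> X \<Longrightarrow> W y = W' y" shows "spec S W X = spec S W' X"
proof -
  have "sol S X W e X f = sol S X W' e X f" for e f by (rule sol_cong) (use assms in auto)
  thus ?thesis unfolding spec_def by simp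
qed

text \<open>Each particle in the half-line contributes \<open>s\<close>. On a ball whose count at
  \<open>t\<close> is constant the whole spectrum is therefore translated rigidly.\<close>

lemma energy_shift:
  assumes S: "finite S"
  shows "energy lam (\<lambda>u. if u \<in> {..t} then v u + s else v u) U S y = energy lam v U S y + lam * s * real_of_int (cnt S y t)"
proof -
  have "(\<Sum>j\<in>S. if y j \<le> t then v (y j) + s else v (y j)) = (\<Sum>j\<in>S. v (y j) + (if y j \<le> t then s else 0))"
    by (intro sum.cong) auto
  also have "\<dots> = (\<Sum>j\<in>S. v (y j)) + (\<Sum>j\<in>S. if y j \<le> t then s else 0)" by (rule sum.distrib)
  also have "(\<Sum>j\<in>S. if y j \<le> t then s else 0) = s * real_of_int (cnt S y t)"
    using S unfolding cnt_def by (simp add: sum.If_cases Int_def)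
  finally show ?thesis unfolding energy_def by (simp add: algebra_simps)
qed

context anderson
begin

text \<open>Along the shift the difference of two levels changes at the speed
  \<open>lam * (n1 - n2)\<close>, of modulus at least \<open>lam\<close>, so it stays below
  \<open>c\<close> only on an interval of length at most \<open>2 * c / lam\<close>. The sets
  \<open>F1\<close> and \<open>F2\<close> are abstract in order to cover both spectra and diagonal
  entries.\<close>

lemma two_volume_abstract:
  fixes F1 F2 :: "(int \<Rightarrow> real) \<Rightarrow> real set" and n1 n2 :: int
  assumes P: "{v. \<exists>e\<in>F1 v. \<exists>e'\<in>F2 v. \<bar>e - e'\<bar> \<le> c} \<in> sets borel"
    and dep: "depends I (\<lambda>v. \<exists>e\<in>F1 v. \<exists>e'\<in>F2 v. \<bar>e - e'\<bar> \<le> c)" and I: "finite I" and del: "\<delta> > 0"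
    and F1: "\<And>v. finite (F1 v)" "\<And>v. card (F1 v) \<le> k1" and F2: "\<And>v. finite (F2 v)" "\<And>v. card (F2 v) \<le> k2"
    and s1: "\<And>v s e. e \<in> F1 (\<lambda>u. if u \<in> Q then v u + s else v u) \<Longrightarrow> e - lam * s * real_of_int n1 \<in> F1 v"
    and s2: "\<And>v s e. e \<in> F2 (\<lambda>u. if u \<in> Q then v u + s else v u) \<Longrightarrow> e - lam * s * real_of_int n2 \<in> F2 v"
    and n: "n1 \<noteq> n2" and lam: "lam > 0" and c: "c \<ge> 0"
  shows "measure \<mu> {v. \<exists>e\<in>F1 v. \<exists>e'\<in>F2 v. \<bar>e - e'\<bar> \<le> c} \<le>
    real (card I) * \<rho>max * \<delta> + (1 + C\<rho> * \<delta> / \<rho>min) ^ card I * (real k1 * real k2 * (2 * c / lam)) / \<delta>"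
proof (rule shift_average[OF P dep I del, of _ Q])
  show "0 \<le> real k1 * real k2 * (2 * c / lam)" using lam c by simp
  fix v
  define b where "b = lam * real_of_int (n1 - n2)"
  have "\<bar>real_of_int (n1 - n2)\<bar> \<ge> 1" using n by linarith
  hence b: "\<bar>b\<bar> \<ge> lam" unfolding b_def abs_mult using lam by (simp add: mult_le_cancel_left1)
  hence b0: "\<bar>b\<bar> > 0" using lam by linarith
  define J where "J = (\<lambda>(e, e'). {- (e - e') / b - c / \<bar>b\<bar>..- (e - e') / b + c / \<bar>b\<bar>})"
  have "{s \<in> {0..\<delta>}. \<exists>e\<in>F1 (\<lambda>u. if u \<in> Q then v u + s else v u). \<exists>e'\<in>F2 (\<lambda>u. if u \<in> Q then v u + s else v u). \<bar>e - e'\<bar> \<le> c}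
     \<subseteq> (\<Union>p\<in>F1 v \<times> F2 v. J p)"
  proof
    fix s assume "s \<in> {s \<in> {0..\<delta>}. \<exists>e\<in>F1 (\<lambda>u. if u \<in> Q then v u + s else v u). \<exists>e'\<in>F2 (\<lambda>u. if u \<in> Q then v u + s else v u). \<bar>e - e'\<bar> \<le> c}"
    then obtain e e' where e: "e \<in> F1 (\<lambda>u. if u \<in> Q then v u + s else v u)" "e' \<in> F2 (\<lambda>u. if u \<in> Q then v u + s else v u)" "\<bar>e - e'\<bar> \<le> c" by auto
    define d where "d = e - lam * s * real_of_int n1"
    define d' where "d' = e' - lam * s * real_of_int n2"
    have dd: "d \<in> F1 v" "d' \<in> F2 v" unfolding d_def d'_def using s1 s2 e by auto
    have "e - e' = d - d' + b * s" unfolding d_def d'_def b_def by (simp add: algebra_simps)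
    moreover have "b * (s + (d - d') / b) = d - d' + b * s" using b0 by (simp add: field_simps)
    ultimately have "\<bar>b * (s + (d - d') / b)\<bar> \<le> c" using e(3) by simp
    hence "\<bar>b\<bar> * \<bar>s + (d - d') / b\<bar> \<le> c" by (simp add: abs_mult)
    hence "\<bar>s + (d - d') / b\<bar> \<le> c / \<bar>b\<bar>" using b0 by (simp add: field_simps)
    hence "s \<in> J (d, d')" unfolding J_def prod.case atLeastAtMost_iff by linarith
    thus "s \<in> (\<Union>p\<in>F1 v \<times> F2 v. J p)" using dd by blast
  qed
  hence "emeasure lborel {s \<in> {0..\<delta>}. \<exists>e\<in>F1 (\<lambda>u. if u \<in> Q then v u + s else v u). \<exists>e'\<in>F2 (\<lambda>u. if u \<in> Q then v u + s else v u). \<bar>e - e'\<bar> \<le> c}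
     \<le> emeasure lborel (\<Union>p\<in>F1 v \<times> F2 v. J p)"
    using F1 F2 by (intro emeasure_mono) (auto intro!: sets.finite_UN simp: J_def)
  also have "\<dots> \<le> (\<Sum>p\<in>F1 v \<times> F2 v. emeasure lborel (J p))"
    using F1 F2 by (intro emeasure_subadditive_finite) (auto simp: J_def)
  also have "\<dots> \<le> (\<Sum>p\<in>F1 v \<times> F2 v. ennreal (2 * c / lam))"
  proof (rule sum_mono)
    fix p assume "p \<in> F1 v \<times> F2 v"
    obtain d d' where p: "p = (d, d')" by (cases p)
    have "emeasure lborel (J p) = ennreal (2 * (c / \<bar>b\<bar>))"
      unfolding p J_def using c b0 by simp
    also have "\<dots> \<le> ennreal (2 * (c / lam))" using c b lam by (intro ennreal_leI mult_left_mono divide_left_mono) auto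
    finally show "emeasure lborel (J p) \<le> ennreal (2 * c / lam)" by simp
  qed
  also have "\<dots> = of_nat (card (F1 v \<times> F2 v)) * ennreal (2 * c / lam)" by simp
  also have "\<dots> = ennreal (real (card (F1 v \<times> F2 v)) * (2 * c / lam))"
    using c lam by (subst ennreal_mult) (auto simp: ennreal_of_nat_eq_real_of_nat)
  also have "\<dots> \<le> ennreal (real k1 * real k2 * (2 * c / lam))"
  proof (intro ennreal_leI mult_right_mono)
    have "card (F1 v \<times> F2 v) \<le> k1 * k2" unfolding card_cartesian_product using F1 F2 by (intro mult_mono) auto
    hence "real (card (F1 v \<times> F2 v)) \<le> real (k1 * k2)" by (rule of_nat_mono)
    thus "real (card (F1 v \<times> F2 v)) \<le> real k1 * real k2" by simp
  qed (use c lam in auto)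
  finally show "emeasure lborel {s \<in> {0..\<delta>}. \<exists>e\<in>F1 (\<lambda>u. if u \<in> Q then v u + s else v u). \<exists>e'\<in>F2 (\<lambda>u. if u \<in> Q then v u + s else v u). \<bar>e - e'\<bar> \<le> c}
     \<le> ennreal (real k1 * real k2 * (2 * c / lam))" .
qed

text \<open>The bound of \<open>two_volume_abstract\<close> for two balls of radius \<open>l\<close>.\<close>

definition wbound :: "nat \<Rightarrow> nat \<Rightarrow> real \<Rightarrow> real \<Rightarrow> real" where
  "wbound N l \<delta> c = real (2 * (N * (2 * l + 1))) * \<rho>max * \<delta> +
     (1 + C\<rho> * \<delta> / \<rho>min) ^ (2 * (N * (2 * l + 1))) * (real ((N * (2 * l + 1)) ^ N) * real ((N * (2 * l + 1)) ^ N) * (2 * c)) / \<delta>"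

lemma wbound_ge:
  assumes n: "n \<le> 2 * (N * (2 * l + 1))" and k: "k1 \<le> (N * (2 * l + 1)) ^ N" "k2 \<le> (N * (2 * l + 1)) ^ N"
    and del: "\<delta> > 0" and c: "c \<ge> 0"
  shows "real n * \<rho>max * \<delta> + (1 + C\<rho> * \<delta> / \<rho>min) ^ n * (real k1 * real k2 * (2 * c)) / \<delta> \<le> wbound N l \<delta> c"
  unfolding wbound_def
proof (intro add_mono mult_right_mono divide_right_mono mult_mono)
  show "(1 + C\<rho> * \<delta> / \<rho>min) ^ n \<le> (1 + C\<rho> * \<delta> / \<rho>min) ^ (2 * (N * (2 * l + 1)))"
    using n lip0 del rmin by (intro power_increasing) auto
  show "real k1 \<le> real ((N * (2 * l + 1)) ^ N)" "real k2 \<le> real ((N * (2 * l + 1)) ^ N)"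
    using k by (auto simp del: of_nat_power of_nat_mult intro: of_nat_mono)
  show "real n \<le> real (2 * (N * (2 * l + 1)))" using n by (rule of_nat_mono)
qed (use rmax del c lip0 rmin in auto)

text \<open>For \<open>lam \<ge> 1\<close> the disorder only accelerates the shift; dropping
  \<open>1 / lam\<close> makes the bound uniform in the disorder, as needed at all later
  scales.\<close>

lemma wegner_two_volume:
  assumes S: "finite S" and far: "\<not> near S ((8 * card S + 2) * l) x y" and r: "r1 \<le> l" "r2 \<le> l"
    and lam: "lam \<ge> 1" and del: "\<delta> > 0" and c: "c \<ge> 0"
  shows "measure \<mu> {v. \<exists>e\<in>spec S (energy lam v U S) (sball S r1 x \<inter> Om).
       \<exists>e'\<in>spec S (energy lam v U S) (sball S r2 y \<inter> Om). \<bar>e - e'\<bar> \<le> c} \<le> wbound (card S) l \<delta> c"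
proof -
  have "\<not> near S ((4 * card S + 2) * l) x y" using far near_mono[OF S, of "(4 * card S + 2) * l" x y "(8 * card S + 2) * l"] by auto
  then obtain t n1 n2 where t: "n1 \<noteq> n2"
    "\<And>u. u \<in> sball S l x \<Longrightarrow> cnt S u t = n1" "\<And>u. u \<in> sball S l y \<Longrightarrow> cnt S u t = n2"
    using separating_threshold[OF S] by metis
  let ?X = "sball S r1 x \<inter> Om" and ?Y = "sball S r2 y \<inter> Om"
  let ?F1 = "\<lambda>v. spec S (energy lam v U S) ?X" and ?F2 = "\<lambda>v. spec S (energy lam v U S) ?Y"
  let ?I = "sites S l x \<union> sites S l y"
  have sub: "?X \<subseteq> sball S l x" "?Y \<subseteq> sball S l y" using r by (auto simp: sball_iff[OF S])
  have fX: "finite ?X" "finite ?Y" using sball_finite_card(1)[OF S] by blast+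
  have fI: "finite ?I" using finite_sites[OF S] by auto
  have cb: "card (sball S r z) \<le> (card S * (2 * l + 1)) ^ card S" if "r \<le> l" for r z
  proof -
    have "card (sball S r z) \<le> card (sball S l z)"
      using that by (intro card_mono sball_finite_card(1)[OF S]) (auto simp: sball_iff[OF S])
    thus ?thesis using sball_finite_card(2)[OF S, of l z] by linarith
  qed
  have k1: "card (?F1 v) \<le> (card S * (2 * l + 1)) ^ card S" for v
    using spec_finite_card(2)[OF fX(1), of S "energy lam v U S"] cb[OF r(1), of x]
      card_mono[OF sball_finite_card(1)[OF S], of ?X r1 x] by auto
  have k2: "card (?F2 v) \<le> (card S * (2 * l + 1)) ^ card S" for v
    using spec_finite_card(2)[OF fX(2), of S "energy lam v U S"] cb[OF r(2), of y]
      card_mono[OF sball_finite_card(1)[OF S], of ?Y r2 y] by auto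
  have cI: "card ?I \<le> 2 * (card S * (2 * l + 1))"
    using card_Un_le[of "sites S l x" "sites S l y"] card_sites[OF S, of l x] card_sites[OF S, of l y] by linarith
  have dep: "depends ?I (\<lambda>v. \<exists>e\<in>?F1 v. \<exists>e'\<in>?F2 v. \<bar>e - e'\<bar> \<le> c)"
    unfolding depends_def
  proof (intro allI impI)
    fix v w :: "int \<Rightarrow> real" assume vw: "\<forall>u\<in>?I. v u = w u"
    have "?F1 v = ?F1 w" using vw sub by (intro spec_cong energy_cong_sball[OF S, of l x]) auto
    moreover have "?F2 v = ?F2 w" using vw sub by (intro spec_cong energy_cong_sball[OF S, of l y]) auto
    ultimately show "(\<exists>e\<in>?F1 v. \<exists>e'\<in>?F2 v. \<bar>e - e'\<bar> \<le> c) = (\<exists>e\<in>?F1 w. \<exists>e'\<in>?F2 w. \<bar>e - e'\<bar> \<le> c)" by simp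
  qed
  have "measure \<mu> {v. \<exists>e\<in>?F1 v. \<exists>e'\<in>?F2 v. \<bar>e - e'\<bar> \<le> c} \<le>
    real (card ?I) * \<rho>max * \<delta> + (1 + C\<rho> * \<delta> / \<rho>min) ^ card ?I *
      (real ((card S * (2 * l + 1)) ^ card S) * real ((card S * (2 * l + 1)) ^ card S) * (2 * c / lam)) / \<delta>"
  proof (rule two_volume_abstract[OF spec_close_borel[OF S fX] dep fI del, of _ _ "{..t}" lam n1 n2])
    show "finite (?F1 v)" "finite (?F2 v)" for v using spec_finite_card(1) fX by auto
    show "e - lam * s * real_of_int n1 \<in> ?F1 v" if "e \<in> ?F1 (\<lambda>u. if u \<in> {..t} then v u + s else v u)" for v s e
      using that sub t(2) by (intro spec_shift[of ?X "energy lam (\<lambda>u. if u \<in> {..t} then v u + s else v u) U S"])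
        (auto simp only: energy_shift[OF S])
    show "e - lam * s * real_of_int n2 \<in> ?F2 v" if "e \<in> ?F2 (\<lambda>u. if u \<in> {..t} then v u + s else v u)" for v s e
      using that sub t(3) by (intro spec_shift[of ?Y "energy lam (\<lambda>u. if u \<in> {..t} then v u + s else v u) U S"])
        (auto simp only: energy_shift[OF S])
  qed (use k1 k2 t lam c in auto)
  also have "\<dots> \<le> real (card ?I) * \<rho>max * \<delta> + (1 + C\<rho> * \<delta> / \<rho>min) ^ card ?I *
      (real ((card S * (2 * l + 1)) ^ card S) * real ((card S * (2 * l + 1)) ^ card S) * (2 * c)) / \<delta>"
  proof -
    have "c * 1 \<le> c * lam" using lam c by (intro mult_left_mono) auto
    hence "2 * c / lam \<le> 2 * c" using lam by (simp add: field_simps)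
    thus ?thesis using del lip0 rmin c
      by (intro add_left_mono divide_right_mono mult_left_mono) auto
  qed
  also have "\<dots> \<le> wbound (card S) l \<delta> c" by (rule wbound_ge[OF cI _ _ del c]) auto
  finally show ?thesis .
qed

text \<open>Here the factor \<open>1 / lam\<close> is retained: at a fixed scale the contribution of
  the coincidence width can be made as small as desired by the disorder.\<close>

lemma diagonal_two_volume:
  assumes S: "finite S" and far: "\<not> near S ((8 * card S + 2) * l) x y"
    and lam: "lam > 0" and del: "\<delta> > 0" and c: "c \<ge> 0"
  shows "{v. \<exists>u\<in>sball S l x \<inter> Om. \<exists>w\<in>sball S l y \<inter> Om. \<bar>energy lam v U S u - energy lam v U S w\<bar> \<le> c} \<in> sets borel"
    "measure \<mu> {v. \<exists>u\<in>sball S l x \<inter> Om. \<exists>w\<in>sball S l y \<inter> Om. \<bar>energy lam v U S u - energy lam v U S w\<bar> \<le> c}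
       \<le> wbound (card S) l \<delta> (c / lam)"
proof -
  have "\<not> near S ((4 * card S + 2) * l) x y" using far near_mono[OF S, of "(4 * card S + 2) * l" x y "(8 * card S + 2) * l"] by auto
  then obtain t n1 n2 where t: "n1 \<noteq> n2"
    "\<And>u. u \<in> sball S l x \<Longrightarrow> cnt S u t = n1" "\<And>u. u \<in> sball S l y \<Longrightarrow> cnt S u t = n2"
    using separating_threshold[OF S] by metis
  let ?X = "sball S l x \<inter> Om" and ?Y = "sball S l y \<inter> Om"
  let ?F1 = "\<lambda>v. energy lam v U S ` ?X" and ?F2 = "\<lambda>v. energy lam v U S ` ?Y"
  let ?I = "sites S l x \<union> sites S l y"
  have fX: "finite ?X" "finite ?Y" using sball_finite_card(1)[OF S] by blast+
  have fI: "finite ?I" using finite_sites[OF S] by auto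
  have k: "card (?F1 v) \<le> (card S * (2 * l + 1)) ^ card S" "card (?F2 v) \<le> (card S * (2 * l + 1)) ^ card S" for v
    using card_image_le[OF fX(1), of "energy lam v U S"] card_image_le[OF fX(2), of "energy lam v U S"]
      sball_finite_card(2)[OF S, of l x] sball_finite_card(2)[OF S, of l y]
      card_mono[OF sball_finite_card(1)[OF S], of ?X l x] card_mono[OF sball_finite_card(1)[OF S], of ?Y l y] by auto
  have cI: "card ?I \<le> 2 * (card S * (2 * l + 1))"
    using card_Un_le[of "sites S l x" "sites S l y"] card_sites[OF S, of l x] card_sites[OF S, of l y] by linarith
  have dep: "depends ?I (\<lambda>v. \<exists>e\<in>?F1 v. \<exists>e'\<in>?F2 v. \<bar>e - e'\<bar> \<le> c)"
    unfolding depends_def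
  proof (intro allI impI)
    fix v w :: "int \<Rightarrow> real" assume vw: "\<forall>u\<in>?I. v u = w u"
    have "?F1 v = ?F1 w" using vw by (intro image_cong refl energy_cong_sball[OF S, of l x]) auto
    moreover have "?F2 v = ?F2 w" using vw by (intro image_cong refl energy_cong_sball[OF S, of l y]) auto
    ultimately show "(\<exists>e\<in>?F1 v. \<exists>e'\<in>?F2 v. \<bar>e - e'\<bar> \<le> c) = (\<exists>e\<in>?F1 w. \<exists>e'\<in>?F2 w. \<bar>e - e'\<bar> \<le> c)" by simp
  qed
  have eq: "{v. \<exists>u\<in>?X. \<exists>w\<in>?Y. \<bar>energy lam v U S u - energy lam v U S w\<bar> \<le> c} = {v. \<exists>e\<in>?F1 v. \<exists>e'\<in>?F2 v. \<bar>e - e'\<bar> \<le> c}" by auto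
  have "{v. \<exists>u\<in>?X. \<exists>w\<in>?Y. \<bar>energy lam v U S u - energy lam v U S w\<bar> \<le> c} =
     (\<Union>u\<in>?X. \<Union>w\<in>?Y. {v. \<bar>energy lam v U S u - energy lam v U S w\<bar> \<le> c})" by auto
  also have "\<dots> \<in> sets borel"
    using fX by (intro sets.finite_UN borel_closed closed_Collect_le continuous_intros continuous_energy) auto
  finally show m: "{v. \<exists>u\<in>?X. \<exists>w\<in>?Y. \<bar>energy lam v U S u - energy lam v U S w\<bar> \<le> c} \<in> sets borel" .
  have "measure \<mu> {v. \<exists>e\<in>?F1 v. \<exists>e'\<in>?F2 v. \<bar>e - e'\<bar> \<le> c} \<le>
    real (card ?I) * \<rho>max * \<delta> + (1 + C\<rho> * \<delta> / \<rho>min) ^ card ?I *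
      (real ((card S * (2 * l + 1)) ^ card S) * real ((card S * (2 * l + 1)) ^ card S) * (2 * c / lam)) / \<delta>"
  proof (rule two_volume_abstract[OF m[unfolded eq] dep fI del, of _ _ "{..t}" lam n1 n2])
    show "finite (?F1 v)" "finite (?F2 v)" for v using fX by auto
    show "e - lam * s * real_of_int n1 \<in> ?F1 v" if "e \<in> ?F1 (\<lambda>u. if u \<in> {..t} then v u + s else v u)" for v s e
      using that t(2) unfolding energy_shift[OF S] by auto
    show "e - lam * s * real_of_int n2 \<in> ?F2 v" if "e \<in> ?F2 (\<lambda>u. if u \<in> {..t} then v u + s else v u)" for v s e
      using that t(3) unfolding energy_shift[OF S] by auto
  qed (use k t lam c in auto)
  also have "\<dots> = real (card ?I) * \<rho>max * \<delta> + (1 + C\<rho> * \<delta> / \<rho>min) ^ card ?I *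
      (real ((card S * (2 * l + 1)) ^ card S) * real ((card S * (2 * l + 1)) ^ card S) * (2 * (c / lam))) / \<delta>" by simp
  also have "\<dots> \<le> wbound (card S) l \<delta> (c / lam)" by (rule wbound_ge[OF cI _ _ del]) (use c lam in auto)
  finally show "measure \<mu> {v. \<exists>u\<in>?X. \<exists>w\<in>?Y. \<bar>energy lam v U S u - energy lam v U S w\<bar> \<le> c} \<le> wbound (card S) l \<delta> (c / lam)"
    unfolding eq .
qed

end

section \<open>Asymptotic inequalities\<close>

text \<open>The width decays faster than every power of \<open>l\<close>, so resonances are
  unlikely, but slower than every exponential, so its reciprocal is negligible against
  \<open>growth\<close>. At scale \<open>l * l\<close> the reciprocal is only
  \<open>exp (sqrt l)\<close>.\<close>

definition res_width :: "nat \<Rightarrow> real" where "res_width l = exp (- (real l powr (1/4)))"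

text \<open>The scale-dependent part of the rate absorbs the loss in passing from \<open>l\<close> to \<open>l\<^sup>2\<close>.\<close>

definition growth :: "real \<Rightarrow> nat \<Rightarrow> real" where
  "growth M l = exp (M * (1 + real l powr (-1/4)) * real l)"

lemma res_width_pos: "res_width l > 0" unfolding res_width_def by simp

lemma growth_pos: "growth M l > 0" unfolding growth_def by simp

lemma ball_count_asymp: "\<forall>\<^sub>F l::nat in sequentially. real ((N * (2 * l + 1)) ^ N) \<le> real l ^ (2 * N)"
proof -
  have "\<forall>\<^sub>F l::nat in sequentially. real N * (2 * real l + 1) \<le> real l ^ 2" by real_asymp
  thus ?thesis
  proof eventually_elim
    case (elim l)
    have "real ((N * (2 * l + 1)) ^ N) = (real N * (2 * real l + 1)) ^ N" by (simp add: algebra_simps)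
    also have "\<dots> \<le> (real l ^ 2) ^ N" using elim by (intro power_mono) auto
    finally show ?case by (simp add: power_mult)
  qed
qed

lemma ball_count_square_asymp:
  "\<forall>\<^sub>F l::nat in sequentially. real ((N * (2 * (l * l) + 1)) ^ N) \<le> real l ^ (3 * N)"
proof -
  have "\<forall>\<^sub>F l::nat in sequentially. real N * (2 * (real l * real l) + 1) \<le> real l ^ 3" by real_asymp
  thus ?thesis
  proof eventually_elim
    case (elim l)
    have "real ((N * (2 * (l * l) + 1)) ^ N) = (real N * (2 * (real l * real l) + 1)) ^ N" by (simp add: algebra_simps)
    also have "\<dots> \<le> (real l ^ 3) ^ N" using elim by (intro power_mono) auto
    finally show ?case by (simp add: power_mult)
  qed
qed

text \<open>With shifts up to \<open>l powr - (a + 5)\<close>, the factor of order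
  \<open>l ^ 3\<close> from the sites and the pairs of radii is affordable, and the product of the
  density ratios stays below \<open>exp 1\<close>. The other term contains
  \<open>res_width l\<close> and is smaller than any power.\<close>

lemma (in anderson) wegner_asymp:
  assumes a: "a \<ge> 0"
  shows "\<forall>\<^sub>F l::nat in sequentially.
    (real l + 1)\<^sup>2 * wbound N l (real l powr - (a + 5)) (2 * res_width l) \<le> real l powr - a"
proof -
  define b where "b = 4 * real N + 2 * a + 5"
  have e1: "\<forall>\<^sub>F l::nat in sequentially. (real l + 1)\<^sup>2 * (2 * (real N * (2 * real l + 1)) * \<rho>max) * real l powr - 5 \<le> 1 / 2"
    by real_asymp
  have e2: "\<forall>\<^sub>F l::nat in sequentially. 2 * (real N * (2 * real l + 1)) * (C\<rho> / \<rho>min) * real l powr - 5 \<le> 1"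
    by real_asymp
  have e3: "\<forall>\<^sub>F l::nat in sequentially. (real l + 1)\<^sup>2 * (4 * exp 1) * real l powr b * exp (- (real l powr (1/4))) \<le> 1 / 2"
    by real_asymp
  show ?thesis
    using e1 e2 e3 ball_count_asymp[of N] eventually_ge_at_top[of "1::nat"]
  proof eventually_elim
    case (elim l)
    let ?x = "real l"
    let ?n = "2 * (N * (2 * l + 1))" and ?d = "?x powr - (a + 5)" and ?R = "real ((N * (2 * l + 1)) ^ N)"
    have x: "?x \<ge> 1" using elim(5) by simp
    have d: "?d > 0" using x by simp
    have split: "?d = ?x powr - 5 * ?x powr - a" by (simp add: powr_add[symmetric] algebra_simps)
    have am: "0 < ?x powr - a" "?x powr - a \<le> 1" using x a by (auto intro: powr_le_one_le simp: powr_minus_divide ge_one_powr_ge_zero)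
    have t1: "(?x + 1)\<^sup>2 * (real ?n * \<rho>max * ?d) \<le> ?x powr - a / 2"
    proof -
      have "(?x + 1)\<^sup>2 * (real ?n * \<rho>max * ?d) = ((?x + 1)\<^sup>2 * (2 * (real N * (2 * ?x + 1)) * \<rho>max) * ?x powr - 5) * ?x powr - a"
        unfolding split by (simp add: algebra_simps)
      also have "\<dots> \<le> 1 / 2 * ?x powr - a" using elim(1) am by (intro mult_right_mono) auto
      finally show ?thesis by simp
    qed
    have pw: "(1 + C\<rho> * ?d / \<rho>min) ^ ?n \<le> exp 1"
    proof -
      have c0: "0 \<le> C\<rho> * ?d / \<rho>min" using lip0 rmin d by simp
      have "(1 + C\<rho> * ?d / \<rho>min) ^ ?n \<le> exp (C\<rho> * ?d / \<rho>min) ^ ?n"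
        using c0 by (intro power_mono) auto
      also have "\<dots> = exp (real ?n * (C\<rho> * ?d / \<rho>min))" by (simp only: exp_of_nat_mult)
      also have "real ?n * (C\<rho> * ?d / \<rho>min) = (2 * (real N * (2 * ?x + 1)) * (C\<rho> / \<rho>min) * ?x powr - 5) * ?x powr - a"
        unfolding split by (simp add: algebra_simps add_divide_distrib)
      also have "\<dots> \<le> 1 * 1" using elim(2) am lip0 rmin by (intro mult_mono) auto
      finally show ?thesis by simp
    qed
    have t2: "(?x + 1)\<^sup>2 * ((1 + C\<rho> * ?d / \<rho>min) ^ ?n * (?R * ?R * (2 * (2 * res_width l))) / ?d) \<le> ?x powr - a / 2"
    proof -
      have R: "0 \<le> ?R" by simp
      have RR: "?R * ?R \<le> ?x powr (4 * real N)"
      proof -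
        have "?R * ?R \<le> ?x ^ (2 * N) * ?x ^ (2 * N)" using elim(4) R by (intro mult_mono) auto
        also have "\<dots> = ?x ^ (4 * N)" by (simp add: power_add[symmetric])
        also have "\<dots> = ?x powr real (4 * N)" using x by (subst powr_realpow) auto
        finally show ?thesis by simp
      qed
      have "(1 + C\<rho> * ?d / \<rho>min) ^ ?n * (?R * ?R * (2 * (2 * res_width l))) / ?d
         \<le> exp 1 * (?x powr (4 * real N) * (2 * (2 * res_width l))) / ?d"
        using pw RR d res_width_pos[of l] R lip0 rmin by (intro divide_right_mono mult_mono) auto
      also have "\<dots> = (4 * exp 1) * (?x powr (4 * real N) * ?x powr (a + 5)) * res_width l"
        unfolding powr_minus_divide[of ?x "a + 5"] by simp
      also have "?x powr (4 * real N) * ?x powr (a + 5) = ?x powr b * ?x powr - a"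
        unfolding b_def by (simp add: powr_add[symmetric] algebra_simps)
      finally have "(?x + 1)\<^sup>2 * ((1 + C\<rho> * ?d / \<rho>min) ^ ?n * (?R * ?R * (2 * (2 * res_width l))) / ?d)
         \<le> (?x + 1)\<^sup>2 * ((4 * exp 1) * (?x powr b * ?x powr - a) * res_width l)" by (intro mult_left_mono) auto
      also have "\<dots> = ((?x + 1)\<^sup>2 * (4 * exp 1) * ?x powr b * exp (- (?x powr (1/4)))) * ?x powr - a"
        unfolding res_width_def by (simp add: algebra_simps)
      also have "\<dots> \<le> 1 / 2 * ?x powr - a" using elim(3) am by (intro mult_right_mono) auto
      finally show ?thesis by simp
    qed
    show ?case unfolding wbound_def using t1 t2 by (simp only: distrib_left)
  qed
qed

text \<open>The first term of \<open>wbound\<close> is small by the choice of \<open>l\<close>; for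
  this fixed \<open>l\<close> the second is a constant divided by \<open>lam\<close>. Hence the
  order of the two limits.\<close>

lemma (in anderson) start_asymp:
  "\<forall>\<^sub>F l::nat in sequentially. \<forall>\<^sub>F lam in at_top.
     wbound N l (real l powr - (P + 3)) (c / lam) \<le> real l powr - P"
proof -
  have "\<forall>\<^sub>F l::nat in sequentially. 2 * (real N * (2 * real l + 1)) * \<rho>max * real l powr - 3 \<le> 1 / 2"
    by real_asymp
  thus ?thesis using eventually_ge_at_top[of "1::nat"]
  proof eventually_elim
    case (elim l)
    let ?x = "real l"
    have x: "?x \<ge> 1" using elim(2) by simp
    have am: "0 < ?x powr - P" using x by simp
    define A where "A = (1 + C\<rho> * ?x powr - (P + 3) / \<rho>min) ^ (2 * (N * (2 * l + 1))) *
      (real ((N * (2 * l + 1)) ^ N) * real ((N * (2 * l + 1)) ^ N) * (2 * c)) / ?x powr - (P + 3)"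
    have "((\<lambda>lam. A / lam) \<longlongrightarrow> 0) at_top" by real_asymp
    hence "\<forall>\<^sub>F lam in at_top. A / lam < ?x powr - P / 2" using am by (intro order_tendstoD) auto
    thus ?case
    proof eventually_elim
      case (elim lam)
      have "real (2 * (N * (2 * l + 1))) * \<rho>max * ?x powr - (P + 3) = (2 * (real N * (2 * ?x + 1)) * \<rho>max * ?x powr - 3) * ?x powr - P"
        by (simp add: powr_add[symmetric] algebra_simps)
      also have "\<dots> \<le> 1 / 2 * ?x powr - P"
        using \<open>2 * (real N * (2 * real l + 1)) * \<rho>max * real l powr - 3 \<le> 1 / 2\<close> am by (intro mult_right_mono) auto
      finally have "real (2 * (N * (2 * l + 1))) * \<rho>max * ?x powr - (P + 3) \<le> ?x powr - P / 2" by simp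
      moreover have "(1 + C\<rho> * ?x powr - (P + 3) / \<rho>min) ^ (2 * (N * (2 * l + 1))) *
         (real ((N * (2 * l + 1)) ^ N) * real ((N * (2 * l + 1)) ^ N) * (2 * (c / lam))) / ?x powr - (P + 3) = A / lam"
        unfolding A_def by (simp add: mult_ac)
      ultimately show ?case unfolding wbound_def using elim by linarith
    qed
  qed
qed

text \<open>About \<open>l\<close> steps gain \<open>M * (1 + l powr (-1/4)) * l\<close> each in the
  exponent, while the new scale asks for \<open>M * (1 + l powr (-1/2)) * l * l\<close>. The surplus
  of order \<open>l powr (7/4)\<close> outweighs the losses of order \<open>l powr (3/2)\<close> and
  the \<open>c0\<close> missing steps, which cost order \<open>l\<close>.\<close>

lemma scale_asymp:
  assumes M: "M > 0"
  shows "\<forall>\<^sub>F l::nat in sequentially. c0 \<le> l \<and>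
    (real ((N * (2 * (l * l) + 1)) ^ N))\<^sup>2 * (2 * real N) / res_width (l * l) \<le> exp (2 * sqrt (real l)) \<and>
    (exp (2 * sqrt (real l)) / growth M l) ^ (l - c0) * (exp (2 * sqrt (real l)) * growth M (l * l)) < 1"
proof -
  have e1: "\<forall>\<^sub>F l::nat in sequentially. (real l - real c0) * (2 * sqrt l - M * (1 + real l powr (-1/4)) * real l)
      + 2 * sqrt l + M * (1 + real l powr (-1/2)) * (real l * real l) < 0"
    using M by real_asymp
  have e2: "\<forall>\<^sub>F l::nat in sequentially. real (6 * N + 1) * ln (real l) \<le> sqrt (real l)" by real_asymp
  show ?thesis
    using e1 e2 ball_count_square_asymp[of N] eventually_ge_at_top[of "max 1 (max c0 (2 * N))"]
  proof eventually_elim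
    case (elim l)
    let ?x = "real l"
    have x: "?x \<ge> 1" "l \<ge> c0" "2 * N \<le> l" "l \<ge> 1" using elim(4) by auto
    have r4: "real (l * l) powr (1/4) = sqrt ?x"
    proof -
      have "real (l * l) powr (1/4) = (?x powr 2) powr (1/4)" using x by (simp add: powr_numeral power2_eq_square)
      also have "\<dots> = ?x powr (1/2)" unfolding powr_powr by simp
      finally show ?thesis using x by (simp add: powr_half_sqrt)
    qed
    have r4': "real (l * l) powr (-1/4) = ?x powr (-1/2)"
    proof -
      have "real (l * l) powr (-1/4) = (?x powr 2) powr (-1/4)" using x by (simp add: powr_numeral power2_eq_square)
      also have "\<dots> = ?x powr (-1/2)" unfolding powr_powr by simp
      finally show ?thesis .
    qed
    have "(real ((N * (2 * (l * l) + 1)) ^ N))\<^sup>2 * (2 * real N) \<le> (?x ^ (3 * N))\<^sup>2 * ?x"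
      using elim(3) x by (intro mult_mono power_mono) auto
    also have "\<dots> = ?x ^ (6 * N + 1)" by (simp add: power_mult[symmetric] power_add)
    also have "\<dots> = exp (real (6 * N + 1) * ln ?x)" using x by (subst exp_of_nat_mult) auto
    also have "\<dots> \<le> exp (sqrt ?x)" using elim(2) by simp
    finally have 1: "(real ((N * (2 * (l * l) + 1)) ^ N))\<^sup>2 * (2 * real N) / res_width (l * l) \<le> exp (sqrt ?x) / res_width (l * l)"
      using res_width_pos[of "l * l"] by (intro divide_right_mono) auto
    also have "\<dots> = exp (2 * sqrt ?x)" unfolding res_width_def r4 by (simp add: exp_minus divide_inverse mult_exp_exp)
    finally have 2: "(real ((N * (2 * (l * l) + 1)) ^ N))\<^sup>2 * (2 * real N) / res_width (l * l) \<le> exp (2 * sqrt ?x)" .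
    have "(exp (2 * sqrt ?x) / growth M l) ^ (l - c0) * (exp (2 * sqrt ?x) * growth M (l * l))
      = exp (real (l - c0) * (2 * sqrt ?x - M * (1 + ?x powr (-1/4)) * ?x)) * exp (2 * sqrt ?x + M * (1 + ?x powr (-1/2)) * (?x * ?x))"
      unfolding growth_def r4' exp_diff[symmetric] exp_of_nat_mult exp_add by (simp add: algebra_simps)
    also have "\<dots> = exp ((?x - real c0) * (2 * sqrt ?x - M * (1 + ?x powr (-1/4)) * ?x) + (2 * sqrt ?x + M * (1 + ?x powr (-1/2)) * (?x * ?x)))"
      using x(2) by (simp add: mult_exp_exp of_nat_diff)
    also have "\<dots> < 1" using elim(1) by simp
    finally show ?case using 2 x by simp
  qed
qed

text \<open>Of the rate \<open>4 * M\<close> of the smaller systems, \<open>3 * M\<close> survives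
  the uncertainty \<open>2 * l powr \<tau>\<close> of the distance. \<open>growth M l\<close> uses
  at most \<open>2 * M\<close>, and the rest dominates the cardinalities and the resonance
  width.\<close>

lemma split_asymp:
  assumes M: "M > 0" and \<tau>: "\<tau> < 1"
  shows "\<forall>\<^sub>F l::nat in sequentially.
    (real ((N * (2 * l + 1)) ^ N))\<^sup>2 * (2 * real N) * exp (- (4 * M) * (real l - 2 * real l powr \<tau>)) / res_width l * growth M l < 1"
proof -
  have e1: "\<forall>\<^sub>F l::nat in sequentially. 8 * real l powr \<tau> \<le> real l" using \<tau> by real_asymp
  have e2: "\<forall>\<^sub>F l::nat in sequentially. real (4 * N + 1) * ln (real l) + real l powr (1/4) < M * real l"
    using M by real_asymp
  show ?thesis
    using e1 e2 ball_count_asymp[of N] eventually_ge_at_top[of "max 1 (2 * N)"]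
  proof eventually_elim
    case (elim l)
    let ?x = "real l"
    have x: "?x \<ge> 1" "2 * N \<le> l" using elim(4) by auto
    have a: "(real ((N * (2 * l + 1)) ^ N))\<^sup>2 * (2 * real N) \<le> exp (real (4 * N + 1) * ln ?x)"
    proof -
      have "(real ((N * (2 * l + 1)) ^ N))\<^sup>2 * (2 * real N) \<le> (?x ^ (2 * N))\<^sup>2 * ?x"
        using elim(3) x by (intro mult_mono power_mono) auto
      also have "\<dots> = ?x ^ (4 * N + 1)" by (simp add: power_mult[symmetric] power_add)
      also have "\<dots> = exp (real (4 * N + 1) * ln ?x)" using x by (subst exp_of_nat_mult) auto
      finally show ?thesis .
    qed
    have b: "growth M l \<le> exp (2 * M * ?x)"
    proof -
      have "?x powr (-1/4) \<le> ?x powr 0" using x by (intro powr_mono) auto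
      hence "?x powr (-1/4) \<le> 1" using x by simp
      hence "M * (1 + ?x powr (-1/4)) \<le> M * 2" using M by (intro mult_left_mono) auto
      hence "M * (1 + ?x powr (-1/4)) * ?x \<le> M * 2 * ?x" using x by (intro mult_right_mono) auto
      thus ?thesis unfolding growth_def by (simp add: mult_ac)
    qed
    have c: "exp (- (4 * M) * (?x - 2 * ?x powr \<tau>)) \<le> exp (- (3 * M) * ?x)"
    proof -
      have "M * (8 * ?x powr \<tau>) \<le> M * ?x" using elim(1) M by (intro mult_left_mono) auto
      thus ?thesis by (simp add: algebra_simps)
    qed
    have "(real ((N * (2 * l + 1)) ^ N))\<^sup>2 * (2 * real N) * exp (- (4 * M) * (?x - 2 * ?x powr \<tau>)) / res_width l * growth M l
      \<le> exp (real (4 * N + 1) * ln ?x) * exp (- (3 * M) * ?x) / res_width l * exp (2 * M * ?x)"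
      using a b c growth_pos[of M l] res_width_pos[of l] by (intro mult_mono divide_right_mono) auto
    also have "\<dots> = exp (real (4 * N + 1) * ln ?x + - (3 * M) * ?x + ?x powr (1/4) + 2 * M * ?x)"
      unfolding res_width_def by (simp only: exp_add exp_minus divide_inverse inverse_inverse_eq)
    also have "\<dots> < 1" using elim(2) by simp
    finally show ?case .
  qed
qed

section \<open>Probability of singular pairs\<close>

text \<open>All normalized real eigenfunctions are included, not only those of one basis, so any
  real eigenbasis may be chosen later.\<close>

definition centre_localized :: "real \<Rightarrow> nat set \<Rightarrow> (config \<Rightarrow> real) \<Rightarrow> config set \<Rightarrow> real \<Rightarrow> real \<Rightarrow> bool" where
  "centre_localized \<tau> S W X L m \<longleftrightarrow> (\<forall>f e. sol S X W e X f \<and> (\<Sum>y\<in>X. f y * f y) = 1 \<longrightarrow>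
     (\<exists>z\<in>X. \<forall>y\<in>X. L powr \<tau> \<le> real (sdist S y z) \<longrightarrow> \<bar>f y\<bar> \<le> exp (- m * real (sdist S y z))))"

text \<open>The distances of \<open>y\<close> and \<open>z\<close> from the centre \<open>w\<close>
  add up to at least \<open>l\<close>. Each factor decays in its own distance up to an error
  \<open>l powr \<tau>\<close>, the range in which only the trivial bound one is known.\<close>

lemma centre_localized_imp_corr_loc:
  assumes S: "finite S" and X: "finite X" and m: "m > 0" and c: "centre_localized \<tau> S W X (real l) m"
  shows "corr_loc S W X l (exp (- m * (real l - 2 * real l powr \<tau>)))"
  unfolding corr_loc_def
proof (intro allI impI ballI)
  fix f e y z assume f: "sol S X W e X f \<and> (\<Sum>y\<in>X. f y * f y) = 1" and yz: "y \<in> X" "z \<in> X" "l \<le> sdist S y z"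
  let ?x = "real l powr \<tau>"
  obtain w where w: "w \<in> X" "\<And>y. y \<in> X \<Longrightarrow> ?x \<le> real (sdist S y w) \<Longrightarrow> \<bar>f y\<bar> \<le> exp (- m * real (sdist S y w))"
    using c f unfolding centre_localized_def by blast
  have le1: "\<bar>f u\<bar> \<le> 1" if "u \<in> X" for u
  proof -
    have "f u * f u \<le> (\<Sum>y\<in>X. f y * f y)" using that X by (intro member_le_sum) auto
    hence "(f u)\<^sup>2 \<le> 1" using f by (simp add: power2_eq_square)
    thus ?thesis by (simp add: abs_square_le_1)
  qed
  define d1 where "d1 = real (sdist S y w)"
  define d2 where "d2 = real (sdist S z w)"
  have "sdist S y z \<le> sdist S y w + sdist S z w" using sdist_triangle[OF S, of y z w] sdist_sym[of S z w] by simp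
  hence d: "real l \<le> d1 + d2" unfolding d1_def d2_def using yz(3) by linarith
  have x0: "?x \<ge> 0" by simp
  have b1: "\<bar>f y\<bar> \<le> exp (- m * (d1 - ?x))"
  proof (cases "?x \<le> d1")
    case True
    hence "\<bar>f y\<bar> \<le> exp (- m * d1)" using w(2)[OF yz(1)] unfolding d1_def by simp
    also have "\<dots> \<le> exp (- m * (d1 - ?x))" using m x0 by (simp add: algebra_simps)
    finally show ?thesis .
  next
    case False
    hence "m * (d1 - ?x) \<le> 0" using m by (intro mult_nonneg_nonpos) auto
    hence "1 \<le> exp (- m * (d1 - ?x))" by simp
    thus ?thesis using le1[OF yz(1)] by linarith
  qed
  have b2: "\<bar>f z\<bar> \<le> exp (- m * (d2 - ?x))"
  proof (cases "?x \<le> d2")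
    case True
    hence "\<bar>f z\<bar> \<le> exp (- m * d2)" using w(2)[OF yz(2)] unfolding d2_def by simp
    also have "\<dots> \<le> exp (- m * (d2 - ?x))" using m x0 by (simp add: algebra_simps)
    finally show ?thesis .
  next
    case False
    hence "m * (d2 - ?x) \<le> 0" using m by (intro mult_nonneg_nonpos) auto
    hence "1 \<le> exp (- m * (d2 - ?x))" by simp
    thus ?thesis using le1[OF yz(2)] by linarith
  qed
  have "\<bar>f y * f z\<bar> \<le> exp (- m * (d1 - ?x)) * exp (- m * (d2 - ?x))"
    unfolding abs_mult using b1 b2 by (intro mult_mono) auto
  also have "\<dots> = exp (- m * (d1 + d2 - 2 * ?x))" by (simp add: mult_exp_exp algebra_simps)
  also have "\<dots> \<le> exp (- m * (real l - 2 * ?x))" using d m by (simp add: mult_left_mono)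
  finally show "\<bar>f y * f z\<bar> \<le> exp (- m * (real l - 2 * ?x))" .
qed

text \<open>A separated subset of maximal cardinality is a net.\<close>

lemma separated_net:
  assumes S: "finite S" and X: "finite X"
  obtains Z where "Z \<subseteq> X" "\<And>z w. z \<in> Z \<Longrightarrow> w \<in> Z \<Longrightarrow> z \<noteq> w \<Longrightarrow> \<not> near S k z w"
    "\<And>x. x \<in> X \<Longrightarrow> \<exists>z\<in>Z. sdist S x z \<le> k"
proof -
  define F where "F = {Z. Z \<subseteq> X \<and> (\<forall>z\<in>Z. \<forall>w\<in>Z. z \<noteq> w \<longrightarrow> \<not> near S k z w)}"
  have "finite F" unfolding F_def using X by (auto intro: finite_subset[of _ "Pow X"])
  moreover have "F \<noteq> {}" unfolding F_def by blast
  ultimately obtain Z where Z: "Z \<in> F" "\<And>Z'. Z' \<in> F \<Longrightarrow> card Z' \<le> card Z" using ex_argmax[of F card] by blast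
  have ZX: "Z \<subseteq> X" "finite Z" using Z(1) X unfolding F_def by (auto intro: finite_subset)
  show ?thesis
  proof (rule that[OF ZX(1)])
    show "\<not> near S k z w" if "z \<in> Z" "w \<in> Z" "z \<noteq> w" for z w using Z(1) that unfolding F_def by blast
    fix x assume x: "x \<in> X"
    show "\<exists>z\<in>Z. sdist S x z \<le> k"
    proof (rule ccontr)
      assume no: "\<not> ?thesis"
      hence far: "\<not> near S k x z" "\<not> near S k z x" if "z \<in> Z" for z
        using near_iff_sdist[OF S] that sdist_sym by metis+
      have xZ: "x \<notin> Z" using far(1)[of x] near_refl[OF S] by blast
      have "insert x Z \<in> F" using Z(1) x far unfolding F_def by auto
      hence "card (insert x Z) \<le> card Z" by (rule Z(2))
      thus False using xZ ZX(2) by simp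
    qed
  qed
qed

context anderson
begin

text \<open>An outer probability: the localization events need not be shown to be measurable.\<close>

definition small :: "(int \<Rightarrow> real) set \<Rightarrow> real \<Rightarrow> bool" where
  "small A c \<longleftrightarrow> (\<exists>B\<in>sets borel. A \<subseteq> B \<and> measure \<mu> B \<le> c)"

lemma small_mono: "small A c \<Longrightarrow> A' \<subseteq> A \<Longrightarrow> c \<le> c' \<Longrightarrow> small A' c'"
  unfolding small_def by (meson order_trans)

lemma small_measure: "A \<in> sets borel \<Longrightarrow> measure \<mu> A \<le> c \<Longrightarrow> small A c"
  unfolding small_def by blast

lemma small_Un: "small A c \<Longrightarrow> small B d \<Longrightarrow> small (A \<union> B) (c + d)"
proof -
  assume "small A c" "small B d"
  then obtain A' B' where ab: "A' \<in> sets borel" "A \<subseteq> A'" "measure \<mu> A' \<le> c" "B' \<in> sets borel" "B \<subseteq> B'" "measure \<mu> B' \<le> d"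
    unfolding small_def by blast
  have "measure \<mu> (A' \<union> B') \<le> measure \<mu> A' + measure \<mu> B'" using ab by (intro measure_Un_le) auto
  thus ?thesis unfolding small_def using ab by (intro bexI[of _ "A' \<union> B'"]) auto
qed

lemma small_UN:
  assumes I: "finite I" and A: "\<And>i. i \<in> I \<Longrightarrow> small (A i) c"
  shows "small (\<Union>i\<in>I. A i) (real (card I) * c)"
  using assms
proof (induction I rule: finite_induct)
  case empty
  show ?case by (auto intro!: small_measure)
next
  case (insert i I)
  have "small (A i \<union> (\<Union>i\<in>I. A i)) (c + real (card I) * c)" using insert by (intro small_Un) auto
  thus ?case using insert.hyps by (simp add: algebra_simps)
qed

lemma small_borel: "small A c \<Longrightarrow> A \<in> sets borel \<Longrightarrow> measure \<mu> A \<le> c"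
  unfolding small_def using mu.finite_measure_mono by (metis order_trans sets_mu)

definition sing_pair :: "(int \<Rightarrow> real) \<Rightarrow> real \<Rightarrow> nat set \<Rightarrow> real \<Rightarrow> config set \<Rightarrow> nat \<Rightarrow> config \<Rightarrow> config \<Rightarrow> (int \<Rightarrow> real) set" where
  "sing_pair U M S lam Om l x y = {v. \<exists>E. sing S Om (energy lam v U S) E l x (growth M l) \<and> sing S Om (energy lam v U S) E l y (growth M l)}"

definition pair_estimate :: "(int \<Rightarrow> real) \<Rightarrow> real \<Rightarrow> real \<Rightarrow> nat set \<Rightarrow> real \<Rightarrow> nat \<Rightarrow> bool" where
  "pair_estimate U M P S lam l \<longleftrightarrow> (\<forall>lo hi x y. x \<in> region S lo hi \<longrightarrow> y \<in> region S lo hi \<longrightarrow>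
     \<not> near S ((8 * card S + 2) * l) x y \<longrightarrow> measure \<mu> (sing_pair U M S lam (region S lo hi) l x y) \<le> real l powr - P)"

text \<open>Regions inside a ball, rather than balls, because the factors produced by
  \<open>split_not_sing\<close> have this form.\<close>

definition scale_localized :: "(int \<Rightarrow> real) \<Rightarrow> real \<Rightarrow> real \<Rightarrow> real \<Rightarrow> nat set \<Rightarrow> real \<Rightarrow> nat \<Rightarrow> bool" where
  "scale_localized U \<tau> m p S lam l \<longleftrightarrow> (\<forall>lo hi a. region S lo hi \<subseteq> sball S l a \<longrightarrow>
     small {v. \<not> centre_localized \<tau> S (energy lam v U S) (region S lo hi) (real l) m} (real l powr - p))"

text \<open>All pairs of radii occur because \<open>scale_step_not_sing\<close> needs non-resonance
  of every concentric ball. The factor two arises from two eigenvalues that are each within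
  \<open>res_width l\<close> of one energy.\<close>

definition resonant :: "(int \<Rightarrow> real) \<Rightarrow> nat set \<Rightarrow> real \<Rightarrow> config set \<Rightarrow> nat \<Rightarrow> config \<Rightarrow> config \<Rightarrow> (int \<Rightarrow> real) set" where
  "resonant U S lam Om l x y = {v. \<exists>r1\<le>l. \<exists>r2\<le>l. \<exists>e\<in>spec S (energy lam v U S) (sball S r1 x \<inter> Om).
     \<exists>e'\<in>spec S (energy lam v U S) (sball S r2 y \<inter> Om). \<bar>e - e'\<bar> \<le> 2 * res_width l}"

lemma region_confs: "region S lo hi \<subseteq> confs S" unfolding region_def by auto

lemma sing_pair_event_borel: "finite S \<Longrightarrow> sing_pair U M S lam (region S lo hi) l x y \<in> sets borel"
  unfolding sing_pair_def by (rule sing_pair_borel[OF _ region_confs])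

lemma resonant_small:
  assumes S: "finite S" and a: "a \<ge> 0"
  shows "\<forall>\<^sub>F l in sequentially. \<forall>lam\<ge>1. \<forall>Om x y. \<not> near S ((8 * card S + 2) * l) x y \<longrightarrow>
     small (resonant U S lam Om l x y) (real l powr - a)"
  using wegner_asymp[OF a, of "card S"] eventually_ge_at_top[of "1::nat"]
proof eventually_elim
  case (elim l)
  show ?case
  proof (intro allI impI)
    fix lam :: real and Om x y assume lam: "1 \<le> lam" and far: "\<not> near S ((8 * card S + 2) * l) x y"
    let ?A = "\<lambda>(r1, r2). {v. \<exists>e\<in>spec S (energy lam v U S) (sball S r1 x \<inter> Om).
       \<exists>e'\<in>spec S (energy lam v U S) (sball S r2 y \<inter> Om). \<bar>e - e'\<bar> \<le> 2 * res_width l}"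
    let ?w = "wbound (card S) l (real l powr - (a + 5)) (2 * res_width l)"
    have f: "finite (sball S r z \<inter> Om)" for r z using sball_finite_card(1)[OF S] by blast
    have "small (?A i) ?w" if "i \<in> {..l} \<times> {..l}" for i
    proof -
      obtain r1 r2 where i: "i = (r1, r2)" "r1 \<le> l" "r2 \<le> l" using \<open>i \<in> _\<close> by auto
      show ?thesis unfolding i(1) prod.case
        using res_width_pos[of l] elim(2)
        by (intro small_measure spec_close_borel[OF S f f] wegner_two_volume[OF S far i(2,3) lam]) auto
    qed
    hence su: "small (\<Union>i\<in>{..l} \<times> {..l}. ?A i) (real (card ({..l} \<times> {..l})) * ?w)" by (intro small_UN) auto
    have sub: "resonant U S lam Om l x y \<subseteq> (\<Union>i\<in>{..l} \<times> {..l}. ?A i)"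
    proof
      fix v assume "v \<in> resonant U S lam Om l x y"
      then obtain r1 r2 where "r1 \<le> l" "r2 \<le> l" "v \<in> ?A (r1, r2)" unfolding resonant_def by auto
      thus "v \<in> (\<Union>i\<in>{..l} \<times> {..l}. ?A i)" by blast
    qed
    have "real (card ({..l} \<times> {..l})) = (real l + 1)\<^sup>2"
      by (simp add: card_cartesian_product power2_eq_square algebra_simps)
    hence "real (card ({..l} \<times> {..l})) * ?w \<le> real l powr - a" using elim(1) by (simp only:)
    thus "small (resonant U S lam Om l x y) (real l powr - a)" by (rule small_mono[OF su sub])
  qed
qed

text \<open>The number \<open>\<eta>\<close> is chosen so that each hop gains
  \<open>exp (- (2 * M))\<close> when the diagonal is at distance \<open>\<eta>\<close> from the
  energy. Two balls singular at one energy then have diagonal entries within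
  \<open>2 * \<eta>\<close> of each other, which large disorder makes unlikely.\<close>

lemma start_scale:
  assumes S: "finite S" "S \<noteq> {}" and M: "M > 0"
  shows "\<forall>\<^sub>F l in sequentially. \<forall>\<^sub>F lam in at_top. pair_estimate U M P S lam l"
proof -
  define \<eta> where "\<eta> = 2 * real (card S) * exp (2 * M)"
  have cS: "real (card S) \<ge> 1" using S by (simp add: Suc_le_eq card_gt_0_iff)
  have eta: "\<eta> > 0" unfolding \<eta>_def using cS by (intro mult_pos_pos) auto
  show ?thesis using start_asymp[of "card S" P "2 * \<eta>"] eventually_ge_at_top[of "1::nat"]
  proof eventually_elim
    case (elim l)
    have l: "real l \<ge> 1" using elim(2) by simp
    from elim(1) eventually_gt_at_top[of "0::real"] show ?case
    proof eventually_elim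
      case (elim lam)
      show ?case unfolding pair_estimate_def
      proof (intro allI impI)
        fix lo hi x y assume x: "x \<in> region S lo hi" and y: "y \<in> region S lo hi" and far: "\<not> near S ((8 * card S + 2) * l) x y"
        let ?Om = "region S lo hi"
        let ?D = "{v. \<exists>u\<in>sball S l x \<inter> ?Om. \<exists>w\<in>sball S l y \<inter> ?Om. \<bar>energy lam v U S u - energy lam v U S w\<bar> \<le> 2 * \<eta>}"
        \<comment> \<open>Since \<open>growth M l\<close> is at most \<open>exp (2 * M * l)\<close>,
          the \<open>l + 1\<close> hops from the centre to the outer sphere suffice.\<close>
        have Qb: "exp (- (2 * M)) ^ (l + 1) * growth M l < 1"
        proof -
          have "real l powr (-1/4) \<le> real l powr 0" using l by (intro powr_mono) auto
          hence "real l powr (-1/4) \<le> 1" using l by simp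
          hence "M * (1 + real l powr (-1/4)) * real l \<le> M * 2 * real l"
            using M by (intro mult_right_mono mult_left_mono) auto
          moreover have "exp (- (2 * M)) ^ (l + 1) = exp (real (l + 1) * (- (2 * M)))" by (rule exp_of_nat_mult[symmetric])
          ultimately have "exp (- (2 * M)) ^ (l + 1) * growth M l \<le> exp (real (l + 1) * (- (2 * M)) + M * 2 * real l)"
            unfolding growth_def by (simp add: mult_exp_exp)
          also have "\<dots> < 1" using M by (simp add: algebra_simps)
          finally show ?thesis .
        qed
        have ns: "\<exists>u\<in>sball S l z \<inter> ?Om. \<bar>energy lam v U S u - E\<bar> < \<eta>"
          if "z \<in> ?Om" "sing S ?Om (energy lam v U S) E l z (growth M l)" for z v E
        proof (rule ccontr)
          assume "\<not> ?thesis"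
          hence "\<not> sing S ?Om (energy lam v U S) E l z (growth M l)"
            using that(1) eta M Qb growth_pos[of M l] cS
            by (intro far_diagonal_not_sing[OF S(1) region_confs, where \<eta> = \<eta> and \<theta> = "exp (- (2 * M))"])
               (auto simp: \<eta>_def exp_minus field_simps not_less)
          thus False using that(2) by simp
        qed
        have "sing_pair U M S lam ?Om l x y \<subseteq> ?D"
        proof
          fix v assume "v \<in> sing_pair U M S lam ?Om l x y"
          then obtain E where E: "sing S ?Om (energy lam v U S) E l x (growth M l)" "sing S ?Om (energy lam v U S) E l y (growth M l)"
            unfolding sing_pair_def by blast
          obtain u w where uw: "u \<in> sball S l x \<inter> ?Om" "\<bar>energy lam v U S u - E\<bar> < \<eta>"
            "w \<in> sball S l y \<inter> ?Om" "\<bar>energy lam v U S w - E\<bar> < \<eta>" using ns[OF x E(1)] ns[OF y E(2)] by blast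
          have "\<bar>energy lam v U S u - energy lam v U S w\<bar> \<le> 2 * \<eta>" using uw(2,4) by linarith
          thus "v \<in> ?D" using uw(1,3) by blast
        qed
        hence "measure \<mu> (sing_pair U M S lam ?Om l x y) \<le> measure \<mu> ?D"
          using diagonal_two_volume(1)[OF S(1) far elim(2), of 1 "2 * \<eta>"] eta by (intro mu.finite_measure_mono) auto
        also have "\<dots> \<le> wbound (card S) l (real l powr - (P + 3)) (2 * \<eta> / lam)"
          using eta l elim(2) by (intro diagonal_two_volume(2)[OF S(1) far]) auto
        also have "\<dots> \<le> real l powr - P" by (rule elim(1))
        finally show "measure \<mu> (sing_pair U M S lam ?Om l x y) \<le> real l powr - P" .
      qed
    qed
  qed
qed

definition split_bad :: "(int \<Rightarrow> real) \<Rightarrow> real \<Rightarrow> nat set \<Rightarrow> real \<Rightarrow> config set \<Rightarrow> nat \<Rightarrow> config \<Rightarrow> (int \<Rightarrow> real) set" where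
  "split_bad U M S lam Om l z = {v. \<exists>E. (\<forall>e\<in>spec S (energy lam v U S) (sball S l z \<inter> Om). \<bar>e - E\<bar> \<ge> res_width l) \<and>
      sing S Om (energy lam v U S) E l z (growth M l)}"

text \<open>Once both groups are localized, \<open>split_not_sing\<close> rules out singularity at
  all non-resonant energies simultaneously. The event therefore lies in the union of two failures of
  localization, whence the factor two.\<close>

lemma split_bad_small:
  assumes S: "finite S" and M: "M > 0" and \<tau>: "\<tau> < 1" and U: "finite {u. U u \<noteq> 0}"
  shows "\<forall>\<^sub>F l in sequentially. \<forall>lam. (\<forall>J. J \<subset> S \<longrightarrow> J \<noteq> {} \<longrightarrow> scale_localized U \<tau> (4 * M) p J lam l) \<longrightarrow>
     (\<forall>lo hi z t. z \<in> region S lo hi \<longrightarrow> split_at S l z t \<longrightarrow>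
        small (split_bad U M S lam (region S lo hi) l z) (2 * real l powr - p))"
proof -
  \<comment> \<open>A crude bound for the range of the interaction; the remaining gap
    \<open>2 * l\<close> exceeds it for large \<open>l\<close>.\<close>
  define r0 where "r0 = (\<Sum>u\<in>{u. U u \<noteq> 0}. nat \<bar>u\<bar>)"
  have r0: "U u = 0" if "\<bar>u\<bar> > int r0" for u
  proof (rule ccontr)
    assume "U u \<noteq> 0"
    hence "nat \<bar>u\<bar> \<le> r0" unfolding r0_def using U by (intro member_le_sum) auto
    thus False using that by linarith
  qed
  show ?thesis
    using split_asymp[OF M \<tau>, of "card S"] eventually_ge_at_top[of "r0 + 1"]
  proof eventually_elim
    case (elim l)
    have l: "l \<ge> 1" "int r0 < 2 * int l" using elim(2) by auto
    show ?case
    proof (intro allI impI)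
      fix lam lo hi z t
      assume loc: "\<forall>J. J \<subset> S \<longrightarrow> J \<noteq> {} \<longrightarrow> scale_localized U \<tau> (4 * M) p J lam l"
        and z: "z \<in> region S lo hi" and sp: "split_at S l z t"
      define J where "J = {j \<in> S. z j \<le> t}"
      define K where "K = S - J"
      have JK: "finite J" "finite K" "J \<inter> K = {}" "J \<union> K = S" unfolding J_def K_def using S by auto
      have prp: "J \<subset> S" "J \<noteq> {}" "K \<subset> S" "K \<noteq> {}"
      proof -
        obtain i j where "i \<in> J" "j \<in> K" using sp unfolding split_at_def J_def K_def by force
        thus "J \<subset> S" "J \<noteq> {}" "K \<subset> S" "K \<noteq> {}" unfolding K_def J_def by blast+
      qed
      have zJ: "\<And>j. j \<in> J \<Longrightarrow> z j \<le> t" unfolding J_def by auto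
      have zK: "\<And>j. j \<in> K \<Longrightarrow> t + 4 * int l \<le> z j" using sp unfolding split_at_def J_def K_def by auto
      have z': "z \<in> region (J \<union> K) lo hi" using z JK(4) by simp
      have U0: "\<And>u. \<bar>u\<bar> \<ge> 2 * int l \<Longrightarrow> U u = 0" using r0 l by auto
      obtain lo1 hi1 lo2 hi2 where
        s1: "region J lo1 hi1 \<subseteq> sball J l (restr J z)" and s2: "region K lo2 hi2 \<subseteq> sball K l (restr K z)" and
        ns: "\<And>lam v E \<epsilon> \<delta> Q. \<epsilon> > 0 \<Longrightarrow> Q \<ge> 0 \<Longrightarrow> \<delta> \<ge> 0 \<Longrightarrow>
          corr_loc J (energy lam v U J) (region J lo1 hi1) l \<delta> \<Longrightarrow>
          corr_loc K (energy lam v U K) (region K lo2 hi2) l \<delta> \<Longrightarrow>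
          (\<And>e. e \<in> spec (J \<union> K) (energy lam v U (J \<union> K)) (sball (J \<union> K) l z \<inter> region (J \<union> K) lo hi)
             \<Longrightarrow> \<bar>e - E\<bar> \<ge> \<epsilon>) \<Longrightarrow>
          (real (card (sball (J \<union> K) l z)))\<^sup>2 * (2 * real (card (J \<union> K))) * \<delta> / \<epsilon> * Q < 1 \<Longrightarrow>
          \<not> sing (J \<union> K) (region (J \<union> K) lo hi) (energy lam v U (J \<union> K)) E l z Q"
        by (rule split_not_sing[where U = U, OF JK(1-3) z' zJ zK l(1) U0]) blast+
      let ?A = "{v. \<not> centre_localized \<tau> J (energy lam v U J) (region J lo1 hi1) (real l) (4 * M)}"
      let ?B = "{v. \<not> centre_localized \<tau> K (energy lam v U K) (region K lo2 hi2) (real l) (4 * M)}"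
      have "small ?A (real l powr - p)" "small ?B (real l powr - p)"
        using loc prp s1 s2 unfolding scale_localized_def by blast+
      hence "small (?A \<union> ?B) (real l powr - p + real l powr - p)" by (rule small_Un)
      moreover have "split_bad U M S lam (region S lo hi) l z \<subseteq> ?A \<union> ?B"
      proof (rule subsetI, rule ccontr)
        fix v assume v: "v \<in> split_bad U M S lam (region S lo hi) l z" and no: "v \<notin> ?A \<union> ?B"
        obtain E where E: "\<forall>e\<in>spec S (energy lam v U S) (sball S l z \<inter> region S lo hi). \<bar>e - E\<bar> \<ge> res_width l"
          "sing S (region S lo hi) (energy lam v U S) E l z (growth M l)" using v unfolding split_bad_def by blast
        let ?d = "exp (- (4 * M) * (real l - 2 * real l powr \<tau>))"
        have f: "finite (region J lo1 hi1)" "finite (region K lo2 hi2)"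
          using finite_subset[OF s1 sball_finite_card(1)[OF JK(1)]] finite_subset[OF s2 sball_finite_card(1)[OF JK(2)]] by auto
        have c: "corr_loc J (energy lam v U J) (region J lo1 hi1) l ?d"
          by (rule centre_localized_imp_corr_loc[OF JK(1) f(1)]) (use no M in auto)
        have c': "corr_loc K (energy lam v U K) (region K lo2 hi2) l ?d"
          by (rule centre_localized_imp_corr_loc[OF JK(2) f(2)]) (use no M in auto)
        have "(real (card (sball S l z)))\<^sup>2 * (2 * real (card S)) * ?d / res_width l * growth M l
           \<le> (real ((card S * (2 * l + 1)) ^ card S))\<^sup>2 * (2 * real (card S)) * ?d / res_width l * growth M l"
          using sball_finite_card(2)[OF S, of l z] res_width_pos[of l] growth_pos[of M l]
          by (intro mult_right_mono divide_right_mono power_mono of_nat_mono) auto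
        hence "(real (card (sball S l z)))\<^sup>2 * (2 * real (card S)) * ?d / res_width l * growth M l < 1" using elim(1) by linarith
        hence "\<not> sing S (region S lo hi) (energy lam v U S) E l z (growth M l)"
          using ns[of "res_width l" "growth M l" ?d lam v E, OF res_width_pos _ _ c c']
            E(1) growth_pos[of M l] unfolding JK(4) by auto
        thus False using E(2) by simp
      qed
      ultimately show "small (split_bad U M S lam (region S lo hi) l z) (2 * real l powr - p)"
        by (auto elim: small_mono)
    qed
  qed
qed

text \<open>Among seven separated singular centres at least six are not split, and these form three
  independent pairs.\<close>

definition many_sing :: "(int \<Rightarrow> real) \<Rightarrow> real \<Rightarrow> nat set \<Rightarrow> real \<Rightarrow> config set \<Rightarrow> nat \<Rightarrow> config set \<Rightarrow> (int \<Rightarrow> real) set" where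
  "many_sing U M S lam Om l B = {v. \<exists>E Z. Z \<subseteq> B \<and> card Z = 7 \<and>
      (\<forall>z\<in>Z. \<forall>w\<in>Z. z \<noteq> w \<longrightarrow> \<not> near S ((8 * card S + 2) * l) z w) \<and>
      (\<forall>z\<in>Z. sing S Om (energy lam v U S) E l z (growth M l))}"

text \<open>The terms count pairs of centres that resonate, split centres that are singular without
  resonance, and sixfold choices for three independent pairs. Outside the first two events, two
  split centres would both have an eigenvalue close to the common energy and hence resonate with
  each other, so there is at most one.\<close>

lemma many_sing_small:
  assumes S: "finite S" and l: "l \<ge> 1" and B: "finite B" "B \<subseteq> region S lo hi"
    and ps: "pair_estimate U M P S lam l"
    and res: "\<And>x y. \<not> near S ((8 * card S + 2) * l) x y \<Longrightarrow> small (resonant U S lam (region S lo hi) l x y) c1"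
    and spl: "\<And>z t. z \<in> region S lo hi \<Longrightarrow> split_at S l z t \<Longrightarrow> small (split_bad U M S lam (region S lo hi) l z) c2"
    and c: "c1 \<ge> 0" "c2 \<ge> 0"
  shows "small (many_sing U M S lam (region S lo hi) l B)
     ((real (card B))\<^sup>2 * c1 + real (card B) * c2 + real (card B) ^ 6 * (real l powr - P) ^ 3)"
proof -
  let ?Om = "region S lo hi" and ?K = "(8 * card S + 2) * l"
  define A1 where "A1 = (\<Union>p\<in>{p \<in> B \<times> B. \<not> near S ?K (fst p) (snd p)}. resonant U S lam ?Om l (fst p) (snd p))"
  define A2 where "A2 = (\<Union>z\<in>{z \<in> B. \<exists>t. split_at S l z t}. split_bad U M S lam ?Om l z)"
  define G where "G = {g \<in> PiE {..<6::nat} (\<lambda>_. B). (\<forall>i<6. \<forall>t. \<not> split_at S l (g i) t) \<and>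
      (\<forall>i<6. \<forall>j<6. i \<noteq> j \<longrightarrow> \<not> near S ?K (g i) (g j))}"
  define A3 where "A3 = (\<Union>g\<in>G. {v. \<forall>k\<in>{..<3::nat}. v \<in> sing_pair U M S lam ?Om l (g (2 * k)) (g (2 * k + 1))})"
  have "small A1 (real (card {p \<in> B \<times> B. \<not> near S ?K (fst p) (snd p)}) * c1)"
    unfolding A1_def using B(1) by (intro small_UN res) auto
  moreover have "card {p \<in> B \<times> B. \<not> near S ?K (fst p) (snd p)} \<le> card (B \<times> B)" using B by (intro card_mono) auto
  ultimately have a1: "small A1 ((real (card B))\<^sup>2 * c1)"
    using c(1) by (elim small_mono) (auto simp: card_cartesian_product power2_eq_square intro!: mult_right_mono simp flip: of_nat_mult)
  have "small A2 (real (card {z \<in> B. \<exists>t. split_at S l z t}) * c2)"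
    unfolding A2_def using B spl by (intro small_UN) auto
  moreover have "card {z \<in> B. \<exists>t. split_at S l z t} \<le> card B" using B by (intro card_mono) auto
  ultimately have a2: "small A2 (real (card B) * c2)" using c(2) by (elim small_mono) (auto intro!: mult_right_mono)
  have fG: "finite G" unfolding G_def using B by (auto intro!: finite_PiE)
  have cG: "card G \<le> card B ^ 6"
  proof -
    have "card G \<le> card (PiE {..<6::nat} (\<lambda>_. B))" unfolding G_def using B by (intro card_mono finite_PiE) auto
    thus ?thesis by (simp add: card_PiE)
  qed
  have g3: "small {v. \<forall>k\<in>{..<3::nat}. v \<in> sing_pair U M S lam ?Om l (g (2 * k)) (g (2 * k + 1))} ((real l powr - P) ^ 3)" if g: "g \<in> G" for g
  proof -
    let ?s = "\<lambda>k. sing_pair U M S lam ?Om l (g (2 * k)) (g (2 * k + 1))"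
    let ?I = "\<lambda>k. sites S l (g (2 * k)) \<union> sites S l (g (2 * k + 1))"
    have ns: "\<not> split_at S l (g i) t" if "i < 6" for i t using g that unfolding G_def by blast
    have far: "\<not> near S ?K (g i) (g j)" if "i < 6" "j < 6" "i \<noteq> j" for i j using g that unfolding G_def by blast
    have gB: "g i \<in> ?Om" if "i < 6" for i using g that B(2) unfolding G_def by (auto simp: PiE_iff)
    \<comment> \<open>Balls around separated unsplit centres use disjoint sets of sites, which makes
      the three pairs independent.\<close>
    have dj: "sites S l (g i) \<inter> sites S l (g j) = {}" if "i < 6" "j < 6" "i \<noteq> j" for i j
      using ns far that l by (intro unsplit_far_disjoint[OF S]) auto
    have "measure \<mu> {v. \<forall>k\<in>{..<3::nat}. v \<in> ?s k} = (\<Prod>k\<in>{..<3::nat}. measure \<mu> {v. v \<in> ?s k})"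
    proof (rule indep_events[where K = ?I])
      show "disjoint_family_on ?I {..<3::nat}"
        unfolding disjoint_family_on_def
      proof (intro ballI impI)
        fix k k' :: nat assume k: "k \<in> {..<3}" "k' \<in> {..<3}" "k \<noteq> k'"
        have ne: "2 * k \<noteq> 2 * k' + 1" "2 * k + 1 \<noteq> 2 * k'" by presburger+
        show "?I k \<inter> ?I k' = {}"
          using k ne dj[of "2 * k" "2 * k'"] dj[of "2 * k" "2 * k' + 1"] dj[of "2 * k + 1" "2 * k'"] dj[of "2 * k + 1" "2 * k' + 1"]
          by auto
      qed
      show "finite (?I k)" for k using finite_sites[OF S] by auto
      show "{v. v \<in> ?s k} \<in> sets borel" for k using sing_pair_event_borel[OF S] by simp
      show "depends (?I k) (\<lambda>v. v \<in> ?s k)" for k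
        unfolding depends_def
      proof (intro allI impI)
        fix v w :: "int \<Rightarrow> real" assume vw: "\<forall>u\<in>?I k. v u = w u"
        have "sing S ?Om (energy lam v U S) E l (g (2 * k)) Q = sing S ?Om (energy lam w U S) E l (g (2 * k)) Q"
          "sing S ?Om (energy lam v U S) E l (g (2 * k + 1)) Q = sing S ?Om (energy lam w U S) E l (g (2 * k + 1)) Q" for E Q
          using vw by (auto intro!: sing_cong[OF S])
        thus "(v \<in> ?s k) = (w \<in> ?s k)" unfolding sing_pair_def by simp
      qed
    qed (auto simp: lessThan_empty_iff)
    also have "\<dots> \<le> (\<Prod>k\<in>{..<3::nat}. real l powr - P)"
    proof (rule prod_mono, intro conjI)
      fix k :: nat assume "k \<in> {..<3}"
      hence k: "2 * k < 6" "2 * k + 1 < 6" by auto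
      show "measure \<mu> {v. v \<in> ?s k} \<le> real l powr - P"
        using ps gB[OF k(1)] gB[OF k(2)] far[OF k] unfolding pair_estimate_def by simp
    qed simp
    finally have m: "measure \<mu> {v. \<forall>k\<in>{..<3::nat}. v \<in> ?s k} \<le> (real l powr - P) ^ 3" by simp
    have "{v. \<forall>k\<in>{..<3::nat}. v \<in> ?s k} = (\<Inter>k\<in>{..<3::nat}. ?s k)" by auto
    hence "{v. \<forall>k\<in>{..<3::nat}. v \<in> ?s k} \<in> sets borel" using sing_pair_event_borel[OF S] by (auto intro!: sets.finite_INT simp: lessThan_empty_iff)
    thus ?thesis using m by (rule small_measure)
  qed
  have "small A3 (real (card G) * (real l powr - P) ^ 3)" unfolding A3_def by (rule small_UN[OF fG g3])
  hence a3: "small A3 (real (card B) ^ 6 * (real l powr - P) ^ 3)"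
    using cG by (elim small_mono) (auto intro!: mult_right_mono simp flip: of_nat_power)
  have "many_sing U M S lam ?Om l B \<subseteq> A1 \<union> A2 \<union> A3"
  proof (rule subsetI, rule ccontr)
    fix v assume v: "v \<in> many_sing U M S lam ?Om l B" and no: "v \<notin> A1 \<union> A2 \<union> A3"
    obtain E Z where EZ: "Z \<subseteq> B \<and> card Z = 7 \<and> (\<forall>z\<in>Z. \<forall>w\<in>Z. z \<noteq> w \<longrightarrow> \<not> near S ?K z w) \<and>
      (\<forall>z\<in>Z. sing S ?Om (energy lam v U S) E l z (growth M l))"
      using v unfolding many_sing_def mem_Collect_eq by (elim exE)
    have Z: "Z \<subseteq> B" "card Z = 7" "\<And>z w. z \<in> Z \<Longrightarrow> w \<in> Z \<Longrightarrow> z \<noteq> w \<Longrightarrow> \<not> near S ?K z w"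
      "\<And>z. z \<in> Z \<Longrightarrow> sing S ?Om (energy lam v U S) E l z (growth M l)" using EZ by auto
    define Y where "Y = {z \<in> Z. \<exists>t. split_at S l z t}"
    have fZ: "finite Z" using Z(2) card.infinite by fastforce
    have reson: "\<exists>e\<in>spec S (energy lam v U S) (sball S l z \<inter> ?Om). \<bar>e - E\<bar> < res_width l" if "z \<in> Y" for z
    proof (rule ccontr)
      assume "\<not> ?thesis"
      hence "v \<in> split_bad U M S lam ?Om l z" unfolding split_bad_def using Z(4) that unfolding Y_def by force
      thus False using no that Z(1) unfolding A2_def Y_def by blast
    qed
    have one: "z = w" if zw: "z \<in> Y" "w \<in> Y" for z w
    proof (rule ccontr)
      assume ne: "z \<noteq> w"
      obtain e e' where e: "e \<in> spec S (energy lam v U S) (sball S l z \<inter> ?Om)" "\<bar>e - E\<bar> < res_width l"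
        "e' \<in> spec S (energy lam v U S) (sball S l w \<inter> ?Om)" "\<bar>e' - E\<bar> < res_width l" using reson zw by blast
      have "\<bar>e - e'\<bar> \<le> 2 * res_width l" using e(2,4) by linarith
      hence "v \<in> resonant U S lam ?Om l z w" unfolding resonant_def using e(1,3) by blast
      moreover have "(z, w) \<in> {p \<in> B \<times> B. \<not> near S ?K (fst p) (snd p)}" using zw Z(1,3) ne unfolding Y_def by auto
      ultimately show False using no unfolding A1_def by force
    qed
    have "card Y \<le> 1" using one fZ by (auto simp: card_le_Suc0_iff_eq Y_def)
    hence "6 \<le> card (Z - Y)" using Z(2) fZ by (subst card_Diff_subset) (auto simp: Y_def)
    then obtain T where T: "T \<subseteq> Z - Y" "card T = 6" by (meson obtain_subset_with_card_n)
    have "finite T" using T(2) card.infinite by fastforce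
    then obtain h where h: "bij_betw h {0..<6::nat} T" using ex_bij_betw_nat_finite[of T] T(2) by metis
    define g where "g = restrict h {..<6::nat}"
    have gT: "g i \<in> T" if "i < 6" for i using h that unfolding g_def bij_betw_def by auto
    have gi: "g i \<noteq> g j" if "i < 6" "j < 6" "i \<noteq> j" for i j
      using h that unfolding g_def bij_betw_def inj_on_def by auto
    have "g \<in> G" unfolding G_def
    proof (intro CollectI conjI allI impI)
      show "g \<in> PiE {..<6::nat} (\<lambda>_. B)" using gT T Z(1) unfolding g_def by (auto simp: PiE_iff)
      show "\<not> split_at S l (g i) t" if "i < 6" for i t using gT[OF that] T unfolding Y_def by auto
      show "\<not> near S ?K (g i) (g j)" if "i < 6" "j < 6" "i \<noteq> j" for i j
        using gT[OF that(1)] gT[OF that(2)] gi[OF that] T Z(3) by blast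
    qed
    moreover have "\<forall>k\<in>{..<3::nat}. v \<in> sing_pair U M S lam ?Om l (g (2 * k)) (g (2 * k + 1))"
    proof
      fix k :: nat assume "k \<in> {..<3}"
      hence "2 * k < 6" "2 * k + 1 < 6" by auto
      hence "g (2 * k) \<in> Z" "g (2 * k + 1) \<in> Z" using gT T by blast+
      thus "v \<in> sing_pair U M S lam ?Om l (g (2 * k)) (g (2 * k + 1))" unfolding sing_pair_def using Z(4) by blast
    qed
    ultimately show False using no unfolding A3_def by blast
  qed
  thus ?thesis using small_Un[OF small_Un[OF a1 a2] a3] small_mono by blast
qed

end

section \<open>Multiscale induction\<close>

context anderson
begin

text \<open>With \<open>N = card S\<close>, a ball of radius \<open>l * l\<close> contains at most
  \<open>l ^ (3 * N)\<close> centres, so three independent pairs contribute at most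
  \<open>l powr (18 * N - 3 * P)\<close>. For \<open>P \<ge> 18 * N + 1\<close> this is at most
  \<open>l powr - (2 * P + 1)\<close>, one power of \<open>l\<close> better than the target.\<close>

lemma scale_step:
  assumes S: "finite S" "S \<noteq> {}" and M: "M > 0" and \<tau>: "\<tau> < 1" and U: "finite {u. U u \<noteq> 0}"
    and P: "P \<ge> 18 * real (card S) + 1"
  shows "\<forall>\<^sub>F l in sequentially. \<forall>lam\<ge>1.
     (\<forall>J. J \<subset> S \<longrightarrow> J \<noteq> {} \<longrightarrow> scale_localized U \<tau> (4 * M) (2 * P + 3 * real (card S) + 2) J lam l) \<longrightarrow>
     pair_estimate U M P S lam l \<longrightarrow> pair_estimate U M P S lam (l * l)"
proof -
  define N where "N = card S"
  define K where "K = 8 * N + 2"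
  \<comment> \<open>The exponents \<open>p\<close> and \<open>a\<close> are such that at least the
    power \<open>2 * P + 1\<close> is left after counting \<open>l ^ (3 * N)\<close> centres or
    \<open>l ^ (6 * N)\<close> pairs.\<close>
  define p where "p = 2 * P + 3 * real N + 2"
  define a where "a = 2 * P + 6 * real N + 1"
  have P0: "P \<ge> 1" using P by simp
  have sq: "filterlim (\<lambda>l::nat. l * l) sequentially sequentially"
  proof (rule filterlim_at_top_mono[OF filterlim_ident])
    show "\<forall>\<^sub>F l::nat in sequentially. l \<le> l * l" by (rule always_eventually) auto
  qed
  have e1: "\<forall>\<^sub>F l in sequentially. \<forall>lam\<ge>1. \<forall>Om x y. \<not> near S ((8 * card S + 2) * (l * l)) x y \<longrightarrow>
     small (resonant U S lam Om (l * l) x y) (real (l * l) powr - (P + 1))"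
    using eventually_compose_filterlim[OF resonant_small[OF S(1), of "P + 1" U] sq] P0 by simp
  have e2: "\<forall>\<^sub>F l in sequentially. \<forall>lam\<ge>1. \<forall>Om x y. \<not> near S ((8 * card S + 2) * l) x y \<longrightarrow>
     small (resonant U S lam Om l x y) (real l powr - a)"
    using resonant_small[OF S(1), of a U] P0 unfolding a_def by simp
  show ?thesis
    using e1 e2 split_bad_small[OF S(1) M \<tau> U, of p] scale_asymp[OF M, of "12 * K + 7" N]
      ball_count_square_asymp[of N] eventually_ge_at_top[of "10::nat"]
  proof eventually_elim
    case (elim l)
    show ?case
    proof (intro allI impI)
      fix lam :: real
      assume lam: "1 \<le> lam" and loc: "\<forall>J. J \<subset> S \<longrightarrow> J \<noteq> {} \<longrightarrow> scale_localized U \<tau> (4 * M) (2 * P + 3 * real (card S) + 2) J lam l"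
        and ps: "pair_estimate U M P S lam l"
      let ?L = "l * l" and ?x = "real l"
      have x: "?x \<ge> 10" "l \<ge> 1" using elim(6) by auto
      show "pair_estimate U M P S lam ?L" unfolding pair_estimate_def
      proof (intro allI impI)
        fix lo hi x1 x2 assume x1: "x1 \<in> region S lo hi" and x2: "x2 \<in> region S lo hi"
          and far: "\<not> near S ((8 * card S + 2) * ?L) x1 x2"
        let ?Om = "region S lo hi"
        define B where "B = (\<lambda>z. sball S ?L z \<inter> ?Om)"
        have fB: "finite (B z)" for z unfolding B_def using sball_finite_card(1)[OF S(1)] by blast
        have cB: "real (card (B z)) \<le> ?x ^ (3 * N)" for z
        proof -
          have "card (B z) \<le> card (sball S ?L z)" unfolding B_def by (intro card_mono sball_finite_card(1)[OF S(1)]) auto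
          also have "\<dots> \<le> (N * (2 * ?L + 1)) ^ N" unfolding N_def by (rule sball_finite_card(2)[OF S(1)])
          finally have "real (card (B z)) \<le> real ((N * (2 * ?L + 1)) ^ N)" by (rule of_nat_mono)
          thus ?thesis using elim(5) by linarith
        qed
        \<comment> \<open>The four consists of one part for resonances, two for split balls and one
          for the independent pairs.\<close>
        define c3 where "c3 = 4 * ?x powr - (2 * P + 1)"
        have ev: "small (many_sing U M S lam ?Om l (B z)) c3" for z
        proof -
          have s: "small (many_sing U M S lam ?Om l (B z))
             ((real (card (B z)))\<^sup>2 * ?x powr - a + real (card (B z)) * (2 * ?x powr - p) + real (card (B z)) ^ 6 * (?x powr - P) ^ 3)"
          proof (rule many_sing_small[OF S(1) x(2) fB _ ps])
            show "small (resonant U S lam ?Om l x y) (?x powr - a)" if "\<not> near S ((8 * card S + 2) * l) x y" for x y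
              using elim(2) lam that by blast
            show "small (split_bad U M S lam ?Om l z) (2 * ?x powr - p)" if "z \<in> ?Om" "split_at S l z t" for z t
              using elim(3) loc that unfolding p_def N_def by blast
          qed (auto simp: B_def)
          have pw: "?x ^ k = ?x powr real k" for k using x by (simp add: powr_realpow)
          have "(real (card (B z)))\<^sup>2 * ?x powr - a \<le> (?x ^ (3 * N))\<^sup>2 * ?x powr - a"
            using cB by (intro mult_right_mono power_mono) auto
          also have "\<dots> = ?x ^ (6 * N) * ?x powr - a" by (simp add: power_mult[symmetric])
          also have "\<dots> = ?x powr - (2 * P + 1)" unfolding pw a_def by (simp add: powr_add[symmetric])
          finally have t1: "(real (card (B z)))\<^sup>2 * ?x powr - a \<le> ?x powr - (2 * P + 1)" .
          have "real (card (B z)) * (2 * ?x powr - p) \<le> ?x ^ (3 * N) * (2 * ?x powr - p)"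
            using cB by (intro mult_right_mono) auto
          also have "\<dots> = 2 * ?x powr - (2 * P + 2)" unfolding pw p_def by (simp add: powr_add[symmetric])
          also have "\<dots> \<le> 2 * ?x powr - (2 * P + 1)" using x by (intro mult_left_mono powr_mono) auto
          finally have t2: "real (card (B z)) * (2 * ?x powr - p) \<le> 2 * ?x powr - (2 * P + 1)" .
          have "real (card (B z)) ^ 6 * (?x powr - P) ^ 3 \<le> (?x ^ (3 * N)) ^ 6 * (?x powr - P) ^ 3"
            using cB by (intro mult_right_mono power_mono) auto
          also have "\<dots> = ?x powr (18 * real N - 3 * P)"
          proof -
            have "(?x powr - P) ^ 3 = ?x powr - (3 * P)" using x by (simp add: powr_power)
            moreover have "(?x ^ (3 * N)) ^ 6 = ?x ^ (18 * N)" by (simp add: power_mult[symmetric])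
            ultimately show ?thesis unfolding pw by (simp add: powr_add[symmetric])
          qed
          also have "\<dots> \<le> ?x powr - (2 * P + 1)" using x P unfolding N_def by (intro powr_mono) auto
          finally have t3: "real (card (B z)) ^ 6 * (?x powr - P) ^ 3 \<le> ?x powr - (2 * P + 1)" .
          show ?thesis by (rule small_mono[OF s order_refl]) (use t1 t2 t3 in \<open>auto simp: c3_def\<close>)
        qed
        have det: "\<not> sing S ?Om (energy lam v U S) E ?L z (growth M ?L)"
          if z: "z \<in> ?Om" and nv: "v \<notin> many_sing U M S lam ?Om l (B z)"
            and nr: "\<And>r e. r \<le> ?L \<Longrightarrow> e \<in> spec S (energy lam v U S) (sball S r z \<inter> ?Om) \<Longrightarrow> \<bar>e - E\<bar> \<ge> res_width ?L"
          for z v E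
        proof -
          define X where "X = {w \<in> B z. sing S ?Om (energy lam v U S) E l w (growth M l)}"
          have fX: "finite X" unfolding X_def using fB by auto
          obtain Z where Z: "Z \<subseteq> X" "\<And>z w. z \<in> Z \<Longrightarrow> w \<in> Z \<Longrightarrow> z \<noteq> w \<Longrightarrow> \<not> near S (K * l) z w"
            "\<And>x. x \<in> X \<Longrightarrow> \<exists>z\<in>Z. sdist S x z \<le> K * l"
            using separated_net[OF S(1) fX, of "K * l"] by metis
          have fZ: "finite Z" using Z(1) fX by (rule finite_subset)
          have cZ: "card Z \<le> 6"
          proof (rule ccontr)
            assume "\<not> ?thesis"
            hence "7 \<le> card Z" by simp
            then obtain Y where Y: "Y \<subseteq> Z" "card Y = 7" by (meson obtain_subset_with_card_n)
            have "Y \<subseteq> B z \<and> card Y = 7 \<and> (\<forall>z\<in>Y. \<forall>w\<in>Y. z \<noteq> w \<longrightarrow> \<not> near S ((8 * card S + 2) * l) z w) \<and>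
               (\<forall>z\<in>Y. sing S ?Om (energy lam v U S) E l z (growth M l))"
              using Y Z(1,2) unfolding X_def K_def N_def by blast
            hence "v \<in> many_sing U M S lam ?Om l (B z)" unfolding many_sing_def by blast
            thus False using nv by simp
          qed
          show ?thesis
          proof (rule scale_step_not_sing[OF S(1) region_confs z res_width_pos nr fZ cZ, where l = l and Q = "growth M l" and k = "K * l"
                and \<Phi> = "exp (2 * sqrt ?x)" and n = "l - (12 * K + 7)"])
            show "\<exists>z0\<in>Z. sdist S w z0 \<le> K * l"
              if "w \<in> sball S ?L z \<inter> ?Om" "sing S ?Om (energy lam v U S) E l w (growth M l)" for w
              using Z(3) that unfolding X_def B_def by blast
            have "(real (card (sball S ?L z)))\<^sup>2 * (2 * real (card S)) / res_width ?L \<le>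
              (real ((N * (2 * ?L + 1)) ^ N))\<^sup>2 * (2 * real N) / res_width ?L"
              unfolding N_def using sball_finite_card(2)[OF S(1), of ?L z] res_width_pos[of ?L]
              by (intro divide_right_mono mult_right_mono power_mono of_nat_mono) auto
            thus "(real (card (sball S ?L z)))\<^sup>2 * (2 * real (card S)) / res_width ?L \<le> exp (2 * sqrt ?x)"
              using elim(4) by linarith
            \<comment> \<open>Giving up \<open>12 * K\<close> steps pays for the bad radii, about
              \<open>12 * K * l\<close> in number. The further \<open>7\<close> cover the excess
              length two of each step and the additive constants.\<close>
            show "(l - (12 * K + 7)) * (l + 2) + 6 * (2 * (K * l) + 1) \<le> ?L + 1"
            proof -
              obtain n where n: "l = n + (12 * K + 7)" using elim(4) le_Suc_ex[of "12 * K + 7" l] by (metis add.commute)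
              have "n * (l + 2) + 6 * (2 * (K * l) + 1) \<le> l * l + 1"
              proof -
                have "l * l = n * l + 12 * (K * l) + 7 * l" using n by (metis add_mult_distrib mult.assoc add.assoc)
                moreover have "2 * n \<le> 2 * l" using n by simp
                ultimately show ?thesis using x(2) by (simp add: algebra_simps)
              qed
              thus ?thesis using n by simp
            qed
            show "(exp (2 * sqrt ?x) / growth M l) ^ (l - (12 * K + 7)) * (exp (2 * sqrt ?x) * growth M ?L) < 1"
              using elim(4) by blast
          qed (use growth_pos[of M l] growth_pos[of M ?L] in auto)
        qed
        have "sing_pair U M S lam ?Om ?L x1 x2 \<subseteq> resonant U S lam ?Om ?L x1 x2 \<union> many_sing U M S lam ?Om l (B x1) \<union> many_sing U M S lam ?Om l (B x2)"
        proof (rule subsetI, rule ccontr)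
          fix v assume v: "v \<in> sing_pair U M S lam ?Om ?L x1 x2"
            and no: "v \<notin> resonant U S lam ?Om ?L x1 x2 \<union> many_sing U M S lam ?Om l (B x1) \<union> many_sing U M S lam ?Om l (B x2)"
          obtain E where E: "sing S ?Om (energy lam v U S) E ?L x1 (growth M ?L)" "sing S ?Om (energy lam v U S) E ?L x2 (growth M ?L)"
            using v unfolding sing_pair_def by blast
          have "\<exists>r\<le>?L. \<exists>e\<in>spec S (energy lam v U S) (sball S r x1 \<inter> ?Om). \<bar>e - E\<bar> < res_width ?L"
            using det[OF x1, of v E] no E(1) by (meson UnCI not_le)
          moreover have "\<exists>r\<le>?L. \<exists>e\<in>spec S (energy lam v U S) (sball S r x2 \<inter> ?Om). \<bar>e - E\<bar> < res_width ?L"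
            using det[OF x2, of v E] no E(2) by (meson UnCI not_le)
          ultimately obtain r1 e1 r2 e2 where r: "r1 \<le> ?L" "e1 \<in> spec S (energy lam v U S) (sball S r1 x1 \<inter> ?Om)" "\<bar>e1 - E\<bar> < res_width ?L"
            "r2 \<le> ?L" "e2 \<in> spec S (energy lam v U S) (sball S r2 x2 \<inter> ?Om)" "\<bar>e2 - E\<bar> < res_width ?L" by blast
          have "\<bar>e1 - e2\<bar> \<le> 2 * res_width ?L" using r(3,6) by linarith
          hence "v \<in> resonant U S lam ?Om ?L x1 x2" unfolding resonant_def using r by blast
          thus False using no by simp
        qed
        moreover have "small (resonant U S lam ?Om ?L x1 x2 \<union> many_sing U M S lam ?Om l (B x1) \<union> many_sing U M S lam ?Om l (B x2))
           (real ?L powr - (P + 1) + c3 + c3)"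
          using elim(1) lam far by (intro small_Un ev) blast
        \<comment> \<open>Relative to the target the two copies of \<open>c3\<close> amount to
          \<open>8 / l\<close> and the resonances to \<open>l powr - 2\<close>; this is where
          \<open>l \<ge> 10\<close> enters.\<close>
        moreover have "real ?L powr - (P + 1) + c3 + c3 \<le> real ?L powr - P"
        proof -
          have L: "real ?L powr b = ?x powr (2 * b)" for b
          proof -
            have "real ?L powr b = (?x powr 2) powr b" using x by (simp add: powr_numeral power2_eq_square)
            thus ?thesis unfolding powr_powr .
          qed
          have e2: "?x powr (2 * - (P + 1)) = ?x powr (2 * - P) * ?x powr - 2" by (simp add: powr_add[symmetric] algebra_simps)
          have e1: "?x powr - (2 * P + 1) = ?x powr (2 * - P) * ?x powr - 1"
            by (simp only: powr_add[symmetric]) (simp add: algebra_simps)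
          have i1: "?x powr - 1 \<le> 1 / 10" using x by (simp add: powr_minus_divide field_simps)
          have "?x powr - 2 \<le> ?x powr - 1" using x by (intro powr_mono) auto
          hence "?x powr - 2 + 8 * ?x powr - 1 \<le> 1" using i1 by linarith
          hence "?x powr (2 * - P) * (?x powr - 2 + 8 * ?x powr - 1) \<le> ?x powr (2 * - P) * 1" by (intro mult_left_mono) auto
          thus ?thesis unfolding L c3_def e1 e2 by (simp add: algebra_simps)
        qed
        ultimately have "small (sing_pair U M S lam ?Om ?L x1 x2) (real ?L powr - P)" using small_mono by blast
        thus "measure \<mu> (sing_pair U M S lam ?Om ?L x1 x2) \<le> real ?L powr - P" by (rule small_borel[OF _ sing_pair_event_borel[OF S(1)]])
      qed
    qed
  qed
qed

text \<open>The nested filters let the disorder threshold depend on the initial scale. All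
  \<open>m\<close> and \<open>p\<close> are quantified inside, because the induction invokes smaller
  systems with larger values of both.\<close>

definition disorder_localized :: "(int \<Rightarrow> real) \<Rightarrow> real \<Rightarrow> nat set \<Rightarrow> bool" where
  "disorder_localized U \<tau> S \<longleftrightarrow> (\<forall>m>0. \<forall>p>0. \<forall>\<^sub>F L0 in at_top. \<forall>\<^sub>F lam in at_top. \<forall>L\<ge>L0. \<forall>lo hi a.
     region S lo hi \<subseteq> sball S (nat \<lfloor>L\<rfloor>) a \<longrightarrow>
     small {v. \<not> centre_localized \<tau> S (energy lam v U S) (region S lo hi) L m} (L powr - p))"

text \<open>After the initial pair estimate, \<open>scale_step\<close> needs only
  \<open>lam \<ge> 1\<close> and localization of the smaller systems at the current scale. There are
  finitely many of these, so one threshold for \<open>lam\<close> serves all scales.\<close>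

lemma all_scales:
  assumes S: "finite S" "S \<noteq> {}" and M: "M > 0" and \<tau>: "\<tau> < 1" and U: "finite {u. U u \<noteq> 0}"
    and P: "P \<ge> 18 * real (card S) + 1"
    and IH: "\<And>J. J \<subset> S \<Longrightarrow> J \<noteq> {} \<Longrightarrow> disorder_localized U \<tau> J"
  shows "\<forall>\<^sub>F l0 in sequentially. \<forall>\<^sub>F lam in at_top. \<forall>k. pair_estimate U M P S lam (l0 ^ (2 ^ k))"
proof -
  define p where "p = 2 * P + 3 * real (card S) + 2"
  have p: "p > 0" using P unfolding p_def by simp
  have ev1: "\<forall>\<^sub>F l0 in sequentially. \<forall>J\<in>{J. J \<subset> S \<and> J \<noteq> {}}. \<forall>\<^sub>F lam in at_top. \<forall>l\<ge>l0. scale_localized U \<tau> (4 * M) p J lam l"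
  proof (rule eventually_ball_finite)
    show "finite {J. J \<subset> S \<and> J \<noteq> {}}" using S by (auto intro: finite_subset[of _ "Pow S"])
    show "\<forall>J\<in>{J. J \<subset> S \<and> J \<noteq> {}}. \<forall>\<^sub>F l0 in sequentially. \<forall>\<^sub>F lam in at_top. \<forall>l\<ge>l0. scale_localized U \<tau> (4 * M) p J lam l"
    proof
      fix J assume J: "J \<in> {J. J \<subset> S \<and> J \<noteq> {}}"
      have "\<forall>\<^sub>F L0 in at_top. \<forall>\<^sub>F lam in at_top. \<forall>L\<ge>L0. \<forall>lo hi a. region J lo hi \<subseteq> sball J (nat \<lfloor>L\<rfloor>) a \<longrightarrow>
          small {v. \<not> centre_localized \<tau> J (energy lam v U J) (region J lo hi) L (4 * M)} (L powr - p)"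
        using IH J M p unfolding disorder_localized_def by simp
      from eventually_compose_filterlim[OF this filterlim_real_sequentially]
      show "\<forall>\<^sub>F l0 in sequentially. \<forall>\<^sub>F lam in at_top. \<forall>l\<ge>l0. scale_localized U \<tau> (4 * M) p J lam l"
      proof eventually_elim
        case (elim l0)
        thus ?case
        proof eventually_elim
          case (elim lam)
          show ?case unfolding scale_localized_def
          proof (intro allI impI)
            fix l lo hi a assume "l0 \<le> l" "region J lo hi \<subseteq> sball J l a"
            thus "small {v. \<not> centre_localized \<tau> J (energy lam v U J) (region J lo hi) (real l) (4 * M)} (real l powr - p)"
              using elim[rule_format, of "real l" lo hi a] by simp
          qed
        qed
      qed
    qed
  qed
  obtain ls where ls: "\<And>l lam. l \<ge> ls \<Longrightarrow> lam \<ge> 1 \<Longrightarrow>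
     (\<forall>J. J \<subset> S \<longrightarrow> J \<noteq> {} \<longrightarrow> scale_localized U \<tau> (4 * M) p J lam l) \<Longrightarrow> pair_estimate U M P S lam l \<Longrightarrow> pair_estimate U M P S lam (l * l)"
    using scale_step[OF S M \<tau> U P] unfolding eventually_sequentially p_def by blast
  show ?thesis
    using ev1 start_scale[OF S M, of U P] eventually_ge_at_top[of "max 1 ls"]
  proof eventually_elim
    case (elim l0)
    have "\<forall>\<^sub>F lam in at_top. \<forall>J\<in>{J. J \<subset> S \<and> J \<noteq> {}}. \<forall>l\<ge>l0. scale_localized U \<tau> (4 * M) p J lam l"
      using elim(1) S(1) by (intro eventually_ball_finite) (auto intro: finite_subset[of _ "Pow S"])
    with elim(2) eventually_ge_at_top[of "1::real"] show ?case
    proof eventually_elim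
      case (elim lam)
      have l0: "l0 \<ge> 1" "l0 \<ge> ls" using \<open>max 1 ls \<le> l0\<close> by auto
      show ?case
      proof
        fix k show "pair_estimate U M P S lam (l0 ^ (2 ^ k))"
        proof (induction k)
          case 0 thus ?case using elim(1) by simp
        next
          case (Suc k)
          have ge: "l0 \<le> l0 ^ (2 ^ k)" using l0(1) self_le_power[of l0 "2 ^ k"] by simp
          have "pair_estimate U M P S lam (l0 ^ (2 ^ k) * l0 ^ (2 ^ k))"
            using ge l0(2) elim(2,3) Suc by (intro ls) auto
          moreover have "l0 ^ (2 ^ k) * l0 ^ (2 ^ k) = l0 ^ (2 ^ Suc k)" by (simp add: power_add[symmetric] mult_2)
          ultimately show ?case by simp
        qed
      qed
    qed
  qed
qed

text \<open>For given \<open>L\<close> a scale with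
  \<open>l \<le> L powr (\<tau> / 2) < l * l\<close> is used. Then
  \<open>l * l \<le> L powr \<tau>\<close>, so the neighbourhood of radius \<open>K * l\<close> of a
  singular centre is a small fraction of the distances in question, and
  \<open>l \<ge> L powr (\<tau> / 4)\<close>, so powers of \<open>l\<close> are powers of
  \<open>L\<close>.\<close>

lemma localization_step:
  assumes S: "finite S" "S \<noteq> {}" and \<tau>: "0 < \<tau>" "\<tau> < 1" and U: "finite {u. U u \<noteq> 0}"
    and IH: "\<And>J. J \<subset> S \<Longrightarrow> J \<noteq> {} \<Longrightarrow> disorder_localized U \<tau> J"
  shows "disorder_localized U \<tau> S"
  unfolding disorder_localized_def
proof (intro allI impI)
  fix m p :: real assume m: "m > 0" and p: "p > 0"
  define N where "N = card S"
  define K where "K = 8 * N + 2"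
  \<comment> \<open>The first bound is the one of \<open>scale_step\<close>. The second lets
    \<open>l powr - P\<close> beat the at most \<open>L powr (4 * N)\<close> pairs of centres and
    leave \<open>L powr - p\<close>.\<close>
  define P where "P = max (18 * real N + 1) (4 * (p + 4 * real N) / \<tau>)"
  \<comment> \<open>This keeps the first scale below \<open>L powr (\<tau> / 2)\<close> for every
    \<open>L \<ge> L0\<close>, and it tends to infinity with \<open>L0\<close>.\<close>
  define l0 where "l0 = (\<lambda>L0::real. nat \<lfloor>L0 powr (\<tau> / 2)\<rfloor>)"
  have fl: "filterlim l0 sequentially at_top"
  proof -
    have "filterlim (\<lambda>L0::real. L0 powr (\<tau> / 2)) at_top at_top" using \<tau> by real_asymp
    thus ?thesis unfolding l0_def
      by (rule filterlim_compose[OF filterlim_nat_sequentially, OF filterlim_compose[OF filterlim_floor_sequentially]])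
  qed
  have "\<forall>\<^sub>F l0 in sequentially. \<forall>\<^sub>F lam in at_top. \<forall>k. pair_estimate U (2 * m) P S lam (l0 ^ (2 ^ k))"
    using m by (intro all_scales[OF S _ \<tau>(2) U _ IH]) (auto simp: P_def N_def)
  from eventually_compose_filterlim[OF this fl] eventually_compose_filterlim[OF eventually_ge_at_top[of "2 * K + 8"] fl]
    eventually_ge_at_top[of "max 1 (3 * real N)"]
  show "\<forall>\<^sub>F L0 in at_top. \<forall>\<^sub>F lam in at_top. \<forall>L\<ge>L0. \<forall>lo hi a.
     region S lo hi \<subseteq> sball S (nat \<lfloor>L\<rfloor>) a \<longrightarrow>
     small {v. \<not> centre_localized \<tau> S (energy lam v U S) (region S lo hi) L m} (L powr - p)"
  proof eventually_elim
    case (elim L0)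
    note l0b = elim(2) and L0b = elim(3)
    from elim(1) show ?case
    proof eventually_elim
      case (elim lam)
      show ?case
      proof (intro allI impI)
        fix L lo hi a assume L: "L0 \<le> L" and sub: "region S lo hi \<subseteq> sball S (nat \<lfloor>L\<rfloor>) a"
        let ?Om = "region S lo hi"
        have L1: "L \<ge> 1" "L \<ge> 3 * real N" using L L0b by auto
        define T where "T = L powr (\<tau> / 2)"
        have fOm: "finite ?Om" using finite_subset[OF sub sball_finite_card(1)[OF S(1)]] .
        have T0: "real (l0 L0) \<le> T"
        proof -
          have "real (l0 L0) \<le> L0 powr (\<tau> / 2)" unfolding l0_def by simp
          also have "\<dots> \<le> T" unfolding T_def using L L0b \<tau> by (intro powr_mono2) auto
          finally show ?thesis .
        qed
        have l02: "l0 L0 \<ge> 2" using l0b by simp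
        obtain k where k: "real (l0 L0 ^ (2 ^ k)) \<le> T" "T < real (l0 L0 ^ (2 ^ Suc k))"
        proof -
          have "\<exists>k. T < real (l0 L0 ^ (2 ^ k))"
          proof -
            obtain n where n: "T < 2 ^ n" using real_arch_pow[of 2 T] by auto
            have "(2::nat) ^ n \<le> l0 L0 ^ (2 ^ n)"
              using l02 by (meson less_exp less_imp_le_nat order_trans power_increasing power_mono one_le_numeral zero_le)
            hence "real (2 ^ n) \<le> real (l0 L0 ^ (2 ^ n))" by (rule of_nat_mono)
            thus ?thesis using n by (intro exI[of _ n]) simp
          qed
          then obtain k where k: "T < real (l0 L0 ^ (2 ^ k))" "\<And>j. j < k \<Longrightarrow> \<not> T < real (l0 L0 ^ (2 ^ j))"
            using exists_least_iff[of "\<lambda>k. T < real (l0 L0 ^ (2 ^ k))"] by blast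
          have "k \<noteq> 0" using k(1) T0 by (metis not_le power_0 power_one_right)
          then obtain j where j: "k = Suc j" by (cases k) auto
          have "\<not> T < real (l0 L0 ^ (2 ^ j))" using k(2)[of j] j by simp
          thus ?thesis using k(1) j by (intro that[of j]) (simp_all only: not_less)
        qed
        define l where "l = l0 L0 ^ (2 ^ k)"
        have lT: "real l \<le> T" "T < real l * real l"
        proof -
          have "l0 L0 ^ (2 ^ Suc k) = l * l" unfolding l_def by (simp add: power_add[symmetric] mult_2)
          hence "real (l0 L0 ^ (2 ^ Suc k)) = real l * real l" by (simp only: of_nat_mult)
          thus "real l \<le> T" "T < real l * real l" using k unfolding l_def by (simp_all only:)
        qed
        have lK: "2 * K + 8 \<le> l"
        proof -
          have "l0 L0 \<le> l" unfolding l_def using l02 by (intro self_le_power) auto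
          thus ?thesis using l0b by linarith
        qed
        have lr: "real l \<ge> 1" using lK by simp
        have ps: "pair_estimate U (2 * m) P S lam l" using elim unfolding l_def by blast
        define B where "B = (\<Union>q\<in>{q \<in> ?Om \<times> ?Om. \<not> near S (K * l) (fst q) (snd q)}. sing_pair U (2 * m) S lam ?Om l (fst q) (snd q))"
        have "small B (real (card {q \<in> ?Om \<times> ?Om. \<not> near S (K * l) (fst q) (snd q)}) * real l powr - P)"
          unfolding B_def
        proof (rule small_UN)
          show "finite {q \<in> ?Om \<times> ?Om. \<not> near S (K * l) (fst q) (snd q)}" using fOm by auto
          fix q assume q: "q \<in> {q \<in> ?Om \<times> ?Om. \<not> near S (K * l) (fst q) (snd q)}"
          show "small (sing_pair U (2 * m) S lam ?Om l (fst q) (snd q)) (real l powr - P)"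
            using q ps unfolding pair_estimate_def K_def N_def by (intro small_measure sing_pair_event_borel[OF S(1)]) auto
        qed
        hence sB: "small B (L powr - p)"
        proof (rule small_mono[OF _ order_refl])
          have "card {q \<in> ?Om \<times> ?Om. \<not> near S (K * l) (fst q) (snd q)} \<le> card (?Om \<times> ?Om)"
            using fOm by (intro card_mono) auto
          also have "\<dots> \<le> card (sball S (nat \<lfloor>L\<rfloor>) a) ^ 2"
            using card_mono[OF sball_finite_card(1)[OF S(1)] sub] by (simp add: card_cartesian_product power2_eq_square mult_mono)
          also have "\<dots> \<le> ((N * (2 * nat \<lfloor>L\<rfloor> + 1)) ^ N) ^ 2"
            unfolding N_def by (intro power_mono sball_finite_card(2)[OF S(1)]) auto
          finally have "real (card {q \<in> ?Om \<times> ?Om. \<not> near S (K * l) (fst q) (snd q)}) \<le> real (((N * (2 * nat \<lfloor>L\<rfloor> + 1)) ^ N) ^ 2)"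
            by (rule of_nat_mono)
          also have "\<dots> = (real N * (2 * real (nat \<lfloor>L\<rfloor>) + 1)) ^ (2 * N)" by (simp add: power_mult[symmetric] mult.commute algebra_simps)
          also have "\<dots> \<le> (L * L) ^ (2 * N)"
          proof (intro power_mono)
            have "real (nat \<lfloor>L\<rfloor>) \<le> L" using L1 by simp
            hence "2 * real (nat \<lfloor>L\<rfloor>) + 1 \<le> 3 * L" using L1 by linarith
            hence "real N * (2 * real (nat \<lfloor>L\<rfloor>) + 1) \<le> real N * (3 * L)" by (intro mult_left_mono) auto
            also have "\<dots> = 3 * real N * L" by simp
            also have "\<dots> \<le> L * L" using L1 by (intro mult_right_mono) auto
            finally show "real N * (2 * real (nat \<lfloor>L\<rfloor>) + 1) \<le> L * L" .
          qed simp
          also have "\<dots> = L ^ (4 * N)" by (simp add: power_mult_distrib power_add[symmetric])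
          also have "\<dots> = L powr (4 * real N)" using L1 by (simp add: powr_realpow[symmetric])
          finally have c: "real (card {q \<in> ?Om \<times> ?Om. \<not> near S (K * l) (fst q) (snd q)}) \<le> L powr (4 * real N)" .
          have P0: "P > 0" unfolding P_def by (simp add: less_max_iff_disj)
          have "real l powr - P \<le> (L powr (\<tau> / 4)) powr - P"
          proof -
            have "L powr (\<tau> / 4) \<le> real l"
            proof (rule power2_le_imp_le)
              have "(L powr (\<tau> / 4))\<^sup>2 = T" unfolding T_def by (simp add: power2_eq_square powr_add[symmetric])
              thus "(L powr (\<tau> / 4))\<^sup>2 \<le> (real l)\<^sup>2" using lT by (simp add: power2_eq_square)
            qed simp
            thus ?thesis using P0 L1 by (intro powr_mono2') auto
          qed
          also have "\<dots> = L powr (- (P * \<tau> / 4))" by (simp add: powr_powr mult_ac)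
          also have "\<dots> \<le> L powr (- (p + 4 * real N))"
          proof (intro powr_mono)
            have "4 * (p + 4 * real N) / \<tau> \<le> P" unfolding P_def by simp
            hence "p + 4 * real N \<le> P * \<tau> / 4" using \<tau> by (simp add: field_simps)
            thus "- (P * \<tau> / 4) \<le> - (p + 4 * real N)" by simp
          qed (use L1 in auto)
          finally have d: "real l powr - P \<le> L powr (- (p + 4 * real N))" .
          have "real (card {q \<in> ?Om \<times> ?Om. \<not> near S (K * l) (fst q) (snd q)}) * real l powr - P
             \<le> L powr (4 * real N) * L powr (- (p + 4 * real N))" using c d by (intro mult_mono) auto
          also have "\<dots> = L powr - p" by (simp add: powr_add[symmetric])
          finally show "real (card {q \<in> ?Om \<times> ?Om. \<not> near S (K * l) (fst q) (snd q)}) * real l powr - P \<le> L powr - p" .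
        qed
        have "centre_localized \<tau> S (energy lam v U S) ?Om L m" if v: "v \<notin> B" for v
          unfolding centre_localized_def
        proof (intro allI impI)
          fix f e assume f: "sol S ?Om (energy lam v U S) e ?Om f \<and> (\<Sum>y\<in>?Om. f y * f y) = 1"
          let ?Q = "growth (2 * m) l"
          have Qe: "?Q \<ge> exp (2 * m * real l)"
          proof -
            have "2 * m * 1 * real l \<le> 2 * m * (1 + real l powr (-1/4)) * real l"
              using m by (intro mult_right_mono mult_left_mono) auto
            thus ?thesis unfolding growth_def by simp
          qed
          have "exp (2 * m * real l) > 1" using m lr by simp
          hence Q1: "?Q > 1" using Qe by linarith
          have cl: "sdist S z w \<le> K * l" if "z \<in> ?Om" "w \<in> ?Om" "sing S ?Om (energy lam v U S) e l z ?Q" "sing S ?Om (energy lam v U S) e l w ?Q" for z w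
          proof (rule ccontr)
            assume "\<not> ?thesis"
            hence "(z, w) \<in> {q \<in> ?Om \<times> ?Om. \<not> near S (K * l) (fst q) (snd q)}" using that near_iff_sdist[OF S(1)] by auto
            moreover have "v \<in> sing_pair U (2 * m) S lam ?Om l z w" unfolding sing_pair_def using that(3,4) by blast
            ultimately have "v \<in> B" unfolding B_def by force
            thus False using v by simp
          qed
          obtain z where z: "z \<in> ?Om" "\<And>y n. y \<in> ?Om \<Longrightarrow> n * (l + 1) + K * l < sdist S y z \<Longrightarrow> \<bar>f y\<bar> \<le> (1 / ?Q) ^ n"
            using eigenfunction_decay[OF S(1) region_confs fOm conjunct1[OF f] conjunct2[OF f] Q1 cl] by blast
          show "\<exists>z\<in>?Om. \<forall>y\<in>?Om. L powr \<tau> \<le> real (sdist S y z) \<longrightarrow> \<bar>f y\<bar> \<le> exp (- m * real (sdist S y z))"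
          proof (intro bexI[OF _ z(1)] ballI impI)
            fix y assume y: "y \<in> ?Om" and Dy: "L powr \<tau> \<le> real (sdist S y z)"
            define D where "D = sdist S y z"
            have "T * T = L powr \<tau>" unfolding T_def by (simp add: powr_add[symmetric])
            moreover have "real l * real l \<le> T * T" using lT by (intro mult_mono) auto
            ultimately have "real (l * l) \<le> real D" using Dy unfolding D_def by simp
            hence lD: "l * l \<le> D" by (simp only: of_nat_le_iff)
            \<comment> \<open>The number of complete steps of length \<open>l + 1\<close> that fit
              strictly outside the neighbourhood of radius \<open>K * l\<close> of
              \<open>z\<close>.\<close>
            define n where "n = (D - K * l - 1) div (l + 1)"
            have KD: "K * l + 1 \<le> D"
            proof -
              have "K * l + 1 \<le> l * l"
              proof -
                have "(K + 1) * l \<le> l * l" using lK by (intro mult_right_mono) auto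
                moreover have "K * l + 1 \<le> (K + 1) * l" using lK by simp
                ultimately show ?thesis by linarith
              qed
              thus ?thesis using lD by linarith
            qed
            have n1: "n * (l + 1) \<le> D - K * l - 1" unfolding n_def by (rule div_times_less_eq_dividend)
            have n2: "D - K * l - 1 < (n + 1) * (l + 1)" unfolding n_def
              using dividend_less_div_times[of "l + 1" "D - K * l - 1"] by simp
            have "n * (l + 1) + K * l < sdist S y z" using n1 KD unfolding D_def by linarith
            hence fb: "\<bar>f y\<bar> \<le> (1 / ?Q) ^ n" using z(2) y by blast
            \<comment> \<open>The \<open>n\<close> gains account for at least half of the distance;
              the rate \<open>2 * m\<close> in the pair estimates was chosen to make up for
              this.\<close>
            have half: "real D \<le> 2 * (real l * real n)"
            proof -
              have "D < (n + 1) * (l + 1) + K * l + 1" using n2 KD by linarith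
              hence "D \<le> n * (l + 1) + l + 1 + K * l" by simp
              hence a: "real D \<le> real n * (real l + 1) + (real K + 1) * real l + 1"
                by (simp add: algebra_simps flip: of_nat_mult of_nat_add)
              have b: "real l * real l \<le> real D" using lD by (simp flip: of_nat_mult)
              have c: "2 * real K + 8 \<le> real l" using of_nat_mono[OF lK, where 'a = real] by simp
              have "real l * real D \<le> real l * (real n * (real l + 1) + (real K + 1) * real l + 1)" using a by (intro mult_left_mono) auto
              hence d: "2 * (real l * real D) \<le> 2 * (real l * real n) * (real l + 1) + real l * ((2 * real K + 2) * real l + 2)"
                by (simp add: algebra_simps)
              have "(2 * real K + 2) * real l + 2 \<le> (real l - 6) * real l + 2" using c by (intro add_right_mono mult_right_mono) auto
              also have "\<dots> \<le> (real l - 1) * real l" using lr by (simp add: algebra_simps)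
              finally have "real l * ((2 * real K + 2) * real l + 2) \<le> real l * ((real l - 1) * real l)" by (intro mult_left_mono) auto
              also have "\<dots> = (real l - 1) * (real l * real l)" by simp
              also have "\<dots> \<le> (real l - 1) * real D" using b lr by (intro mult_left_mono) auto
              finally have "(real l + 1) * real D \<le> (real l + 1) * (2 * (real l * real n))" using d by (simp add: algebra_simps)
              thus ?thesis by (rule mult_left_le_imp_le) simp
            qed
            have "(1 / ?Q) ^ n \<le> (1 / exp (2 * m * real l)) ^ n"
              using Qe Q1 by (intro power_mono divide_left_mono) auto
            also have "\<dots> = exp (- (2 * m * real l)) ^ n" by (simp add: exp_minus divide_inverse)
            also have "\<dots> = exp (real n * - (2 * m * real l))" by (simp only: exp_of_nat_mult)
            also have "\<dots> \<le> exp (- m * real D)"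
            proof -
              have "m * real D \<le> m * (2 * (real l * real n))" using half m by (intro mult_left_mono) auto
              thus ?thesis by (simp add: algebra_simps)
            qed
            finally show "\<bar>f y\<bar> \<le> exp (- m * real (sdist S y z))" using fb unfolding D_def by linarith
          qed
        qed
        hence "{v. \<not> centre_localized \<tau> S (energy lam v U S) ?Om L m} \<subseteq> B" by blast
        thus "small {v. \<not> centre_localized \<tau> S (energy lam v U S) ?Om L m} (L powr - p)" 
          by (rule small_mono[OF sB _ order_refl])
      qed
    qed
  qed
qed

theorem localization:
  assumes "finite S" "S \<noteq> {}" "0 < \<tau>" "\<tau> < 1" "finite {u. U u \<noteq> 0}"
  shows "disorder_localized U \<tau> S"
  using assms(1,2)
proof (induction S rule: finite_psubset_induct)
  case (psubset S)
  show ?case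
    by (rule localization_step[OF psubset.hyps psubset.prems assms(3-5)]) (rule psubset.IH)
qed

end

section \<open>Localization of cubes\<close>

lemma lone_eq_1_iff:
  assumes x: "x \<in> confs {..<N}" and y: "y \<in> confs {..<N}"
  shows "lone N (\<lambda>j. x j - y j) = 1 \<longleftrightarrow> y \<in> neighbours {..<N} x"
proof
  assume one: "lone N (\<lambda>j. x j - y j) = 1"
  have "\<exists>j<N. x j \<noteq> y j"
  proof (rule ccontr)
    assume "\<not> ?thesis"
    hence "(\<Sum>j<N. \<bar>x j - y j\<bar>) = 0" by (intro sum.neutral) auto
    thus False using one unfolding lone_def by simp
  qed
  then obtain j where j: "j < N" "x j \<noteq> y j" by blast
  have s: "(\<Sum>j<N. \<bar>x j - y j\<bar>) = \<bar>x j - y j\<bar> + (\<Sum>i\<in>{..<N} - {j}. \<bar>x i - y i\<bar>)"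
    using j by (subst sum.remove[of _ j]) auto
  have nn: "0 \<le> (\<Sum>i\<in>{..<N} - {j}. \<bar>x i - y i\<bar>)" by (intro sum_nonneg) auto
  have d: "\<bar>x j - y j\<bar> = 1" and z: "(\<Sum>i\<in>{..<N} - {j}. \<bar>x i - y i\<bar>) = 0"
    using one s nn j(2) unfolding lone_def by linarith+
  have rest: "\<bar>x i - y i\<bar> = 0" if "i \<in> {..<N} - {j}" for i
    using z that by (subst (asm) sum_nonneg_eq_0_iff) auto
  have "y i = (x(j := y j)) i" for i
  proof (cases "i \<in> {..<N} - {j}")
    case True thus ?thesis using rest[OF True] by auto
  next
    case False thus ?thesis using x y unfolding confs_def by auto
  qed
  hence yx: "y = x(j := y j)" by (rule ext)
  have "y j = x j + 1 \<or> y j = x j - 1" using d by linarith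
  hence "y = x(j := x j + 1) \<or> y = x(j := x j - 1)" using yx by metis
  thus "y \<in> neighbours {..<N} x" unfolding neighbours_def using j(1) by auto
next
  assume "y \<in> neighbours {..<N} x"
  then obtain j where j: "j < N" "y = x(j := x j + 1) \<or> y = x(j := x j - 1)" unfolding neighbours_def by auto
  have "(\<Sum>i<N. \<bar>x i - y i\<bar>) = (\<Sum>i<N. if i = j then 1 else 0)" using j by (intro sum.cong) auto
  thus "lone N (\<lambda>j. x j - y j) = 1" unfolding lone_def using j(1) by simp
qed

lemma ham_eq_ham_kernel:
  assumes "x \<in> confs {..<N}" "y \<in> confs {..<N}"
  shows "ham N lam v U x y = ham_kernel {..<N} (energy lam v U {..<N}) x y"
proof -
  have h: "(\<Sum>j<N. \<Sum>i<j. U (x i - x j)) = (\<Sum>j<N. \<Sum>i\<in>{i \<in> {..<N}. i < j}. U (x i - x j))"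
  proof (rule sum.cong[OF refl])
    fix j assume "j \<in> {..<N}"
    hence "{i \<in> {..<N}. i < j} = {..<j}" by auto
    thus "(\<Sum>i<j. U (x i - x j)) = (\<Sum>i\<in>{i \<in> {..<N}. i < j}. U (x i - x j))" by simp
  qed
  show ?thesis unfolding ham_def ham_kernel_def energy_def lone_eq_1_iff[OF assms] h by simp
qed

lemma sball_eq_region: "sball S l a = region S (\<lambda>t. cnt S a (t - int l)) (\<lambda>t. cnt S a (t + int l))"
  unfolding region_def using sball_iff_cnt by blast

text \<open>The matrix is real, so a real orthonormal eigenbasis serves as a complex one, and each
  member has a localization centre by hypothesis.\<close>

lemma cube_localizing_of_centre_localized:
  assumes N: "N \<ge> 1" and L: "L \<ge> 0"
    and c: "centre_localized \<tau> {..<N} (energy lam v U {..<N}) (sball {..<N} (nat \<lfloor>L\<rfloor>) a) L m"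
  shows "cube_localizing N \<tau> L a m lam v U"
proof -
  let ?S = "{..<N}" and ?W = "energy lam v U {..<N}"
  define X where "X = sball ?S (nat \<lfloor>L\<rfloor>) a"
  have cube: "cube N L a = X" unfolding X_def by (rule cube_eq_sball[OF N L])
  have fX: "finite X" unfolding X_def by (rule sball_finite_card(1)) simp
  have Xc: "X \<subseteq> confs ?S" unfolding X_def sball_def by auto
  obtain \<phi> e where o: "orthofam X X \<phi>" and s: "\<And>i. i \<in> X \<Longrightarrow> sol ?S X ?W (e i) X (\<phi> i)"
    using sol_eigenbasis[OF fX] by metis
  define \<psi> where "\<psi> = (\<lambda>i y. complex_of_real (\<phi> i y))"
  have norm: "(\<Sum>y\<in>X. \<phi> i y * \<phi> i y) = 1" if "i \<in> X" for i using o that unfolding orthofam_def by auto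
  show ?thesis unfolding cube_localizing_def cube
  proof (intro exI[of _ \<psi>] exI[of _ "\<lambda>i. complex_of_real (e i)"] conjI ballI)
    fix i k assume ik: "i \<in> X" "k \<in> X"
    have "(\<Sum>y\<in>X. \<psi> i y * cnj (\<psi> k y)) = complex_of_real (\<Sum>y\<in>X. \<phi> i y * \<phi> k y)"
      unfolding \<psi>_def by simp
    also have "\<dots> = (if i = k then 1 else 0)" using o ik unfolding orthofam_def by simp
    finally show "(\<Sum>y\<in>X. \<psi> i y * cnj (\<psi> k y)) = (if i = k then 1 else 0)" .
  next
    fix i x assume ix: "i \<in> X" "x \<in> X"
    have "(\<Sum>y\<in>X. complex_of_real (ham N lam v U x y) * \<psi> i y) = complex_of_real (\<Sum>y\<in>X. ham_kernel ?S ?W x y * \<phi> i y)"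
    proof -
      have "ham N lam v U x y = ham_kernel ?S ?W x y" if "y \<in> X" for y using ham_eq_ham_kernel Xc ix that by blast
      thus ?thesis unfolding \<psi>_def by simp
    qed
    also have "\<dots> = complex_of_real (e i * \<phi> i x)"
      using s[OF ix(1)] ix(2) ham_kernel_sum[OF fX ix(2)] unfolding sol_def by simp
    finally show "(\<Sum>y\<in>X. complex_of_real (ham N lam v U x y) * \<psi> i y) = complex_of_real (e i) * \<psi> i x"
      unfolding \<psi>_def by simp
  next
    fix i assume i: "i \<in> X"
    obtain z where z: "z \<in> X" "\<And>y. y \<in> X \<Longrightarrow> L powr \<tau> \<le> real (sdist ?S y z) \<Longrightarrow> \<bar>\<phi> i y\<bar> \<le> exp (- m * real (sdist ?S y z))"
      using c[folded X_def] s[OF i] norm[OF i] unfolding centre_localized_def by blast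
    have "x_localizing N \<tau> L a z m (\<psi> i)"
      unfolding x_localizing_def cube dS_eq_sdist[OF N] \<psi>_def using z(2) norm[OF i] by (simp add: power2_eq_square)
    thus "m_localizing N \<tau> L a m (\<psi> i)" unfolding m_localizing_def cube using z(1) by blast
  qed
qed

section \<open>Measurability and law of the localization event\<close>

lemma closed_Collect_Bex_finite:
  assumes "finite X" "\<And>x. x \<in> X \<Longrightarrow> closed {p. P x p}" shows "closed {p. \<exists>x\<in>X. P x p}"
proof -
  have "{p. \<exists>x\<in>X. P x p} = (\<Union>x\<in>X. {p. P x p})" by auto
  thus ?thesis using assms by (simp add: closed_UN)
qed

lemma closed_Collect_const_imp: "closed {p. P p} \<Longrightarrow> closed {p. c \<longrightarrow> P p}"
  by (cases c) simp_all

text \<open>Normalization bounds the eigenvectors by one, the eigenvalues are exhausted by discs of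
  radius \<open>n\<close>, and values outside the cube are set to zero. For each \<open>n\<close>
  the event is then the projection of a closed set along a compact one.\<close>

lemma cube_localizing_borel:
  assumes N: "N \<ge> 1" and L: "L \<ge> 0"
  shows "{v. cube_localizing N \<tau> L a m lam v U} \<in> sets borel"
proof -
  define X where "X = cube N L a"
  have fX: "finite X" unfolding X_def cube_eq_sball[OF N L] by (rule sball_finite_card(1)) simp
  define PP where "PP = (\<lambda>(v :: int \<Rightarrow> real) (w :: (config \<Rightarrow> config \<Rightarrow> complex) \<times> (config \<Rightarrow> complex)).
      (\<forall>i\<in>X. \<forall>k\<in>X. (\<Sum>y\<in>X. fst w i y * cnj (fst w k y)) = (if i = k then 1 else 0)) \<and>
      (\<forall>i\<in>X. \<forall>x\<in>X. (\<Sum>y\<in>X. complex_of_real (ham N lam v U x y) * fst w i y) = snd w i * fst w i x) \<and>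
      (\<forall>i\<in>X. \<exists>x\<in>X. (\<Sum>y\<in>X. (cmod (fst w i y))\<^sup>2) = 1 \<and>
         (\<forall>y\<in>X. L powr \<tau> \<le> dS N y x \<longrightarrow> cmod (fst w i y) \<le> exp (- m * dS N y x))))"
  have iff: "cube_localizing N \<tau> L a m lam v U \<longleftrightarrow> (\<exists>w. PP v w)" for v
    unfolding cube_localizing_def m_localizing_def x_localizing_def PP_def X_def[symmetric] by simp
  define K where "K = (\<lambda>n::nat. Pi\<^sub>E (UNIV :: config set) (\<lambda>_. Pi\<^sub>E (UNIV :: config set) (\<lambda>_. cball (0::complex) 1)) \<times>
     Pi\<^sub>E (UNIV :: config set) (\<lambda>_. cball (0::complex) (real n)))"
  have cK: "compact (K n)" for n unfolding K_def by (intro compact_Times compact_PiE_fun compact_cball)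
  let ?ty = "\<lambda>p :: (int \<Rightarrow> real) \<times> ((config \<Rightarrow> config \<Rightarrow> complex) \<times> (config \<Rightarrow> complex)). p"
  have cphi: "continuous_on UNIV (\<lambda>p. fst (snd (?ty p)) i y)" for i y
    by (rule continuous_on_product_then_coordinatewise[OF continuous_on_product_then_coordinatewise[OF continuous_on_fst[OF continuous_on_snd[OF continuous_on_id]]]])
  have cE: "continuous_on UNIV (\<lambda>p. snd (snd (?ty p)) i)" for i
    by (rule continuous_on_product_then_coordinatewise[OF continuous_on_snd[OF continuous_on_snd[OF continuous_on_id]]])
  have cv: "continuous_on UNIV (\<lambda>p. fst (?ty p) u)" for u
    by (rule continuous_on_product_then_coordinatewise[OF continuous_on_fst[OF continuous_on_id]])
  have cham: "continuous_on UNIV (\<lambda>p. ham N lam (fst (?ty p)) U x y)" for x y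
    unfolding ham_def by (cases "x = y") (auto intro!: continuous_on_add continuous_on_diff continuous_on_mult continuous_on_sum continuous_on_const cv)
  have cl: "closed {p. PP (fst p) (snd p)}" unfolding PP_def
    by (intro closed_Collect_conj closed_Collect_Ball closed_Collect_Bex_finite closed_Collect_const_imp closed_Collect_eq closed_Collect_le fX
        continuous_on_sum continuous_on_mult continuous_on_cnj continuous_on_of_real continuous_on_const
        continuous_on_power continuous_on_norm cphi cE cham)
  have cn: "closed {v. \<exists>w\<in>K n. PP v w}" for n by (rule closed_Collect_Bex_compact[OF cK cl])
  have "{v. cube_localizing N \<tau> L a m lam v U} = (\<Union>n. {v. \<exists>w\<in>K n. PP v w})"
  proof (intro equalityI subsetI)
    fix v assume "v \<in> {v. cube_localizing N \<tau> L a m lam v U}"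
    then obtain w where w: "PP v w" using iff by blast
    define w' where "w' = ((\<lambda>i y. if i \<in> X \<and> y \<in> X then fst w i y else 0), (\<lambda>i. if i \<in> X then snd w i else 0))"
    have "PP v w' = PP v w" unfolding PP_def w'_def by (auto cong: sum.cong ball_cong bex_cong conj_cong)
    hence w': "PP v w'" using w by simp
    define n where "n = nat \<lceil>\<Sum>i\<in>X. cmod (snd w i)\<rceil>"
    have b1: "cmod (fst w' i y) \<le> 1" for i y
    proof (cases "i \<in> X \<and> y \<in> X")
      case True
      have "(\<Sum>y\<in>X. (cmod (fst w i y))\<^sup>2) = 1" using w True unfolding PP_def by blast
      moreover have "(cmod (fst w i y))\<^sup>2 \<le> (\<Sum>y\<in>X. (cmod (fst w i y))\<^sup>2)" using True fX by (intro member_le_sum) auto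
      ultimately have "(cmod (fst w i y))\<^sup>2 \<le> 1" by simp
      hence "cmod (fst w i y) \<le> 1" by (simp add: abs_square_le_1)
      thus ?thesis using True unfolding w'_def by simp
    qed (auto simp: w'_def)
    have b2: "cmod (snd w' i) \<le> real n" for i
    proof (cases "i \<in> X")
      case True
      have "cmod (snd w i) \<le> (\<Sum>i\<in>X. cmod (snd w i))" using True fX by (intro member_le_sum) auto
      thus ?thesis using True unfolding w'_def n_def by simp linarith
    qed (simp add: w'_def)
    have "w' \<in> K n" unfolding K_def mem_Times_iff using b1 b2 by (auto simp: PiE_UNIV_domain)
    thus "v \<in> (\<Union>n. {v. \<exists>w\<in>K n. PP v w})" using w' by blast
  next
    fix v assume "v \<in> (\<Union>n. {v. \<exists>w\<in>K n. PP v w})"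
    thus "v \<in> {v. cube_localizing N \<tau> L a m lam v U}" using iff by blast
  qed
  thus ?thesis using cn by (auto intro!: sets.countable_UN)
qed

text \<open>Independence identifies the joint law of the potential with the product measure, so
  estimates for \<open>\<mu>\<close> hold on every probability space carrying such a
  potential.\<close>

lemma (in anderson) law_of_potential:
  assumes iid: "iid_with_density M V \<rho>" and A: "{v. P v} \<in> sets borel"
  shows "measure M {\<omega> \<in> space M. P (\<lambda>u. V u \<omega>)} = measure \<mu> {v. P v}"
proof -
  have M: "prob_space M" and ind: "prob_space.indep_vars M (\<lambda>_. borel) V UNIV"
    and d: "\<And>u. distributed M lborel (V u) (\<lambda>v. ennreal (\<rho> v))" using iid unfolding iid_with_density_def by auto
  interpret M: prob_space M by (rule M)
  have V: "V u \<in> measurable M borel" for u using d[of u] unfolding distributed_def by simp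
  have dD: "distr M borel (V u) = D" for u
  proof -
    have "distr M borel (V u) = distr M lborel (V u)" by (intro distr_cong) auto
    thus ?thesis using d[of u] unfolding distributed_def D_def by simp
  qed
  let ?f = "\<lambda>\<omega>. \<lambda>u\<in>UNIV. V u \<omega>"
  have "distr M (PiM UNIV (\<lambda>_. borel)) ?f = PiM UNIV (\<lambda>u. distr M borel (V u))"
    using ind M.indep_vars_iff_distr_eq_PiM[where I = UNIV and M' = "\<lambda>_. borel" and X = V] V by simp
  hence law: "distr M (PiM UNIV (\<lambda>_. borel)) ?f = \<mu>" unfolding dD \<mu>_def .
  have "?f \<in> measurable M (PiM UNIV (\<lambda>_. borel))" using V by (intro measurable_restrict) auto
  moreover have "{v. P v} \<in> sets (PiM UNIV (\<lambda>_. borel))" using A by (simp add: sets_PiM_equal_borel)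
  ultimately have "measure (distr M (PiM UNIV (\<lambda>_. borel)) ?f) {v. P v} = measure M (?f -` {v. P v} \<inter> space M)"
    by (rule measure_distr)
  moreover have "?f -` {v. P v} \<inter> space M = {\<omega> \<in> space M. P (\<lambda>u. V u \<omega>)}" by (auto simp: restrict_def)
  ultimately show ?thesis unfolding law by simp
qed

theorem theorem1p3:
  fixes \<beta> \<gamma> \<tau> :: real
    and \<rho> :: "real \<Rightarrow> real" and vmax \<rho>min \<rho>max :: real
    and Uint :: "int \<Rightarrow> real"
    and N :: nat and m p :: real
  assumes "0 < \<beta>" "\<beta> < 1" "0 < \<tau>" "\<tau> < 1"
    and "\<beta> < 1 / \<gamma>" "1 / \<gamma> < 1" "1 < \<gamma>" "\<gamma> < 2"
    and "max (\<gamma> * \<beta>) (1 / \<gamma>) < \<tau>"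
    and "vmax > 0"
    and "\<forall>v. v \<notin> {0..vmax} \<longrightarrow> \<rho> v = 0"
    and "\<rho>min > 0" "\<rho>max > 0"
    and "\<forall>v\<in>{0..vmax}. \<rho>min \<le> \<rho> v \<and> \<rho> v \<le> \<rho>max"
    and "\<exists>\<rho>'. (\<forall>v\<in>{0<..<vmax}. (\<rho> has_real_derivative \<rho>' v) (at v))
              \<and> continuous_on {0<..<vmax} \<rho>' \<and> bounded (\<rho>' ` {0<..<vmax})"
    and "finite {u. Uint u \<noteq> 0}"
    and "N \<ge> 1" "m > 0" "p > 0"
  shows "\<exists>C1. \<forall>L0 \<ge> 1. L0 \<ge> C1 \<longrightarrow>
           (\<exists>C2. \<forall>lam > 0. lam \<ge> C2 \<longrightarrow>
              (\<forall>(M :: 'a measure) V. iid_with_density M V \<rho> \<longrightarrow>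
                 (\<forall>L \<ge> L0.
                    (INF a\<in>configs N.
                       measure M {\<omega> \<in> space M. cube_localizing N \<tau> L a m lam (\<lambda>u. V u \<omega>) Uint})
                    \<ge> 1 - L powr (- p))))"
proof (cases "\<exists>(M :: 'a measure) V. iid_with_density M V \<rho>")
  case False
  thus ?thesis by blast
next
  \<comment> \<open>A potential with this law supplies the measurability and the total mass of
    \<open>\<rho>\<close>, from which the product measure is built. Without any such potential the
    claim is vacuous.\<close>
  case True
  then obtain M0 :: "'a measure" and V0 where iid0: "iid_with_density M0 V0 \<rho>" by blast
  obtain \<rho>' where r': "\<And>v. v \<in> {0<..<vmax} \<Longrightarrow> (\<rho> has_real_derivative \<rho>' v) (at v)" "bounded (\<rho>' ` {0<..<vmax})"
    using assms(15) by blast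
  obtain C where C: "C > 0" "\<And>v. v \<in> {0<..<vmax} \<Longrightarrow> \<bar>\<rho>' v\<bar> \<le> C"
    using r'(2) unfolding bounded_pos by auto
  have lip1: "\<bar>\<rho> x - \<rho> y\<bar> \<le> C * \<bar>x - y\<bar>" if xy: "x \<in> {0<..<vmax}" "y \<in> {0<..<vmax}" "x < y" for x y
  proof -
    have "\<exists>z>x. z < y \<and> \<rho> y - \<rho> x = (y - x) * \<rho>' z"
      by (rule MVT2[OF xy(3)]) (use r'(1) xy in auto)
    then obtain z where z: "z > x" "z < y" "\<rho> y - \<rho> x = (y - x) * \<rho>' z" by blast
    have "\<bar>\<rho> x - \<rho> y\<bar> = \<bar>\<rho>' z\<bar> * \<bar>x - y\<bar>" using z(3) by (metis abs_minus_commute abs_mult mult.commute)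
    also have "\<dots> \<le> C * \<bar>x - y\<bar>" using C(2)[of z] z xy by (intro mult_right_mono) auto
    finally show ?thesis .
  qed
  have nn: "\<rho> v \<ge> 0" for v
  proof (cases "v \<in> {0..vmax}")
    case True
    hence "\<rho>min \<le> \<rho> v" using assms(14) by blast
    thus ?thesis using assms(12) by linarith
  qed (use assms(11) in simp)
  have d0: "distributed M0 lborel (V0 0) (\<lambda>v. ennreal (\<rho> v))" and M0: "prob_space M0"
    using iid0 unfolding iid_with_density_def by auto
  interpret anderson \<rho> vmax \<rho>min \<rho>max C
  proof (rule anderson.intro)
    have "(\<lambda>v. ennreal (\<rho> v)) \<in> borel_measurable borel" using d0 unfolding distributed_def by simp
    hence "(\<lambda>v. enn2real (ennreal (\<rho> v))) \<in> borel_measurable borel" by (rule measurable_compose) measurable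
    thus "\<rho> \<in> borel_measurable borel" using nn by simp
    have "prob_space (distr M0 lborel (V0 0))"
      using d0 unfolding distributed_def by (intro prob_space.prob_space_distr[OF M0]) auto
    thus "prob_space (density lborel (\<lambda>x. ennreal (\<rho> x)))" using d0 unfolding distributed_def by simp
    show "\<bar>\<rho> x - \<rho> y\<bar> \<le> C * \<bar>x - y\<bar>" if "x \<in> {0<..<vmax}" "y \<in> {0<..<vmax}" for x y
      using lip1[of x y] lip1[of y x] that by (cases x y rule: linorder_cases) (auto simp: abs_minus_commute)
  qed (use assms C in auto)
  have ne: "{..<N} \<noteq> {}" using assms(17) by (auto simp: lessThan_empty_iff)
  have "disorder_localized Uint \<tau> {..<N}" by (rule localization) (use assms ne in auto)
  hence "\<forall>\<^sub>F L0 in at_top. \<forall>\<^sub>F lam in at_top. \<forall>L\<ge>L0. \<forall>lo hi a.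
     region {..<N} lo hi \<subseteq> sball {..<N} (nat \<lfloor>L\<rfloor>) a \<longrightarrow>
     small {v. \<not> centre_localized \<tau> {..<N} (energy lam v Uint {..<N}) (region {..<N} lo hi) L m} (L powr - p)"
    using assms(18,19) unfolding disorder_localized_def by blast
  then obtain C1 where C1: "\<And>L0. L0 \<ge> C1 \<Longrightarrow> \<forall>\<^sub>F lam in at_top. \<forall>L\<ge>L0. \<forall>lo hi a.
     region {..<N} lo hi \<subseteq> sball {..<N} (nat \<lfloor>L\<rfloor>) a \<longrightarrow>
     small {v. \<not> centre_localized \<tau> {..<N} (energy lam v Uint {..<N}) (region {..<N} lo hi) L m} (L powr - p)"
    unfolding eventually_at_top_linorder by blast
  show ?thesis
  proof (rule exI[of _ C1], intro allI impI)
    fix L0 :: real assume L0: "1 \<le> L0" "C1 \<le> L0"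
    obtain C2 where C2: "\<And>lam L lo hi a. lam \<ge> C2 \<Longrightarrow> L \<ge> L0 \<Longrightarrow> region {..<N} lo hi \<subseteq> sball {..<N} (nat \<lfloor>L\<rfloor>) a \<Longrightarrow>
       small {v. \<not> centre_localized \<tau> {..<N} (energy lam v Uint {..<N}) (region {..<N} lo hi) L m} (L powr - p)"
      using C1[OF L0(2)] unfolding eventually_at_top_linorder by blast
    show "\<exists>C2. \<forall>lam > 0. lam \<ge> C2 \<longrightarrow>
              (\<forall>(M :: 'a measure) V. iid_with_density M V \<rho> \<longrightarrow>
                 (\<forall>L \<ge> L0.
                    (INF a\<in>configs N.
                       measure M {\<omega> \<in> space M. cube_localizing N \<tau> L a m lam (\<lambda>u. V u \<omega>) Uint})
                    \<ge> 1 - L powr (- p)))"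
    proof (rule exI[of _ C2], intro allI impI)
      fix lam :: real and M :: "'a measure" and V and L :: real
      assume lam: "lam \<ge> C2" and iid: "iid_with_density M V \<rho>" and L: "L0 \<le> L"
      show "1 - L powr (- p) \<le> (INF a\<in>configs N. measure M {\<omega> \<in> space M. cube_localizing N \<tau> L a m lam (\<lambda>u. V u \<omega>) Uint})"
      proof (rule cINF_greatest)
        show "configs N \<noteq> {}" unfolding configs_def by auto
        fix a assume "a \<in> configs N"
        let ?G = "{v. cube_localizing N \<tau> L a m lam v Uint}"
        let ?B = "{v. \<not> centre_localized \<tau> {..<N} (energy lam v Uint {..<N}) (sball {..<N} (nat \<lfloor>L\<rfloor>) a) L m}"
        have L1: "L \<ge> 0" using L L0 by simp
        have G: "?G \<in> sets borel" by (rule cube_localizing_borel[OF assms(17) L1])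
        have "small ?B (L powr - p)"
          using C2[OF lam L, of "\<lambda>t. cnt {..<N} a (t - int (nat \<lfloor>L\<rfloor>))" "\<lambda>t. cnt {..<N} a (t + int (nat \<lfloor>L\<rfloor>))" a]
          unfolding sball_eq_region[symmetric] by blast
        moreover have "- ?G \<subseteq> ?B" using cube_localizing_of_centre_localized[OF assms(17) L1] by blast
        ultimately have "small (- ?G) (L powr - p)" by (rule small_mono) simp
        \<comment> \<open>The event of the theorem is Borel, so the outer bound becomes a bound on
          its probability.\<close>
        hence "measure \<mu> (- ?G) \<le> L powr - p" using G by (intro small_borel) auto
        moreover have "measure \<mu> (- ?G) = 1 - measure \<mu> ?G"
          using mu.prob_compl[of ?G] G by (simp add: Compl_eq_Diff_UNIV)
        ultimately show "1 - L powr (- p) \<le> measure M {\<omega> \<in> space M. cube_localizing N \<tau> L a m lam (\<lambda>u. V u \<omega>) Uint}"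
          using law_of_potential[OF iid G] by linarith
      qed
    qed
  qed
qed

end
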